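(* Let $\kappa>0$ and let $D\subset\mathbb R^2$ be a bounded open set with $C^2$-smooth boundary such that $\mathbb R^2\setminus\overline D$ is connected. Let $n\in L^\infty(\mathbb R^2)$ with $n=1$ outside $D$, $\operatorname{supp}(n-1)=\overline D$, and assume $\Im(n)$ is uniformly positive in $D$, i.e. $\Im(n(x))\ge\alpha>0$ for a.e. $x\in D$. Then the operator $\Im(T)=\frac{1}{2\mathrm i}(T-T^* ):L^2(D)\to L^2(D)$ is coercive, i.e. there is $c>0$ with $(\Im(T)f,f)_{L^2(D)}\ge c\|f\|^2_{L^2(D)}$ for all $f\in L^2(D)$.
   Context: For $f\in L^2(D)$ let $w\in H^2_{\mathrm{loc}}(\mathbb R^2)$ be the unique solution (which exists under the stated assumptions) of $(\Delta^2-\kappa^4 n)w=\kappa^4(n-1)f$ in $\mathbb R^2$ ($f$ extended by zero), with $[\![w]\!]=[\![\partial_\nu w]\!]=[\![\Delta w]\!]=[\![\partial_\nu\Delta w]\!]=0$ on $\partial D$ (jumps of exterior minus interior traces), satisfying the radiation conditions $\lim_{r\to\infty}\sqrt r(\partial_r w-\mathrm i\kappa w)=0$ and $\lim_{r\to\infty}\sqrt r(\partial_r\Delta w-\mathrm i\kappa\Delta w)=0$, $r=|x|$, uniformly in direction. Define $T:L^2(D)\to L^2(D)$ by $Tf=\frac{\kappa^2}{2}(n-1)(f+w)$, and $T^*$ its $L^2(D)$-adjoint. *)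

theory Defs
  imports "HOL-Analysis.Analysis"
begin

type_synonym R2 = "real^2"

definition C2c :: "(R2 \<Rightarrow> real) \<Rightarrow> (R2 \<Rightarrow> R2) \<Rightarrow> (R2 \<Rightarrow> R2 \<Rightarrow> R2) \<Rightarrow> bool" where
  "C2c \<phi> g H \<longleftrightarrow>
     (\<forall>x. (\<phi> has_derivative (\<lambda>v. g x \<bullet> v)) (at x) \<and> (g has_derivative H x) (at x)) \<and>
     (\<forall>v. continuous_on UNIV (\<lambda>x. H x v)) \<and> bounded {x. \<phi> x \<noteq> 0}"

definition lap :: "(R2 \<Rightarrow> R2 \<Rightarrow> R2) \<Rightarrow> R2 \<Rightarrow> real" where
  "lap H x = (\<Sum>i\<in>UNIV. H x (axis i 1) $ i)"

definition locL2 :: "(R2 \<Rightarrow> complex) \<Rightarrow> bool" where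
  "locL2 u \<longleftrightarrow> u \<in> borel_measurable lebesgue \<and>
     (\<forall>K. compact K \<longrightarrow> set_integrable lebesgue K (\<lambda>x. (cmod (u x))^2))"

definition L2_on :: "R2 set \<Rightarrow> (R2 \<Rightarrow> complex) \<Rightarrow> bool" where
  "L2_on D u \<longleftrightarrow> (\<lambda>x. indicator D x * u x) \<in> borel_measurable lebesgue \<and>
     set_integrable lebesgue D (\<lambda>x. (cmod (u x))^2)"

definition ipD :: "R2 set \<Rightarrow> (R2 \<Rightarrow> complex) \<Rightarrow> (R2 \<Rightarrow> complex) \<Rightarrow> complex" where
  "ipD D u v = (LINT x:D|lebesgue. u x * cnj (v x))"

definition H2loc :: "(R2 \<Rightarrow> complex) \<Rightarrow> bool" where
  "H2loc u \<longleftrightarrow> locL2 u \<and>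
     (\<exists>(d1 :: 2 \<Rightarrow> R2 \<Rightarrow> complex) (d2 :: 2 \<Rightarrow> 2 \<Rightarrow> R2 \<Rightarrow> complex).
        (\<forall>i. locL2 (d1 i)) \<and> (\<forall>i j. locL2 (d2 i j)) \<and>
        (\<forall>\<phi> g H. C2c \<phi> g H \<longrightarrow>
           (\<forall>i. (LINT x|lebesgue. u x * of_real (g x $ i))
                 = - (LINT x|lebesgue. d1 i x * of_real (\<phi> x))) \<and>
           (\<forall>i j. (LINT x|lebesgue. u x * of_real (H x (axis j 1) $ i))
                 = (LINT x|lebesgue. d2 i j x * of_real (\<phi> x)))))"

definition ess_supp :: "(R2 \<Rightarrow> complex) \<Rightarrow> R2 set" where
  "ess_supp u = - \<Union>{U. open U \<and> (AE x in lebesgue. x \<in> U \<longrightarrow> u x = 0)}"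

definition C2_boundary :: "R2 set \<Rightarrow> bool" where
  "C2_boundary D \<longleftrightarrow> (\<forall>p\<in>frontier D. \<exists>U \<psi> g H. open U \<and> p \<in> U \<and>
     (\<forall>x\<in>U. (\<psi> has_derivative (\<lambda>v. g x \<bullet> v)) (at x) \<and> (g has_derivative H x) (at x)) \<and>
     (\<forall>v. continuous_on U (\<lambda>x. H x v)) \<and> (\<forall>x\<in>U. g x \<noteq> 0) \<and>
     D \<inter> U = {x\<in>U. \<psi> x < 0})"

text \<open>Radiation conditions for w and \<Delta>w, imposed on the classical (smooth) representative v
  of w near infinity; the limits are uniform in direction (filter at_infinity).\<close>
definition radiating :: "real \<Rightarrow> (R2 \<Rightarrow> complex) \<Rightarrow> bool" where
  "radiating \<kappa> w \<longleftrightarrow> (\<exists>R>0. \<exists>(v :: R2 \<Rightarrow> complex) (gv :: 2 \<Rightarrow> R2 \<Rightarrow> complex)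
       (hv :: 2 \<Rightarrow> 2 \<Rightarrow> R2 \<Rightarrow> complex) (gl :: 2 \<Rightarrow> R2 \<Rightarrow> complex).
     (AE x in lebesgue. norm x > R \<longrightarrow> w x = v x) \<and>
     (\<forall>x. norm x > R \<longrightarrow>
        (v has_derivative (\<lambda>h. \<Sum>i\<in>UNIV. h $ i *\<^sub>R gv i x)) (at x) \<and>
        (\<forall>i. (gv i has_derivative (\<lambda>h. \<Sum>j\<in>UNIV. h $ j *\<^sub>R hv i j x)) (at x)) \<and>
        ((\<lambda>y. \<Sum>i\<in>UNIV. hv i i y) has_derivative (\<lambda>h. \<Sum>j\<in>UNIV. h $ j *\<^sub>R gl j x)) (at x)) \<and>
     ((\<lambda>x. sqrt (norm x) * cmod ((\<Sum>i\<in>UNIV. (x $ i / norm x) *\<^sub>R gv i x)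
                                   - \<i> * of_real \<kappa> * v x)) \<longlongrightarrow> 0) at_infinity \<and>
     ((\<lambda>x. sqrt (norm x) * cmod ((\<Sum>j\<in>UNIV. (x $ j / norm x) *\<^sub>R gl j x)
                                   - \<i> * of_real \<kappa> * (\<Sum>i\<in>UNIV. hv i i x))) \<longlongrightarrow> 0) at_infinity)"

text \<open>w is a radiating solution of (\<Delta>^2 - \<kappa>^4 n) w = \<kappa>^4 (n-1) f in R^2 (f extended by zero),
  w in H^2_loc, equation in the distributional sense on all of R^2 (which encodes the
  transmission conditions across the boundary of D). L is the weak Laplacian of w.\<close>
definition is_sol :: "real \<Rightarrow> (R2 \<Rightarrow> complex) \<Rightarrow> R2 set \<Rightarrow> (R2 \<Rightarrow> complex) \<Rightarrow> (R2 \<Rightarrow> complex) \<Rightarrow> bool" where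
  "is_sol \<kappa> n D f w \<longleftrightarrow> H2loc w \<and>
     (\<exists>L. locL2 L \<and>
        (\<forall>\<phi> g H. C2c \<phi> g H \<longrightarrow>
           (LINT x|lebesgue. w x * of_real (lap H x)) = (LINT x|lebesgue. L x * of_real (\<phi> x)) \<and>
           (LINT x|lebesgue. L x * of_real (lap H x))
             - of_real (\<kappa>^4) * (LINT x|lebesgue. n x * w x * of_real (\<phi> x))
           = of_real (\<kappa>^4) * (LINT x|lebesgue. (n x - 1) * (indicator D x * f x) * of_real (\<phi> x)))) \<and>
     radiating \<kappa> w"

definition T_op :: "real \<Rightarrow> (R2 \<Rightarrow> complex) \<Rightarrow> (R2 \<Rightarrow> complex) \<Rightarrow> (R2 \<Rightarrow> complex) \<Rightarrow> R2 \<Rightarrow> complex" where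
  "T_op \<kappa> n f w x = of_real (\<kappa>^2 / 2) * (n x - 1) * (f x + w x)"

end

theory Submission
  imports Defs
begin

text \<open>
  Put \<open>F = \<kappa>\<^sup>4 (n - 1) (f + w)\<close>, so that \<open>(\<Delta>\<^sup>2 - \<kappa>\<^sup>4) w = F\<close> and \<open>T f = F / (2 \<kappa>\<^sup>2)\<close> on \<open>D\<close>. Writing \<open>f = (f + w) - w\<close>,
  \<open>Im (T f, f) = (\<kappa>\<^sup>2 / 2) \<integral>\<^sub>D Im n |f + w|\<^sup>2 - Im \<integral> F cnj w / (2 \<kappa>\<^sup>2)\<close>, so it suffices that \<open>Im \<integral> F cnj w \<le> 0\<close> and that
  the \<open>L\<^sup>2(D)\<close> norm of \<open>w\<close> is bounded by that of \<open>F\<close>. Now \<open>w = (p - u) / (2 \<kappa>\<^sup>2)\<close> with \<open>(\<Delta> + \<kappa>\<^sup>2) u = F\<close> and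
  \<open>(\<Delta> - \<kappa>\<^sup>2) p = F\<close>, both satisfying the Sommerfeld condition. For \<open>u\<close> the sign is conservation of energy,
  and the bound is a Morawetz identity: the multiplier \<open>2 x \<cdot> \<nabla>u + u\<close> with the weight
  \<open>(1 + \<kappa>\<^sup>2 |x|\<^sup>2) powr (- 1/2)\<close>, combined with the energy flux, gives a divergence that controls \<open>|u|\<^sup>2\<close> and whose
  flux through large circles is nonpositive in the limit. For \<open>p\<close> the energy identity is coercive, so \<open>p\<close> and its
  gradient are square integrable and there is no flux at infinity. All this is done for mollifications, which
  are smooth, with radial cutoffs in place of integrals over circles.
\<close>

subsection \<open>Integration by parts and radial cutoffs\<close>

text \<open>Coercivity asks for one constant for all \<open>f\<close>, so every step is an explicit
  inequality. Conservation of energy gives a sign but does not bound the size of \<open>u\<close> on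
  \<open>D\<close>; the multiplier identity does. Its ingredients are forced: the zero-order part
  \<open>u\<close> of the multiplier lets |u|^2 and |grad u|^2 enter the divergence with the same
  positive coefficient, and the weight decays like 1 / (\<kappa> |x|), so that at infinity the flux
  of the multiplier field is balanced by twice the outgoing energy flux, while it stays smooth at
  the origin. Since \<open>w\<close> is only in H^2_loc and the source only square integrable, the
  identities cannot be applied to \<open>w\<close> itself. Convolution commutes with the operator
  because the variable coefficient \<open>n - 1\<close> is kept in the source \<open>F\<close>; the
  bounds do not depend on the mollification parameter, and mean square convergence carries them
  back. The circle closes with \<open>h = f + w\<close>: \<open>F\<close> is bounded by
  \<open>h\<close>, \<open>w\<close> by \<open>F\<close>, and so \<open>f = h - w\<close> by
  \<open>h\<close>, in which the imaginary part of \<open>n\<close> gives the lower bound.\<close>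

definition pd :: "2 \<Rightarrow> (R2 \<Rightarrow> real) \<Rightarrow> (R2 \<Rightarrow> real) \<Rightarrow> bool" where
  "pd i f f' \<longleftrightarrow> (\<forall>x. ((\<lambda>t. f (x + t *\<^sub>R axis i 1)) has_real_derivative f' x) (at 0))"

lemma pdD: "pd i f f' \<Longrightarrow> ((\<lambda>t. f (x + t *\<^sub>R axis i 1)) has_real_derivative f' x) (at 0)"
  by (simp add: pd_def)

text \<open>\<open>pd\<close> prescribes the derivative at parameter 0 only, but from every base
  point; moving the base point along the line reaches all parameters, as the mean value theorem
  requires.\<close>

lemma pd_line:
  assumes "pd i f f'"
  shows "((\<lambda>t. f (x + t *\<^sub>R axis i 1)) has_real_derivative f' (x + s *\<^sub>R axis i 1)) (at s)"
proof -
  have "((\<lambda>t. f ((x + s *\<^sub>R axis i 1) + t *\<^sub>R axis i 1)) has_real_derivative f' (x + s *\<^sub>R axis i 1)) (at 0)"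
    using pdD[OF assms] .
  then have "((\<lambda>t. f (x + (s + t) *\<^sub>R axis i 1)) has_real_derivative f' (x + s *\<^sub>R axis i 1)) (at 0)"
    by (simp add: algebra_simps)
  then show ?thesis
    using DERIV_at_within_shift[of "\<lambda>t. f (x + t *\<^sub>R axis i 1)" _ s 0 UNIV] by simp
qed

lemma integrable_lborel_compact_support:
  fixes f :: "'a::euclidean_space \<Rightarrow> 'b::euclidean_space"
  assumes "continuous_on UNIV f" "\<And>x. norm x > M \<Longrightarrow> f x = 0"
  shows "integrable lborel f"
proof -
  have "integrable lborel (\<lambda>x. indicator (cball 0 M) x *\<^sub>R f x)"
    by (rule borel_integrable_compact) (auto intro: continuous_on_subset[OF assms(1)])
  moreover have "(\<lambda>x. indicator (cball 0 M) x *\<^sub>R f x) = f"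
    using assms(2) by (auto simp: fun_eq_iff indicator_def not_le)
  ultimately show ?thesis by simp
qed

lemma integrable_indicator_cball: "integrable lborel (indicat_real (cball (c::'a::euclidean_space) r))"
  by (rule integrable_real_indicator)
     (use emeasure_lborel_cball_finite in \<open>auto simp: infinity_ennreal_def\<close>)

lemma lborel_integral_translate:
  fixes f :: "'a::euclidean_space \<Rightarrow> 'b::euclidean_space"
  assumes [measurable]: "f \<in> borel_measurable borel"
  shows "(LBINT x. f (x + c)) = (LBINT x. f x)"
proof -
  have "(LBINT x. f x) = (\<integral>x. f x \<partial>distr lborel borel ((+) c))"
    by (simp add: lborel_distr_plus)
  also have "\<dots> = (LBINT x. f (c + x))"
    by (subst integral_distr) auto
  finally show ?thesis by (simp add: add.commute)
qed

lemma integrable_lborel_translate: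
  fixes f :: "'a::euclidean_space \<Rightarrow> 'b::euclidean_space"
  assumes [measurable]: "f \<in> borel_measurable borel" and "integrable lborel f"
  shows "integrable lborel (\<lambda>x. f (x + c))"
proof -
  have "integrable (distr lborel borel ((+) c)) f"
    using assms by (simp add: lborel_distr_plus)
  then have "integrable lborel (\<lambda>x. f (c + x))"
    by (subst (asm) integrable_distr_eq) auto
  then show ?thesis by (simp add: add.commute)
qed

lemma bounded_compact_support:
  fixes f :: "'a::euclidean_space \<Rightarrow> 'b::real_normed_vector"
  assumes "continuous_on UNIV f" "\<And>x. norm x > M \<Longrightarrow> f x = 0"
  obtains B where "B > 0" "\<And>x. norm (f x) \<le> B"
proof -
  have "bounded (f ` cball 0 M)"
    by (intro compact_imp_bounded compact_continuous_image continuous_on_subset[OF assms(1)]) auto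
  then obtain B where B: "B > 0" "\<And>x. x \<in> cball 0 M \<Longrightarrow> norm (f x) \<le> B"
    by (auto simp: bounded_pos)
  have "norm (f x) \<le> B" for x
    using B assms(2)[of x] by (cases "norm x > M") auto
  with B(1) show ?thesis by (rule that)
qed

text \<open>The integral of a partial derivative is the derivative of \<open>\<integral> G (x + t e)\<close>, which does not
  depend on \<open>t\<close>.\<close>
lemma integral_pd_eq_0:
  assumes pd: "pd i G G'" and cG: "continuous_on UNIV G" and cG': "continuous_on UNIV G'"
    and supp: "\<And>x. norm x > M \<Longrightarrow> G x = 0"
  shows "(LBINT x. G' x) = 0"
proof -
  let ?e = "axis i 1 :: R2"
  \<comment> \<open>The set where \<open>norm x > M\<close> is open, so \<open>G\<close> vanishes on
    a short segment around such an \<open>x\<close>, and its derivative along the segment is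
    zero.\<close>
  have supp': "G' x = 0" if "norm x > M" for x
  proof -
    have "\<forall>\<^sub>F t in nhds 0. norm (x + t *\<^sub>R ?e) > M"
    proof (rule order_tendstoD(1))
      have "((\<lambda>t. norm (x + t *\<^sub>R ?e)) \<longlongrightarrow> norm (x + 0 *\<^sub>R ?e)) (nhds 0)"
        by (intro tendsto_intros filterlim_ident)
      then show "((\<lambda>t. norm (x + t *\<^sub>R ?e)) \<longlongrightarrow> norm x) (nhds 0)" by simp
    qed (fact that)
    then have "\<forall>\<^sub>F t in nhds 0. G (x + t *\<^sub>R ?e) = 0"
      by eventually_elim (rule supp)
    then have "((\<lambda>t. G (x + t *\<^sub>R ?e)) has_real_derivative 0) (at 0)"
      by (subst DERIV_cong_ev[OF refl _ refl, of _ "\<lambda>_. 0"]) auto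
    with pdD[OF pd] show ?thesis by (rule DERIV_unique)
  qed
  obtain B where B: "B > 0" "\<And>x. \<bar>G' x\<bar> \<le> B"
    using bounded_compact_support[OF cG' supp'] by (metis real_norm_def)
  have [measurable]: "G \<in> borel_measurable borel" "G' \<in> borel_measurable borel"
    using cG cG' by (auto intro: borel_measurable_continuous_onI)
  have iG: "integrable lborel G" by (rule integrable_lborel_compact_support[OF cG supp])
  define h where "h n = inverse (real (Suc n))" for n
  have h: "h n > 0" "h n \<le> 1" for n
    by (auto simp: h_def field_simps)
  have hlim: "h \<longlonglongrightarrow> 0" unfolding h_def by (rule LIMSEQ_inverse_real_of_nat)
  define \<phi> where "\<phi> n x = (G (x + h n *\<^sub>R ?e) - G x) / h n" for n x
  have "(LBINT x. \<phi> n x) = 0" for n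
    using lborel_integral_translate[of G "h n *\<^sub>R ?e"]
    by (simp add: \<phi>_def iG integrable_lborel_translate[OF _ iG])
  moreover have "(\<lambda>n. LBINT x. \<phi> n x) \<longlonglongrightarrow> (LBINT x. G' x)"
  proof (rule integral_dominated_convergence)
    \<comment> \<open>A difference quotient equals a value of \<open>G'\<close> by the mean value
      theorem, and steps of length at most 1 keep its support within radius \<open>M + 1\<close>.
      This gives a majorant independent of \<open>n\<close>.\<close>
    show "integrable lborel (\<lambda>x. B * indicator (cball 0 (M+1)) x :: real)"
      by (intro integrable_mult_right integrable_indicator_cball)
    show "AE x in lborel. (\<lambda>n. \<phi> n x) \<longlonglongrightarrow> G' x"
    proof (rule AE_I2)
      fix x
      have "((\<lambda>t. (G (x + t *\<^sub>R ?e) - G x) / t) \<longlongrightarrow> G' x) (at 0)"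
        using pdD[OF pd, of x] by (simp add: DERIV_def)
      moreover have "filterlim h (at 0) sequentially"
        using hlim h by (auto simp: filterlim_at intro!: always_eventually) (metis less_irrefl)
      ultimately show "(\<lambda>n. \<phi> n x) \<longlonglongrightarrow> G' x"
        unfolding \<phi>_def by (rule filterlim_compose)
    qed
    fix n
    show "AE x in lborel. norm (\<phi> n x) \<le> B * indicator (cball 0 (M + 1)) x"
    proof (rule AE_I2)
      fix x
      obtain z where z: "G (x + h n *\<^sub>R ?e) - G (x + 0 *\<^sub>R ?e) = (h n - 0) * G' (x + z *\<^sub>R ?e)"
        using MVT2[OF h(1)[of n], of "\<lambda>t. G (x + t *\<^sub>R ?e)" "\<lambda>t. G' (x + t *\<^sub>R ?e)"]
          pd_line[OF pd] by blast
      have eq: "\<phi> n x = G' (x + z *\<^sub>R ?e)"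
        using z h(1)[of n] by (simp add: \<phi>_def)
      show "norm (\<phi> n x) \<le> B * indicator (cball 0 (M + 1)) x"
      proof (cases "x \<in> cball 0 (M+1)")
        case True
        then show ?thesis using B eq by simp
      next
        case False
        then have "norm x > M + 1" by simp
        moreover have "norm (h n *\<^sub>R ?e) \<le> 1" using h[of n] by (simp add: norm_axis_1)
        ultimately have "norm (x + h n *\<^sub>R ?e) > M" "norm x > M"
          using norm_diff_ineq[of x "h n *\<^sub>R ?e"] by linarith+
        then show ?thesis using supp B(1) by (simp add: \<phi>_def indicator_def)
      qed
    qed
  qed (auto simp: \<phi>_def)
  ultimately show ?thesis
    by (simp add: LIMSEQ_const_iff)
qed

text \<open>The square of this profile is continuously differentiable, with gradient
  \<open>- (4 / M\<^sup>2) * cutoff M x\<close> times the vector \<open>x\<close>. Cutting off thus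
  turns the flux of \<open>G\<close> through a circle into an average of \<open>x . G\<close> over a
  disc.\<close>

definition cutoff :: "real \<Rightarrow> R2 \<Rightarrow> real" where
  "cutoff M x = max 0 (1 - (norm x)\<^sup>2 / M\<^sup>2)"

lemma norm_R2: "(norm (x::R2))\<^sup>2 = (x$1)\<^sup>2 + (x$2)\<^sup>2"
  by (simp add: norm_vec_def L2_set_def sum_2)

lemma continuous_on_cutoff [continuous_intros]: "continuous_on A (cutoff M)"
  unfolding cutoff_def by (cases "M = 0") (auto intro!: continuous_intros)

lemma measurable_cutoff [measurable]: "cutoff M \<in> borel_measurable borel"
  by (auto intro: borel_measurable_continuous_onI continuous_intros)

lemma cutoff_bounds: "0 \<le> cutoff M x" "cutoff M x \<le> 1"
  by (auto simp: cutoff_def)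

lemma cutoff_eq_0: "M > 0 \<Longrightarrow> norm x \<ge> M \<Longrightarrow> cutoff M x = 0"
  by (simp add: cutoff_def power_mono)

text \<open>An exponent of at least 2 smooths the kink: at 0 the difference quotient is bounded by
  \<open>\<bar>h\<bar>^(n + 1)\<close>.\<close>

lemma DERIV_max0_power: "((\<lambda>z::real. (max 0 z)^(n + 2)) has_real_derivative real (n + 2) * (max 0 z)^(n + 1)) (at z)"
proof (cases "z = 0")
  case True
  have "((\<lambda>h. ((max 0 (0 + h))^(n + 2) - (max 0 0)^(n + 2)) / h) \<longlongrightarrow> (0::real)) (at 0)"
  proof (rule Lim_null_comparison)
    show "((\<lambda>h::real. \<bar>h\<bar>^(n + 1)) \<longlongrightarrow> 0) (at 0)"
      by (auto intro!: tendsto_eq_intros)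
    have "norm (((max 0 (0 + h))^(n + 2) - (max 0 0)^(n + 2)) / h) \<le> \<bar>h\<bar>^(n + 1)" for h :: real
    proof (cases "h > 0")
      case True
      then show ?thesis by (simp add: max_def)
    next
      case False
      then have "max 0 (0 + h) = 0" by simp
      then have "norm (((max 0 (0 + h))^(n + 2) - (max 0 0)^(n + 2)) / h) = 0" by simp
      also have "0 \<le> \<bar>h\<bar>^(n + 1)" by simp
      finally show ?thesis .
    qed
    then show "\<forall>\<^sub>F h::real in at 0. norm (((max 0 (0 + h))^(n + 2) - (max 0 0)^(n + 2)) / h) \<le> \<bar>h\<bar>^(n + 1)"
      by simp
  qed
  with True show ?thesis by (simp add: DERIV_def)
next
  case False
  show ?thesis
  proof (cases "z > 0")
    case True
    then have "\<forall>\<^sub>F y in nhds z. (max 0 y)^(n + 2) = y^(n + 2)"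
      by (auto simp: eventually_nhds intro!: exI[of _ "{0<..}"])
    moreover have "((\<lambda>y. y^(n + 2)) has_real_derivative real (n + 2) * (max 0 z)^(n + 1)) (at z)"
      using True DERIV_pow[of "n + 2" z] by simp
    ultimately show ?thesis by (subst DERIV_cong_ev[OF refl _ refl]) auto
  next
    case f: False
    with False have "z < 0" by simp
    then have "\<forall>\<^sub>F y in nhds z. (max 0 y)^(n + 2) = 0"
      by (auto simp: eventually_nhds intro!: exI[of _ "{..<0}"])
    then show ?thesis using \<open>z < 0\<close> by (subst DERIV_cong_ev[OF refl _ refl, of _ "\<lambda>_. 0"]) auto
  qed
qed

lemma axis_nth_2: "(axis (1::2) (1::real))$1 = 1" "(axis (1::2) (1::real))$2 = 0"
  "(axis (2::2) (1::real))$1 = 0" "(axis (2::2) (1::real))$2 = 1"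
  by (auto simp: axis_def)

lemma two_cases: "(i::2) = 1 \<or> i = 2"
  using exhaust_2 by blast

lemma pd_norm2: "pd i (\<lambda>x. (norm x)\<^sup>2) (\<lambda>x. 2 * x $ i)"
  using two_cases[of i] unfolding pd_def norm_R2
  by (auto simp: axis_nth_2 intro!: derivative_eq_intros)

lemma pd_mult:
  assumes "pd i f f'" "pd i g g'"
  shows "pd i (\<lambda>x. f x * g x) (\<lambda>x. f' x * g x + f x * g' x)"
  unfolding pd_def
  by (intro allI DERIV_cong[OF DERIV_mult[OF pdD[OF assms(1)] pdD[OF assms(2)]]]) simp

lemma pd_cutoff2: "pd i (\<lambda>x. (cutoff M x)\<^sup>2) (\<lambda>x. - (4 / M\<^sup>2) * cutoff M x * x $ i)"
  unfolding pd_def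
proof
  fix x :: R2
  have "((\<lambda>t. 1 - (norm (x + t *\<^sub>R axis i 1))\<^sup>2 / M\<^sup>2) has_real_derivative - (2 * x $ i) / M\<^sup>2) (at 0)"
    by (rule DERIV_cong[OF DERIV_diff[OF DERIV_const DERIV_cdivide[OF pdD[OF pd_norm2]]]]) simp
  from DERIV_chain2[OF DERIV_max0_power[of 0] this]
  show "((\<lambda>t. (cutoff M (x + t *\<^sub>R axis i 1))\<^sup>2) has_real_derivative - (4 / M\<^sup>2) * cutoff M x * x $ i) (at 0)"
    by (simp add: cutoff_def mult.assoc power2_eq_square)
qed

text \<open>The divergence theorem with the squared cutoff in place of a disc. The factor
  \<open>4 / M\<^sup>2\<close> is that of an average over a disc, so that a bound on
  \<open>x . G\<close> near infinity bounds the right-hand side.\<close>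

lemma integral_cut_divergence:
  assumes M: "M > 0"
    and pd: "pd 1 G1 d1" "pd 2 G2 d2"
    and cont: "continuous_on UNIV G1" "continuous_on UNIV G2" "continuous_on UNIV d1" "continuous_on UNIV d2"
  shows "(LBINT x. (cutoff M x)\<^sup>2 * (d1 x + d2 x)) =
         (4 / M\<^sup>2) * (LBINT x. cutoff M x * (x$1 * G1 x + x$2 * G2 x))"
proof -
  have *: "(LBINT x. - (4 / M\<^sup>2) * cutoff M x * x $ i * G x + (cutoff M x)\<^sup>2 * d x) = 0"
    if "pd i G d" "continuous_on UNIV G" "continuous_on UNIV d" for i G d
    by (rule integral_pd_eq_0[where M=M, OF pd_mult[OF pd_cutoff2 that(1)]])
       (use M in \<open>auto intro!: continuous_intros that simp: cutoff_eq_0\<close>)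
  have I: "integrable lborel (\<lambda>x. cutoff M x * g x)" if "continuous_on UNIV g" for g :: "R2 \<Rightarrow> real"
    by (rule integrable_lborel_compact_support[where M=M])
       (use M in \<open>auto intro!: continuous_intros that simp: cutoff_eq_0\<close>)
  have **: "(LBINT x. (cutoff M x)\<^sup>2 * d x) = (4 / M\<^sup>2) * (LBINT x. cutoff M x * (x $ i * G x))"
      "integrable lborel (\<lambda>x. (cutoff M x)\<^sup>2 * d x)" "integrable lborel (\<lambda>x. cutoff M x * (x $ i * G x))"
    if "pd i G d" "continuous_on UNIV G" "continuous_on UNIV d" for i G d
  proof -
    have 1: "integrable lborel (\<lambda>x. cutoff M x * (cutoff M x * d x))"
      by (rule I) (auto intro!: continuous_intros that)
    then show 2: "integrable lborel (\<lambda>x. (cutoff M x)\<^sup>2 * d x)"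
      by (simp add: power2_eq_square mult.assoc)
    show 3: "integrable lborel (\<lambda>x. cutoff M x * (x $ i * G x))"
      by (rule I) (auto intro!: continuous_intros that)
    have "(\<lambda>x. - (4 / M\<^sup>2) * cutoff M x * x $ i * G x + (cutoff M x)\<^sup>2 * d x) =
          (\<lambda>x. (cutoff M x)\<^sup>2 * d x - (4 / M\<^sup>2) * (cutoff M x * (x $ i * G x)))"
      by (auto simp: fun_eq_iff algebra_simps)
    with *[OF that] 2 3 show "(LBINT x. (cutoff M x)\<^sup>2 * d x) = (4 / M\<^sup>2) * (LBINT x. cutoff M x * (x $ i * G x))"
      by simp
  qed
  note a = **[OF pd(1) cont(1,3)] and b = **[OF pd(2) cont(2,4)]
  show ?thesis
    using a b by (simp add: distrib_left)
qed

text \<open>Where \<open>f\<close> is at most \<open>\<delta> / (2 * pi)\<close> the integral is at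
  most half of \<open>\<delta> * M\<^sup>2\<close>, and the remaining fixed disc contributes a
  constant, which is at most the other half for large \<open>M\<close>. Only an upper bound on
  \<open>f\<close> is assumed because the fluxes are controlled from one side. Uniformity in the
  weight allows both the cutoff and the indicator of a disc.\<close>

lemma cball_integral_average_small:
  fixes f :: "R2 \<Rightarrow> real"
  assumes f: "continuous_on UNIV f" and lim: "\<And>\<delta>. \<delta> > 0 \<Longrightarrow> \<forall>\<^sub>F x in at_infinity. f x \<le> \<delta>" and \<delta>: "\<delta> > 0"
  shows "\<exists>M0>0. \<forall>M\<ge>M0. \<forall>\<psi>. \<psi> \<in> borel_measurable borel \<longrightarrow> (\<forall>x. 0 \<le> \<psi> x \<and> \<psi> x \<le> 1) \<longrightarrow>
      (\<forall>x. norm x > M \<longrightarrow> \<psi> x = 0) \<longrightarrow> (LBINT x. \<psi> x * f x) / M\<^sup>2 \<le> \<delta>"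
proof -
  have [measurable]: "f \<in> borel_measurable borel"
    using f by (rule borel_measurable_continuous_onI)
  define v where "v M = measure lborel (cball (0::R2) M)" for M
  have v: "v M = M\<^sup>2 * pi" if "M \<ge> 0" for M
    unfolding v_def using that by (subst content_cball) (auto simp: unit_ball_vol_2)
  have "\<delta> / (2 * pi) > 0" using \<delta> by simp
  from lim[OF this] obtain \<rho> where \<rho>: "\<And>x. norm x \<ge> \<rho> \<Longrightarrow> f x \<le> \<delta> / (2 * pi)"
    by (auto simp: eventually_at_infinity)
  have "bounded (f ` cball 0 \<rho>)"
    by (intro compact_imp_bounded compact_continuous_image continuous_on_subset[OF f]) auto
  then obtain C where C: "C > 0" "\<And>x. x \<in> cball 0 \<rho> \<Longrightarrow> norm (f x) \<le> C"
    by (auto simp: bounded_pos)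
  \<comment> \<open>The second summand gives \<open>C * v \<rho> \<le> \<delta> / 2 * M0\<close>;
    the first makes \<open>M \<ge> 1\<close>, hence \<open>M \<le> M\<^sup>2\<close>.\<close>
  define M0 where "M0 = 1 + 2 * C * v \<rho> / \<delta>"
  have v0: "v \<rho> \<ge> 0" by (simp add: v_def)
  have M01: "M0 \<ge> 1" using C(1) v0 \<delta> by (simp add: M0_def)
  show ?thesis
  proof (rule exI[of _ M0], intro conjI allI impI)
    show "M0 > 0" using M01 by simp
    fix M :: real and \<psi> :: "R2 \<Rightarrow> real"
    assume M: "M0 \<le> M" and [measurable]: "\<psi> \<in> borel_measurable borel"
      and \<psi>: "\<forall>x. 0 \<le> \<psi> x \<and> \<psi> x \<le> 1" and \<psi>s: "\<forall>x. norm x > M \<longrightarrow> \<psi> x = 0"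
    have M1: "M \<ge> 1" using M M01 by simp
    have pw: "\<psi> x * f x \<le> C * indicator (cball 0 \<rho>) x + \<delta> / (2 * pi) * indicator (cball 0 M) x" for x
    proof (cases "norm x > M")
      case True
      then show ?thesis using \<psi>s C(1) by (auto simp: indicator_def)
    next
      case False
      have *: "\<psi> x * f x \<le> c" if "f x \<le> c" "c \<ge> 0" for c
        using mult_left_mono[OF that(1), of "\<psi> x"] mult_right_mono[of "\<psi> x" 1 c] that \<psi> by force
      show ?thesis
      proof (cases "norm x \<le> \<rho>")
        case True
        then have "f x \<le> C" using C(2)[of x] by auto
        with *[of C] C(1) have "\<psi> x * f x \<le> C" by simp
        moreover have "0 \<le> \<delta> / (2 * pi)" using \<delta> by simp
        ultimately show ?thesis using True by (simp add: indicator_def)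
      next
        case f: False
        with \<rho>[of x] have "f x \<le> \<delta> / (2 * pi)" by auto
        moreover have "0 \<le> \<delta> / (2 * pi)" using \<delta> by simp
        ultimately show ?thesis using False f *[of "\<delta> / (2 * pi)"] by (simp add: indicator_def)
      qed
    qed
    have ii: "integrable lborel (\<lambda>x. c * indicator (cball (0::R2) r) x :: real)" for c r
      by (intro integrable_mult_right integrable_indicator_cball)
    have if': "integrable lborel (\<lambda>x. indicator (cball 0 M) x *\<^sub>R f x)"
      by (rule borel_integrable_compact) (auto intro: continuous_on_subset[OF f])
    have i: "integrable lborel (\<lambda>x. \<psi> x * f x)"
    proof (rule Bochner_Integration.integrable_bound[OF if'])
      have "\<bar>\<psi> x\<bar> * \<bar>f x\<bar> \<le> \<bar>f x\<bar>" for x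
        using \<psi> by (intro mult_left_le_one_le) auto
      then show "AE x in lborel. norm (\<psi> x * f x) \<le> norm (indicator (cball 0 M) x *\<^sub>R f x)"
        using \<psi>s by (auto intro!: AE_I2 simp: indicator_def abs_mult)
    qed auto
    have "(LBINT x. \<psi> x * f x) \<le> (LBINT x. C * indicator (cball (0::R2) \<rho>) x + \<delta> / (2 * pi) * indicator (cball 0 M) x)"
      by (rule Bochner_Integration.integral_mono[OF i Bochner_Integration.integrable_add[OF ii ii] pw])
    also have "\<dots> = C * v \<rho> + \<delta> / (2 * pi) * v M"
      by (subst Bochner_Integration.integral_add[OF ii ii]) (simp add: v_def)
    also have "\<dots> = C * v \<rho> + \<delta> / 2 * M\<^sup>2"
      using M1 by (simp add: v)
    also have "\<dots> \<le> \<delta> / 2 * M\<^sup>2 + \<delta> / 2 * M\<^sup>2"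
    proof -
      have "C * v \<rho> \<le> \<delta> / 2 * M0" using \<delta> by (simp add: M0_def field_simps)
      also have "\<dots> \<le> \<delta> / 2 * M\<^sup>2"
        using \<delta> M self_le_power[OF M1, of 2] by (intro mult_left_mono) linarith+
      finally show ?thesis by simp
    qed
    finally have "(LBINT x. \<psi> x * f x) \<le> \<delta> * M\<^sup>2" by simp
    moreover have "M\<^sup>2 > 0" using M1 by simp
    ultimately show "(LBINT x. \<psi> x * f x) / M\<^sup>2 \<le> \<delta>"
      by (simp only: pos_divide_le_eq)
  qed
qed

subsection \<open>Energy and Morawetz estimates\<close>

text \<open>The left-hand side is the divergence of the field \<open>morawetz_field\<close> below, expanded by the product rule.\<close>
lemma morawetz_divergence_identity:
  fixes X Y h k a a1 a2 a11 a12 a22 b b1 b2 b11 b12 b22 :: real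
  defines "A \<equiv> X * a1 + Y * a2" and "B \<equiv> X * b1 + Y * b2"
    and "U \<equiv> a\<^sup>2 + b\<^sup>2" and "N \<equiv> a1\<^sup>2 + a2\<^sup>2 + b1\<^sup>2 + b2\<^sup>2"
    and "F1 \<equiv> a11 + a22 + k\<^sup>2 * a" and "F2 \<equiv> b11 + b22 + k\<^sup>2 * b"
    and "t \<equiv> X\<^sup>2 + Y\<^sup>2"
  assumes h: "h\<^sup>2 * (1 + k\<^sup>2 * t) = 1"
  shows "- (k\<^sup>2 * X * h^3) * (2 * (A * a1 + B * b1) + (k\<^sup>2 * U - N) * X + (a * a1 + b * b1))
      + h * (2 * ((a1 + X * a11 + Y * a12) * a1 + A * a11 + (b1 + X * b11 + Y * b12) * b1 + B * b11)
           + (k\<^sup>2 * (2 * (a * a1 + b * b1)) - 2 * (a1 * a11 + a2 * a12 + b1 * b11 + b2 * b12)) * X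
           + (k\<^sup>2 * U - N) + (a1\<^sup>2 + a * a11 + b1\<^sup>2 + b * b11))
      + k\<^sup>2 / 2 * (2 * (a * a1 + b * b1) * X * h^3 + U * h^3 - 3 * k\<^sup>2 * U * X\<^sup>2 * h^5)
      - 2 * (a * b11 - b * a11)
      + (- (k\<^sup>2 * Y * h^3) * (2 * (A * a2 + B * b2) + (k\<^sup>2 * U - N) * Y + (a * a2 + b * b2))
      + h * (2 * ((a2 + X * a12 + Y * a22) * a2 + A * a22 + (b2 + X * b12 + Y * b22) * b2 + B * b22)
           + (k\<^sup>2 * (2 * (a * a2 + b * b2)) - 2 * (a1 * a12 + a2 * a22 + b1 * b12 + b2 * b22)) * Y
           + (k\<^sup>2 * U - N) + (a2\<^sup>2 + a * a22 + b2\<^sup>2 + b * b22))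
      + k\<^sup>2 / 2 * (2 * (a * a2 + b * b2) * Y * h^3 + U * h^3 - 3 * k\<^sup>2 * U * Y\<^sup>2 * h^5)
      - 2 * (a * b22 - b * a22))
    = h^3 * (k\<^sup>2 * U + N + 2 * k\<^sup>2 * (t * N - (A\<^sup>2 + B\<^sup>2))) + k\<^sup>2 / 2 * U * (2 * h^3 - 3 * k\<^sup>2 * t * h^5)
      + h * (2 * (A * F1 + B * F2) + (a * F1 + b * F2)) - 2 * (a * F2 - b * F1)"
    (is "?L = ?R")
proof -
  \<comment> \<open>Differentiating the weight produces \<open>h^3\<close>. Trading the single
    \<open>h\<close> for \<open>h^3 * (1 + k\<^sup>2 * t)\<close> lets the two kinds of terms
    combine: the part with \<open>k\<^sup>2 * t * U\<close> cancels and the gradient part becomes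
    \<open>t * N - (A\<^sup>2 + B\<^sup>2)\<close>, the angular derivative.\<close>
  have hh: "h * (k\<^sup>2 * U + N) = h^3 * (1 + k\<^sup>2 * t) * (k\<^sup>2 * U + N)"
    using h by algebra
  have "?L = h * (k\<^sup>2 * U + N) - k\<^sup>2 * h^3 * (2 * (A\<^sup>2 + B\<^sup>2) + t * k\<^sup>2 * U - t * N)
      + k\<^sup>2 / 2 * U * (2 * h^3 - 3 * k\<^sup>2 * t * h^5)
      + h * (2 * (A * F1 + B * F2) + (a * F1 + b * F2)) - 2 * (a * F2 - b * F1)"
    unfolding A_def B_def U_def N_def F1_def F2_def t_def
    by (simp add: field_simps power2_eq_square power3_eq_cube)
  also have "\<dots> = ?R"
    unfolding hh by algebra
  finally show ?thesis .
qed

lemma pd_coord: "pd 1 (\<lambda>x. x $ 1) (\<lambda>x. 1)" "pd 2 (\<lambda>x. x $ 1) (\<lambda>x. 0)"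
   "pd 1 (\<lambda>x. x $ 2) (\<lambda>x. 0)" "pd 2 (\<lambda>x. x $ 2) (\<lambda>x. 1)"
  by (auto simp: pd_def axis_nth_2 intro!: derivative_eq_intros)

lemma pd_add: "pd i f f' \<Longrightarrow> pd i g g' \<Longrightarrow> pd i (\<lambda>x. f x + g x) (\<lambda>x. f' x + g' x)"
  by (auto simp: pd_def intro!: derivative_eq_intros)

lemma pd_diff: "pd i f f' \<Longrightarrow> pd i g g' \<Longrightarrow> pd i (\<lambda>x. f x - g x) (\<lambda>x. f' x - g' x)"
  by (auto simp: pd_def intro!: derivative_eq_intros)

lemma pd_cmult: "pd i f f' \<Longrightarrow> pd i (\<lambda>x. c * f x) (\<lambda>x. c * f' x)"
  unfolding pd_def by (intro allI DERIV_cmult) auto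

lemma pd_square: "pd i f f' \<Longrightarrow> pd i (\<lambda>x. (f x)\<^sup>2) (\<lambda>x. 2 * f x * f' x)"
  using pd_mult[of i f f' f f'] by (simp add: power2_eq_square mult_ac)

text \<open>A regularisation of 1 / (k |x|), which it never exceeds: smooth and bounded by 1 at the
  origin.\<close>

definition morawetz_weight :: "real \<Rightarrow> R2 \<Rightarrow> real" where
  "morawetz_weight k x = inverse (sqrt (1 + k\<^sup>2 * (norm x)\<^sup>2))"

lemma morawetz_weight_sq: "(morawetz_weight k x)\<^sup>2 * (1 + k\<^sup>2 * (norm x)\<^sup>2) = 1"
proof -
  have "1 + k\<^sup>2 * (norm x)\<^sup>2 > 0" by (simp add: add_pos_nonneg)
  then show ?thesis by (simp add: morawetz_weight_def power_inverse)
qed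

lemma morawetz_weight_pos: "morawetz_weight k x > 0"
  by (simp add: morawetz_weight_def add_pos_nonneg)

lemma continuous_on_morawetz_weight [continuous_intros]: "continuous_on A (morawetz_weight k)"
proof -
  have "1 + k\<^sup>2 * (norm x)\<^sup>2 > 0" for x :: R2 by (simp add: add_pos_nonneg)
  then show ?thesis unfolding morawetz_weight_def by (intro continuous_intros) (metis less_irrefl real_sqrt_gt_0_iff)
qed

lemma pd_morawetz_weight: "pd i (morawetz_weight k) (\<lambda>x. - (k\<^sup>2 * x $ i * (morawetz_weight k x)^3))"
  unfolding pd_def
proof
  fix x :: R2
  let ?g = "\<lambda>t. 1 + k\<^sup>2 * (norm (x + t *\<^sub>R axis i 1))\<^sup>2"
  have pos: "1 + k\<^sup>2 * (norm x)\<^sup>2 > 0" by (simp add: add_pos_nonneg)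
  have 1: "(?g has_real_derivative (k\<^sup>2 * (2 * x $ i))) (at 0)"
    by (rule DERIV_cong[OF DERIV_add[OF DERIV_const DERIV_cmult[OF pdD[OF pd_norm2]]]]) simp
  have 2: "((\<lambda>t. sqrt (?g t)) has_real_derivative (inverse (sqrt (?g 0)) / 2) * (k\<^sup>2 * (2 * x $ i))) (at 0)"
    by (rule DERIV_chain2[OF DERIV_real_sqrt 1]) (use pos in auto)
  have 3: "sqrt (?g 0) \<noteq> 0" using pos by auto
  show "((\<lambda>t. morawetz_weight k (x + t *\<^sub>R axis i 1)) has_real_derivative - (k\<^sup>2 * x $ i * (morawetz_weight k x)^3)) (at 0)"
    unfolding morawetz_weight_def
    by (rule DERIV_cong[OF DERIV_inverse_fun[OF 2 3]])
       (simp add: power_inverse power2_eq_square power3_eq_cube divide_simps)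
qed

text \<open>Here \<open>u = a + \<i> b\<close>, and indices denote partial derivatives. Below, \<open>rad_a + \<i> rad_b = x \<cdot> \<nabla>u\<close>,
  \<open>som_defect k = |x \<cdot> \<nabla>u - \<i> k |x| u|\<^sup>2\<close>, and \<open>rad_energy\<close> and \<open>rad_flux\<close> are the real and imaginary part of
  \<open>cnj u (x \<cdot> \<nabla>u)\<close>.\<close>
locale C2_pair =
  fixes a a1 a2 a11 a12 a22 b b1 b2 b11 b12 b22 :: "R2 \<Rightarrow> real"
  assumes pda: "pd 1 a a1" "pd 2 a a2" "pd 1 a1 a11" "pd 2 a1 a12" "pd 1 a2 a12" "pd 2 a2 a22"
    and pdb: "pd 1 b b1" "pd 2 b b2" "pd 1 b1 b11" "pd 2 b1 b12" "pd 1 b2 b12" "pd 2 b2 b22"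
    and cont: "continuous_on UNIV a" "continuous_on UNIV a1" "continuous_on UNIV a2"
      "continuous_on UNIV a11" "continuous_on UNIV a12" "continuous_on UNIV a22"
      "continuous_on UNIV b" "continuous_on UNIV b1" "continuous_on UNIV b2"
      "continuous_on UNIV b11" "continuous_on UNIV b12" "continuous_on UNIV b22"
begin

definition abs2 :: "R2 \<Rightarrow> real" where "abs2 x = (a x)\<^sup>2 + (b x)\<^sup>2"
definition grad2 :: "R2 \<Rightarrow> real" where "grad2 x = (a1 x)\<^sup>2 + (a2 x)\<^sup>2 + (b1 x)\<^sup>2 + (b2 x)\<^sup>2"
definition rad_a :: "R2 \<Rightarrow> real" where "rad_a x = x$1 * a1 x + x$2 * a2 x"
definition rad_b :: "R2 \<Rightarrow> real" where "rad_b x = x$1 * b1 x + x$2 * b2 x"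

text \<open>The first bracket is the weighted field of the multiplier. The term with
  \<open>k\<^sup>2 / 2\<close> cancels the mixed product of \<open>u\<close> and
  \<open>x . grad u\<close> that arises when the weight is differentiated. The last term subtracts
  twice the energy flux, whose outward part absorbs the leading growth of the bracket at
  infinity.\<close>

definition morawetz_field :: "real \<Rightarrow> 2 \<Rightarrow> (R2 \<Rightarrow> real) \<Rightarrow> (R2 \<Rightarrow> real) \<Rightarrow> R2 \<Rightarrow> real" where
  "morawetz_field k i ai bi x = morawetz_weight k x * (2 * (rad_a x * ai x + rad_b x * bi x) + (k\<^sup>2 * abs2 x - grad2 x) * x $ i + (a x * ai x + b x * bi x))
     + k\<^sup>2 / 2 * (abs2 x * x $ i * (morawetz_weight k x * (morawetz_weight k x)\<^sup>2)) - 2 * (a x * bi x - b x * ai x)"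

lemma pd_abs2: "pd 1 abs2 (\<lambda>x. 2 * (a x * a1 x + b x * b1 x))" "pd 2 abs2 (\<lambda>x. 2 * (a x * a2 x + b x * b2 x))"
  unfolding abs2_def
  using pd_add[OF pd_square[OF pda(1)] pd_square[OF pdb(1)]] pd_add[OF pd_square[OF pda(2)] pd_square[OF pdb(2)]]
  by (simp_all add: algebra_simps)

lemma pd_grad2: "pd 1 grad2 (\<lambda>x. 2 * (a1 x * a11 x + a2 x * a12 x + b1 x * b11 x + b2 x * b12 x))"
   "pd 2 grad2 (\<lambda>x. 2 * (a1 x * a12 x + a2 x * a22 x + b1 x * b12 x + b2 x * b22 x))"
  unfolding grad2_def
  using pd_add[OF pd_add[OF pd_add[OF pd_square[OF pda(3)] pd_square[OF pda(5)]] pd_square[OF pdb(3)]] pd_square[OF pdb(5)]]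
    pd_add[OF pd_add[OF pd_add[OF pd_square[OF pda(4)] pd_square[OF pda(6)]] pd_square[OF pdb(4)]] pd_square[OF pdb(6)]]
  by (simp_all add: algebra_simps)

lemma pd_rad_a: "pd 1 rad_a (\<lambda>x. a1 x + x$1 * a11 x + x$2 * a12 x)" "pd 2 rad_a (\<lambda>x. a2 x + x$1 * a12 x + x$2 * a22 x)"
  unfolding rad_a_def
  using pd_add[OF pd_mult[OF pd_coord(1) pda(3)] pd_mult[OF pd_coord(3) pda(5)]]
    pd_add[OF pd_mult[OF pd_coord(2) pda(4)] pd_mult[OF pd_coord(4) pda(6)]]
  by (simp_all add: algebra_simps)

lemma pd_rad_b: "pd 1 rad_b (\<lambda>x. b1 x + x$1 * b11 x + x$2 * b12 x)" "pd 2 rad_b (\<lambda>x. b2 x + x$1 * b12 x + x$2 * b22 x)"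
  unfolding rad_b_def
  using pd_add[OF pd_mult[OF pd_coord(1) pdb(3)] pd_mult[OF pd_coord(3) pdb(5)]]
    pd_add[OF pd_mult[OF pd_coord(2) pdb(4)] pd_mult[OF pd_coord(4) pdb(6)]]
  by (simp_all add: algebra_simps)

text \<open>The derivative has the shape of one half of the left-hand side of
  \<open>morawetz_divergence_identity\<close>; the instances for the two axes add up to all of
  it.\<close>

lemma pd_morawetz_field:
  assumes ai: "pd i a ai" "pd i ai aii" and bi: "pd i b bi" "pd i bi bii"
    and rad_a: "pd i rad_a A'" and rad_b: "pd i rad_b B'" and abs2: "pd i abs2 U'" and grad2: "pd i grad2 N'" and i: "pd i (\<lambda>x. x $ i) (\<lambda>x. 1)"
  shows "pd i (morawetz_field k i ai bi) (\<lambda>x. - (k\<^sup>2 * x $ i * (morawetz_weight k x)^3) *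
        (2 * (rad_a x * ai x + rad_b x * bi x) + (k\<^sup>2 * abs2 x - grad2 x) * x $ i + (a x * ai x + b x * bi x))
      + morawetz_weight k x * (2 * (A' x * ai x + rad_a x * aii x + B' x * bi x + rad_b x * bii x)
           + (k\<^sup>2 * U' x - N' x) * x $ i
           + (k\<^sup>2 * abs2 x - grad2 x) + ((ai x)\<^sup>2 + a x * aii x + (bi x)\<^sup>2 + b x * bii x))
      + k\<^sup>2 / 2 * (U' x * x $ i * (morawetz_weight k x)^3 + abs2 x * (morawetz_weight k x)^3 - 3 * k\<^sup>2 * abs2 x * (x $ i)\<^sup>2 * (morawetz_weight k x)^5)
      - 2 * (a x * bii x - b x * aii x))" (is "pd i _ ?d")
proof -
  note p = pd_diff[OF pd_add[OF pd_mult[OF pd_morawetz_weight[of i k] pd_add[OF pd_add[OF pd_cmult[OF pd_add[OF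
      pd_mult[OF rad_a ai(2)] pd_mult[OF rad_b bi(2)]], of 2] pd_mult[OF pd_diff[OF pd_cmult[OF abs2] grad2] i]]
      pd_add[OF pd_mult[OF ai(1,2)] pd_mult[OF bi(1,2)]]]]
      pd_cmult[OF pd_mult[OF pd_mult[OF abs2 i] pd_mult[OF pd_morawetz_weight[of i k] pd_square[OF pd_morawetz_weight[of i k]]]]]]
      pd_cmult[OF pd_diff[OF pd_mult[OF ai(1) bi(2)] pd_mult[OF bi(1) ai(2)]], of 2], of "k\<^sup>2" "k\<^sup>2 / 2"]
  show ?thesis
    unfolding morawetz_field_def pd_def
    by (intro allI DERIV_cong[OF pdD[OF p]]) (simp add: algebra_simps eval_nat_numeral)
qed

definition som_defect :: "real \<Rightarrow> R2 \<Rightarrow> real" where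
  "som_defect k x = (rad_a x + k * norm x * b x)\<^sup>2 + (rad_b x - k * norm x * a x)\<^sup>2"

lemma continuous_on_aux [continuous_intros]:
  "continuous_on UNIV abs2" "continuous_on UNIV grad2" "continuous_on UNIV rad_a" "continuous_on UNIV rad_b" "continuous_on UNIV (som_defect k)"
  unfolding abs2_def grad2_def rad_a_def rad_b_def som_defect_def by (intro continuous_intros cont)+

lemma nonneg: "abs2 x \<ge> 0" "grad2 x \<ge> 0" "som_defect k x \<ge> 0"
  by (auto simp: abs2_def grad2_def som_defect_def)

text \<open>The difference of the two sides is the square of the angular derivative.\<close>

lemma cauchy_schwarz_radial: "(rad_a x)\<^sup>2 + (rad_b x)\<^sup>2 \<le> (norm x)\<^sup>2 * grad2 x"
proof -
  have "(norm x)\<^sup>2 * grad2 x - ((rad_a x)\<^sup>2 + (rad_b x)\<^sup>2) =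
      (x$1 * a2 x - x$2 * a1 x)\<^sup>2 + (x$1 * b2 x - x$2 * b1 x)\<^sup>2"
    unfolding norm_R2 rad_a_def rad_b_def grad2_def by algebra
  then show ?thesis
    by (smt (verit) zero_le_power2)
qed

text \<open>The mixed term is the energy flux. A small defect therefore ties the flux to a sum of
  squares, which is the source of all sign information at infinity.\<close>

lemma som_defect_expand: "som_defect k x = (rad_a x)\<^sup>2 + (rad_b x)\<^sup>2 + k\<^sup>2 * (norm x)\<^sup>2 * abs2 x - 2 * k * norm x * (a x * rad_b x - b x * rad_a x)"
  unfolding som_defect_def abs2_def by (simp add: power2_eq_square algebra_simps)

end

lemma integrable_cutoff_mult:
  assumes "M > 0" "continuous_on UNIV (g :: R2 \<Rightarrow> real)"
  shows "integrable lborel (\<lambda>x. cutoff M x * g x)" "integrable lborel (\<lambda>x. (cutoff M x)\<^sup>2 * g x)"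
  by (rule integrable_lborel_compact_support[where M=M];
      use assms in \<open>auto intro!: continuous_intros simp: cutoff_eq_0\<close>)+

lemma integral_cutoff_tendsto:
  fixes q :: "R2 \<Rightarrow> real"
  assumes q: "continuous_on UNIV q" "\<And>x. norm x > R \<Longrightarrow> q x = 0"
  shows "((\<lambda>M. LBINT x. (cutoff M x)\<^sup>2 * q x) \<longlongrightarrow> (LBINT x. q x)) at_top"
proof (rule integral_dominated_convergence_at_top)
  have [measurable]: "q \<in> borel_measurable borel"
    using q(1) by (rule borel_measurable_continuous_onI)
  show "q \<in> borel_measurable lborel" "\<And>M. (\<lambda>x. (cutoff M x)\<^sup>2 * q x) \<in> borel_measurable lborel"
    by simp_all
  show "integrable lborel (\<lambda>x. \<bar>q x\<bar>)"
    using integrable_lborel_compact_support[OF q] by simp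
  show "\<forall>\<^sub>F M in at_top. AE x in lborel. norm ((cutoff M x)\<^sup>2 * q x) \<le> \<bar>q x\<bar>"
  proof (intro always_eventually allI AE_I2)
    fix M and x :: R2
    have "(cutoff M x)\<^sup>2 \<le> 1" using cutoff_bounds[of M x] by (simp add: power_le_one)
    then show "norm ((cutoff M x)\<^sup>2 * q x) \<le> \<bar>q x\<bar>"
      by (simp add: abs_mult mult_left_le_one_le)
  qed
  show "AE x in lborel. ((\<lambda>M. (cutoff M x)\<^sup>2 * q x) \<longlongrightarrow> q x) at_top"
  proof (rule AE_I2)
    fix x :: R2
    have "((\<lambda>M. (norm x)\<^sup>2 / M\<^sup>2) \<longlongrightarrow> 0) at_top"
      by (intro real_tendsto_divide_at_top tendsto_const filterlim_pow_at_top filterlim_ident) auto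
    then have "((\<lambda>M. (max 0 (1 - (norm x)\<^sup>2 / M\<^sup>2))\<^sup>2 * q x) \<longlongrightarrow> (max 0 (1 - 0))\<^sup>2 * q x) at_top"
      by (intro tendsto_intros)
    then show "((\<lambda>M. (cutoff M x)\<^sup>2 * q x) \<longlongrightarrow> q x) at_top" by (simp add: cutoff_def)
  qed
qed

text \<open>On the disc of half the radius the profile is at least 3/4, and 9/16 exceeds
  1/2.\<close>

lemma cutoff_ge_half:
  assumes "norm x \<le> R" "M \<ge> 2 * R" "M > 0"
  shows "(cutoff M x)\<^sup>2 \<ge> 1/2"
proof -
  have "(norm x)\<^sup>2 / M\<^sup>2 \<le> 1/4"
    using assms power_mono[of "2 * norm x" M 2] by (simp add: field_simps power_mult_distrib)
  then have "3/4 \<le> cutoff M x" unfolding cutoff_def by linarith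
  then have "(3/4)\<^sup>2 \<le> (cutoff M x)\<^sup>2" by (intro power_mono) auto
  then show ?thesis by (simp add: power2_eq_square)
qed

text \<open>Trades the first power of the cutoff, which integration by parts produces, for the
  square at twice the radius, which the energy estimate controls.\<close>

lemma cutoff_le_double: "M > 0 \<Longrightarrow> cutoff M x \<le> 2 * (cutoff (2 * M) x)\<^sup>2"
  using cutoff_ge_half[of x M "2*M"] cutoff_bounds[of M x] cutoff_eq_0[of M x]
  by (cases "norm x \<le> M") auto

lemma cutoff_norm_le: "M > 0 \<Longrightarrow> cutoff M x * norm x \<le> M * (2 * (cutoff (2 * M) x)\<^sup>2)"
  using cutoff_le_double[of M x] cutoff_eq_0[of M x] cutoff_bounds[of M x]
  by (cases "norm x \<le> M") (auto simp: mult.commute intro!: mult_mono)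

lemma integral_cball_le:
  assumes f: "continuous_on UNIV f" "\<And>x. f x \<ge> 0" and M: "M \<ge> 2 * R" "M > 0"
  shows "(LBINT x. indicator (cball 0 R) x * f x) \<le> 2 * (LBINT x. (cutoff M x)\<^sup>2 * f x)"
proof -
  have i: "integrable lborel (\<lambda>x. indicator (cball 0 R) x * f x)"
    using borel_integrable_compact[of "cball 0 R" f] continuous_on_subset[OF f(1)] by simp
  have "(LBINT x. indicator (cball 0 R) x * f x) \<le> (LBINT x. 2 * ((cutoff M x)\<^sup>2 * f x))"
  proof (rule Bochner_Integration.integral_mono[OF i])
    show "integrable lborel (\<lambda>x. 2 * ((cutoff M x)\<^sup>2 * f x))"
      by (intro integrable_mult_right integrable_cutoff_mult M f)
    fix x
    show "indicator (cball 0 R) x * f x \<le> 2 * ((cutoff M x)\<^sup>2 * f x)"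
    proof (cases "norm x \<le> R")
      case True
      from mult_right_mono[OF cutoff_ge_half[OF this M] f(2)[of x]] True show ?thesis
        by simp
    qed (simp add: f)
  qed
  then show ?thesis by simp
qed

lemma young_mult: "c > 0 \<Longrightarrow> \<bar>x * y\<bar> \<le> c * x\<^sup>2 + y\<^sup>2 / (4 * c)" for c x y :: real
proof -
  assume c: "c > 0"
  have "0 \<le> (2 * c * \<bar>x\<bar> - \<bar>y\<bar>)\<^sup>2 / (4 * c)" using c by simp
  also have "\<dots> = c * x\<^sup>2 + y\<^sup>2 / (4 * c) - \<bar>x * y\<bar>"
    using c by (simp add: power2_eq_square field_simps abs_mult)
  finally show ?thesis by simp
qed

lemma young_pair: "c > 0 \<Longrightarrow> \<bar>x * y + z * w\<bar> \<le> c * (x\<^sup>2 + z\<^sup>2) + (y\<^sup>2 + w\<^sup>2) / (4 * c)" for c x y z w :: real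
  using young_mult[of c x y] young_mult[of c z w] by (simp add: add_divide_distrib distrib_left)

lemma cutoff_integral_average_small:
  fixes f :: "R2 \<Rightarrow> real"
  assumes f: "continuous_on UNIV f" and lim: "\<And>\<delta>. \<delta> > 0 \<Longrightarrow> \<forall>\<^sub>F x in at_infinity. f x \<le> \<delta>" and \<delta>: "\<delta> > 0"
  obtains M0 where "M0 > 0" "\<And>M. M \<ge> M0 \<Longrightarrow> (LBINT x. cutoff M x * f x) / M\<^sup>2 \<le> \<delta>"
proof -
  from cball_integral_average_small[OF f lim \<delta>] obtain M0 where M0: "M0 > 0"
    "\<forall>M\<ge>M0. \<forall>\<psi>. \<psi> \<in> borel_measurable borel \<longrightarrow> (\<forall>x. 0 \<le> \<psi> x \<and> \<psi> x \<le> 1) \<longrightarrow>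
      (\<forall>x. norm x > M \<longrightarrow> \<psi> x = 0) \<longrightarrow> (LBINT x. \<psi> x * f x) / M\<^sup>2 \<le> \<delta>" by blast
  show ?thesis
  proof (rule that[OF M0(1)])
    fix M assume "M \<ge> M0"
    with M0 show "(LBINT x. cutoff M x * f x) / M\<^sup>2 \<le> \<delta>"
      using cutoff_bounds[of M] cutoff_eq_0[of M] by auto
  qed
qed

section \<open>Helmholtz equation: energy flux, Morawetz flux and local bound\<close>

context C2_pair
begin

text \<open>Dividing by \<open>1 + norm x\<close> has the effect of \<open>norm x\<close> at
  infinity without a singularity at the origin, as averaging over whole discs requires.\<close>

lemma som_defect_div_continuous: "continuous_on UNIV (\<lambda>x. som_defect k x / (1 + norm x))"
  by (intro continuous_intros) (auto simp: add_nonneg_eq_0_iff)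

definition rad_flux :: "R2 \<Rightarrow> real" where "rad_flux x = a x * rad_b x - b x * rad_a x"

text \<open>By \<open>som_defect_expand\<close>,
  \<open>som_defect k x + 2 * k * norm x * rad_flux x\<close> is a sum of squares.\<close>

lemma rad_flux_lower: "k > 0 \<Longrightarrow> x \<noteq> 0 \<Longrightarrow> - rad_flux x \<le> som_defect k x / (2 * k * norm x)"
proof -
  assume k: "k > 0" and x: "x \<noteq> 0"
  have "som_defect k x + 2 * k * norm x * rad_flux x \<ge> 0"
    using som_defect_expand[of k x] nonneg(1)[of x] by (simp add: rad_flux_def)
  then show ?thesis using k x by (simp add: field_simps)
qed

lemma rad_flux_field:
  shows "pd 1 (\<lambda>x. a x * b1 x - b x * a1 x) (\<lambda>x. a x * b11 x - b x * a11 x)"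
    "pd 2 (\<lambda>x. a x * b2 x - b x * a2 x) (\<lambda>x. a x * b22 x - b x * a22 x)"
  using pd_diff[OF pd_mult[OF pda(1) pdb(3)] pd_mult[OF pdb(1) pda(3)]]
    pd_diff[OF pd_mult[OF pda(2) pdb(6)] pd_mult[OF pdb(2) pda(6)]] by (simp_all add: algebra_simps)

text \<open>Green's identity for \<open>u\<close> and its conjugate: the products of gradients
  cancel. A real multiple of \<open>u\<close> added to the Laplacian leaves the integrand unchanged,
  so the identity serves both the Helmholtz and the modified equation.\<close>

lemma rad_flux_cutoff:
  assumes M: "M > 0"
  shows "(LBINT x. (cutoff M x)\<^sup>2 * (a x * (b11 x + b22 x) - b x * (a11 x + a22 x))) =
         (4 / M\<^sup>2) * (LBINT x. cutoff M x * rad_flux x)"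
proof -
  have "(LBINT x. (cutoff M x)\<^sup>2 * ((a x * b11 x - b x * a11 x) + (a x * b22 x - b x * a22 x))) =
         (4 / M\<^sup>2) * (LBINT x. cutoff M x * (x$1 * (a x * b1 x - b x * a1 x) + x$2 * (a x * b2 x - b x * a2 x)))"
    by (rule integral_cut_divergence[OF M rad_flux_field]) (intro continuous_intros cont)+
  then show ?thesis by (simp add: rad_flux_def rad_a_def rad_b_def algebra_simps)
qed

text \<open>Conservation of energy: the flux through large circles is nonnegative up to the Sommerfeld defect.\<close>
lemma helmholtz_flux_nonneg:
  assumes k: "k > 0" and F: "\<And>x. a11 x + a22 x + k\<^sup>2 * a x = F1 x" "\<And>x. b11 x + b22 x + k\<^sup>2 * b x = F2 x"
    and Fs: "\<And>x. norm x > R \<Longrightarrow> F1 x = 0" "\<And>x. norm x > R \<Longrightarrow> F2 x = 0"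
    and sommerfeld: "((\<lambda>x. som_defect k x / norm x) \<longlongrightarrow> 0) at_infinity"
  shows "(LBINT x. a x * F2 x - b x * F1 x) \<ge> 0"
proof -
  have cF: "continuous_on UNIV F1" "continuous_on UNIV F2"
    unfolding F[symmetric, abs_def] by (intro continuous_intros cont)+
  let ?q = "\<lambda>x. a x * F2 x - b x * F1 x"
  have lim: "((\<lambda>M. LBINT x. (cutoff M x)\<^sup>2 * ?q x) \<longlongrightarrow> (LBINT x. ?q x)) at_top"
    by (rule integral_cutoff_tendsto[where R=R]) (auto intro!: continuous_intros cont cF simp: Fs)
  have eq: "a x * (b11 x + b22 x) - b x * (a11 x + a22 x) = ?q x" for x
    by (simp add: F[symmetric] algebra_simps)
  have cJ: "continuous_on UNIV (\<lambda>x. - rad_flux x)"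
    unfolding rad_flux_def by (intro continuous_intros cont)
  have small: "\<forall>\<^sub>F x in at_infinity. - rad_flux x \<le> \<delta>" if "\<delta> > 0" for \<delta>
  proof -
    have "\<forall>\<^sub>F x in at_infinity. som_defect k x / norm x < 2 * k * \<delta>"
      using sommerfeld k that by (intro order_tendstoD(2)) auto
    moreover have "\<forall>\<^sub>F x in at_infinity. x \<noteq> (0::R2)"
      by (rule eventually_not_equal_at_infinity)
    ultimately show ?thesis
    proof eventually_elim
      case (elim x)
      have "- rad_flux x \<le> som_defect k x / norm x / (2 * k)"
        using rad_flux_lower[OF k elim(2)] by (simp add: field_simps)
      also have "\<dots> \<le> 2 * k * \<delta> / (2 * k)" using elim(1) k by (intro divide_right_mono) auto
      finally show ?case using k by simp
    qed
  qed
  have "- 4 * \<delta> \<le> (LBINT x. ?q x)" if \<delta>: "\<delta> > 0" for \<delta>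
  proof -
    obtain M0 where M0: "M0 > 0" "\<And>M. M \<ge> M0 \<Longrightarrow> (LBINT x. cutoff M x * (- rad_flux x)) / M\<^sup>2 \<le> \<delta>"
      using cutoff_integral_average_small[OF cJ small \<delta>] by blast
    have "\<forall>\<^sub>F M in at_top. - 4 * \<delta> \<le> (LBINT x. (cutoff M x)\<^sup>2 * ?q x)"
      using eventually_ge_at_top[of M0]
    proof eventually_elim
      case (elim M)
      have "(LBINT x. (cutoff M x)\<^sup>2 * ?q x) = 4 * ((LBINT x. cutoff M x * rad_flux x) / M\<^sup>2)"
        using rad_flux_cutoff[of M] M0(1) elim unfolding eq by simp
      then show ?case using M0(2)[OF elim] by simp
    qed
    then show ?thesis by (rule tendsto_lowerbound[OF lim]) simp
  qed
  note * = this
  show ?thesis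
  proof (rule field_le_epsilon)
    fix e :: real assume "e > 0"
    then show "0 \<le> (LBINT x. ?q x) + e" using *[of "e / 4"] by simp
  qed
qed

text \<open>Since the weight is at most 1 / (k |x|), the leading part of the multiplier flux is at
  most \<open>P + k\<^sup>2 |x|\<^sup>2 |u|\<^sup>2\<close> over k |x|, with \<open>P\<close> the
  square of \<open>x . grad u\<close>. Twice the energy flux is the same quantity minus the defect,
  so the leading parts cancel exactly. What remains is the defect and |u|^2 over |x|, both of which
  tend to zero for a Sommerfeld solution.\<close>

lemma morawetz_flux_upper:
  assumes k: "k > 0" and x: "x \<noteq> 0"
  shows "x$1 * morawetz_field k 1 a1 b1 x + x$2 * morawetz_field k 2 a2 b2 x \<le> (3/2 * som_defect k x + abs2 x) / (k * norm x)"
proof -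
  let ?r = "norm x" and ?h = "morawetz_weight k x"
  define P where "P = (rad_a x)\<^sup>2 + (rad_b x)\<^sup>2"
  define Re where "Re = a x * rad_a x + b x * rad_b x"
  have r: "?r > 0" using x by simp
  have eq: "x$1 * morawetz_field k 1 a1 b1 x + x$2 * morawetz_field k 2 a2 b2 x =
      ?h * (2 * P + (k\<^sup>2 * abs2 x - grad2 x) * ?r\<^sup>2) + ?h * Re + k\<^sup>2 / 2 * (abs2 x * ?r\<^sup>2 * (?h * ?h\<^sup>2)) - 2 * rad_flux x"
    unfolding morawetz_field_def P_def Re_def rad_flux_def rad_a_def rad_b_def norm_R2
    by (simp add: power2_eq_square algebra_simps)
  have hk: "?h * (k * ?r) \<le> 1"
  proof (rule power2_le_imp_le)
    have "(?h * (k * ?r))\<^sup>2 = 1 - ?h\<^sup>2"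
      using morawetz_weight_sq[of k x] by (simp add: power_mult_distrib algebra_simps)
    then show "(?h * (k * ?r))\<^sup>2 \<le> 1\<^sup>2" by simp
  qed simp
  then have hle: "?h \<le> 1 / (k * ?r)" using k r by (simp add: field_simps)
  have P: "P \<le> ?r\<^sup>2 * grad2 x" unfolding P_def by (rule cauchy_schwarz_radial)
  have SS: "som_defect k x = P + k\<^sup>2 * ?r\<^sup>2 * abs2 x - 2 * k * ?r * rad_flux x"
    using som_defect_expand[of k x] by (simp add: P_def rad_flux_def)
  have nn: "P + k\<^sup>2 * ?r\<^sup>2 * abs2 x \<ge> 0" using nonneg(1,2)[of x] by (simp add: P_def)
  have Re: "Re \<le> (abs2 x + som_defect k x) / 2"
  proof -
    have "Re = a x * (rad_a x + k * ?r * b x) + b x * (rad_b x - k * ?r * a x)" by (simp add: Re_def algebra_simps)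
    also have "\<dots> \<le> 1/2 * ((a x)\<^sup>2 + (b x)\<^sup>2) + ((rad_a x + k * ?r * b x)\<^sup>2 + (rad_b x - k * ?r * a x)\<^sup>2) / (4 * (1/2))"
      using young_pair[of "1/2" "a x" "rad_a x + k * ?r * b x" "b x" "rad_b x - k * ?r * a x"] by linarith
    finally show ?thesis by (simp add: abs2_def som_defect_def add_divide_distrib)
  qed
  have t1: "?h * (2 * P + (k\<^sup>2 * abs2 x - grad2 x) * ?r\<^sup>2) \<le> 1 / (k * ?r) * (P + k\<^sup>2 * ?r\<^sup>2 * abs2 x)"
  proof -
    \<comment> \<open>The original bracket has no sign. Bounding one of the two copies of
      \<open>P\<close> by \<open>cauchy_schwarz_radial\<close> removes the gradient and leaves a
      nonnegative bracket, for which the weight may be replaced by its upper bound.\<close>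
    have "?h * (2 * P + (k\<^sup>2 * abs2 x - grad2 x) * ?r\<^sup>2) \<le> ?h * (P + k\<^sup>2 * ?r\<^sup>2 * abs2 x)"
      using P morawetz_weight_pos[of k x] by (intro mult_left_mono) (auto simp: algebra_simps)
    also have "\<dots> \<le> 1 / (k * ?r) * (P + k\<^sup>2 * ?r\<^sup>2 * abs2 x)" by (rule mult_right_mono[OF hle nn])
    finally show ?thesis .
  qed
  have t2: "?h * Re \<le> 1 / (k * ?r) * ((abs2 x + som_defect k x) / 2)"
  proof -
    have "?h * Re \<le> ?h * ((abs2 x + som_defect k x) / 2)" using Re morawetz_weight_pos[of k x] by (intro mult_left_mono) auto
    also have "\<dots> \<le> 1 / (k * ?r) * ((abs2 x + som_defect k x) / 2)"
      by (rule mult_right_mono[OF hle]) (use nonneg in auto)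
    finally show ?thesis .
  qed
  have t3: "k\<^sup>2 / 2 * (abs2 x * ?r\<^sup>2 * (?h * ?h\<^sup>2)) \<le> 1 / (k * ?r) * (abs2 x / 2)"
  proof -
    have "(?h * (k * ?r))\<^sup>2 \<le> 1" using hk morawetz_weight_pos[of k x] k by (intro power_le_one) auto
    then have "(?h * (abs2 x / 2)) * (?h * (k * ?r))\<^sup>2 \<le> (?h * (abs2 x / 2)) * 1"
      using morawetz_weight_pos[of k x] nonneg(1)[of x] by (intro mult_left_mono) auto
    also have "\<dots> \<le> 1 / (k * ?r) * (abs2 x / 2)"
      using mult_right_mono[OF hle, of "abs2 x / 2"] nonneg(1)[of x] by simp
    finally show ?thesis by (simp add: power2_eq_square algebra_simps)
  qed
  have t4: "2 * rad_flux x = 1 / (k * ?r) * (P + k\<^sup>2 * ?r\<^sup>2 * abs2 x - som_defect k x)"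
    using SS k r by (simp add: field_simps)
  have "x$1 * morawetz_field k 1 a1 b1 x + x$2 * morawetz_field k 2 a2 b2 x \<le> 1 / (k * ?r) * (P + k\<^sup>2 * ?r\<^sup>2 * abs2 x)
      + 1 / (k * ?r) * ((abs2 x + som_defect k x) / 2) + 1 / (k * ?r) * (abs2 x / 2) - 1 / (k * ?r) * (P + k\<^sup>2 * ?r\<^sup>2 * abs2 x - som_defect k x)"
    unfolding eq t4 by (intro diff_right_mono add_mono t1 t2 t3)
  also have "\<dots> = 1 / (k * ?r) * (3/2 * som_defect k x + abs2 x)" using k r by (simp add: field_simps)
  finally show ?thesis by simp
qed

text \<open>The divergence of \<open>morawetz_field\<close> in the form in which signs can be read
  off: squares, then the correction, then products with the Helmholtz source.\<close>

definition morawetz_div :: "real \<Rightarrow> R2 \<Rightarrow> real" where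
  "morawetz_div k x = (let F1 = a11 x + a22 x + k\<^sup>2 * a x; F2 = b11 x + b22 x + k\<^sup>2 * b x in
      (morawetz_weight k x)^3 * (k\<^sup>2 * abs2 x + grad2 x + 2 * k\<^sup>2 * ((norm x)\<^sup>2 * grad2 x - ((rad_a x)\<^sup>2 + (rad_b x)\<^sup>2)))
      + k\<^sup>2 / 2 * abs2 x * (2 * (morawetz_weight k x)^3 - 3 * k\<^sup>2 * (norm x)\<^sup>2 * (morawetz_weight k x)^5)
      + morawetz_weight k x * (2 * (rad_a x * F1 + rad_b x * F2) + (a x * F1 + b x * F2)) - 2 * (a x * F2 - b x * F1))"

lemma morawetz_cutoff:
  assumes M: "M > 0"
  shows "(LBINT x. (cutoff M x)\<^sup>2 * morawetz_div k x) =
    (4 / M\<^sup>2) * (LBINT x. cutoff M x * (x$1 * morawetz_field k 1 a1 b1 x + x$2 * morawetz_field k 2 a2 b2 x))"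
proof -
  note p1 = pd_morawetz_field[OF pda(1,3) pdb(1,3) pd_rad_a(1) pd_rad_b(1) pd_abs2(1) pd_grad2(1) pd_coord(1), of k]
  note p2 = pd_morawetz_field[OF pda(2,6) pdb(2,6) pd_rad_a(2) pd_rad_b(2) pd_abs2(2) pd_grad2(2) pd_coord(4), of k]
  have *: "(LBINT x. (cutoff M x)\<^sup>2 * morawetz_div k x) =
    (4 / M\<^sup>2) * (LBINT x. cutoff M x * (x$1 * morawetz_field k 1 a1 b1 x + x$2 * morawetz_field k 2 a2 b2 x))"
    if "pd 1 (morawetz_field k 1 a1 b1) d1" "pd 2 (morawetz_field k 2 a2 b2) d2" "continuous_on UNIV d1" "continuous_on UNIV d2"
      and "\<And>x. morawetz_div k x = d1 x + d2 x" for d1 d2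
    unfolding that(5)
    by (rule integral_cut_divergence[OF M that(1,2) _ _ that(3,4)]; unfold morawetz_field_def; intro continuous_intros cont)
  show ?thesis
  proof (rule *[OF p1 p2], goal_cases)
    case (3 x)
    show ?case
      unfolding morawetz_div_def Let_def norm_R2 abs2_def grad2_def rad_a_def rad_b_def
      by (rule morawetz_divergence_identity[OF morawetz_weight_sq[of k x, unfolded norm_R2], symmetric])
  qed (intro continuous_intros cont)+
qed

text \<open>The terms without source dominate the cubed weight times half of k^2 |u|^2 plus |grad
  u|^2, everywhere. On the disc the cubed weight is at least \<open>c\<close>, its value at |x| = R,
  and Young's inequality charges the source terms to this: the product with
  \<open>x . grad u\<close> uses all of the gradient, the products with \<open>u\<close> half of the
  rest. Outside the disc the source vanishes.\<close>

lemma morawetz_div_lower: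
  assumes k: "k > 0" and R: "R > 0"
    and F: "\<And>x. a11 x + a22 x + k\<^sup>2 * a x = F1 x" "\<And>x. b11 x + b22 x + k\<^sup>2 * b x = F2 x"
    and Fs: "\<And>x. norm x > R \<Longrightarrow> F1 x = 0" "\<And>x. norm x > R \<Longrightarrow> F2 x = 0"
    and c: "c = inverse (sqrt (1 + k\<^sup>2 * R\<^sup>2)) ^ 3"
  shows "indicator (cball 0 R) x * (k\<^sup>2 * c / 4 * abs2 x) - (R\<^sup>2 / c + 9 / (k\<^sup>2 * c)) * ((F1 x)\<^sup>2 + (F2 x)\<^sup>2) \<le> morawetz_div k x"
proof -
  let ?h = "morawetz_weight k x" and ?t = "(norm x)\<^sup>2"
  let ?Q = "(F1 x)\<^sup>2 + (F2 x)\<^sup>2"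
  have pos: "1 + k\<^sup>2 * R\<^sup>2 > 0" by (simp add: add_pos_nonneg)
  have cpos: "c > 0" unfolding c using pos by simp
  have h: "?h > 0" by (rule morawetz_weight_pos)
  have h2: "?h\<^sup>2 * (1 + k\<^sup>2 * ?t) = 1" by (rule morawetz_weight_sq)
  have h1: "?h \<le> 1"
  proof (rule power2_le_imp_le)
    have "?h\<^sup>2 * 1 \<le> ?h\<^sup>2 * (1 + k\<^sup>2 * ?t)" by (intro mult_left_mono) auto
    then show "?h\<^sup>2 \<le> 1\<^sup>2" using h2 by simp
  qed simp
  have main: "?h^3 * (k\<^sup>2 / 2 * abs2 x + grad2 x) \<le>
      ?h^3 * (k\<^sup>2 * abs2 x + grad2 x + 2 * k\<^sup>2 * (?t * grad2 x - ((rad_a x)\<^sup>2 + (rad_b x)\<^sup>2)))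
      + k\<^sup>2 / 2 * abs2 x * (2 * ?h^3 - 3 * k\<^sup>2 * ?t * ?h^5)"
  proof -
    \<comment> \<open>Because \<open>k\<^sup>2 * t * h\<^sup>2 = 1 - h\<^sup>2\<close> for the
      weight \<open>h\<close>, the correction loses at most
      \<open>k\<^sup>2 / 2 * h^3 * |u|\<^sup>2\<close>, half of the main term.\<close>
    have e: "2 * ?h^3 - 3 * k\<^sup>2 * ?t * ?h^5 = ?h^3 * (3 * ?h\<^sup>2 - 1)"
      using h2 by algebra
    have "0 \<le> ?h^3 * (2 * k\<^sup>2 * (?t * grad2 x - ((rad_a x)\<^sup>2 + (rad_b x)\<^sup>2)))"
      using cauchy_schwarz_radial[of x] h by simp
    moreover have "k\<^sup>2 / 2 * abs2 x * (?h^3 * (3 * ?h\<^sup>2 - 1)) = ?h^3 * (k\<^sup>2 * abs2 x * (3/2 * ?h\<^sup>2)) - ?h^3 * (k\<^sup>2 / 2 * abs2 x)"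
      by (simp add: algebra_simps)
    moreover have "0 \<le> ?h^3 * (k\<^sup>2 * abs2 x * (3/2 * ?h\<^sup>2))"
      using h nonneg(1)[of x] by simp
    ultimately show ?thesis unfolding e by (simp add: algebra_simps)
  qed
  show ?thesis
  proof (cases "norm x > R")
    case True
    have "0 \<le> ?h^3 * (k\<^sup>2 / 2 * abs2 x + grad2 x)" using h nonneg(1,2)[of x] by simp
    then show ?thesis using main True Fs[OF True] by (simp add: morawetz_div_def F)
  next
    case False
    then have xR: "norm x \<le> R" by simp
    have ch: "c \<le> ?h^3"
    proof -
      have "sqrt (1 + k\<^sup>2 * ?t) \<le> sqrt (1 + k\<^sup>2 * R\<^sup>2)"
        using xR by (intro real_sqrt_le_mono add_left_mono mult_left_mono power_mono) auto
      then have "inverse (sqrt (1 + k\<^sup>2 * R\<^sup>2)) \<le> ?h"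
        unfolding morawetz_weight_def by (intro le_imp_inverse_le) (auto simp: add_pos_nonneg)
      then show ?thesis unfolding c using pos by (intro power_mono) auto
    qed
    have "c * (k\<^sup>2 / 2 * abs2 x + grad2 x) \<le> ?h^3 * (k\<^sup>2 / 2 * abs2 x + grad2 x)"
      by (intro mult_right_mono ch) (use nonneg(1,2)[of x] in auto)
    note c1 = order_trans[OF this main]
    have c2: "- (c * grad2 x) - R\<^sup>2 / c * ?Q \<le> ?h * (2 * (rad_a x * F1 x + rad_b x * F2 x))"
    proof -
      \<comment> \<open>Chosen so that the gradient part of the estimate is exactly
        \<open>c * grad2 x\<close>, the amount available.\<close>
      define d where "d = c / R\<^sup>2"
      have d: "d > 0" using cpos R by (simp add: d_def)
      have "\<bar>rad_a x * F1 x + rad_b x * F2 x\<bar> \<le> d / 2 * ((rad_a x)\<^sup>2 + (rad_b x)\<^sup>2) + ?Q / (4 * (d / 2))"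
        using d by (intro young_pair) auto
      also have "\<dots> \<le> d / 2 * (R\<^sup>2 * grad2 x) + ?Q / (4 * (d / 2))"
      proof -
        have "?t * grad2 x \<le> R\<^sup>2 * grad2 x" using xR nonneg(2)[of x] by (intro mult_right_mono power_mono) auto
        then have "(rad_a x)\<^sup>2 + (rad_b x)\<^sup>2 \<le> R\<^sup>2 * grad2 x" using cauchy_schwarz_radial[of x] by linarith
        then show ?thesis using d by (intro add_right_mono mult_left_mono) auto
      qed
      also have "2 * \<dots> = c * grad2 x + R\<^sup>2 / c * ?Q" using R cpos by (simp add: d_def field_simps)
      finally have b: "\<bar>2 * (rad_a x * F1 x + rad_b x * F2 x)\<bar> \<le> c * grad2 x + R\<^sup>2 / c * ?Q" by (simp only: abs_mult abs_numeral)
      have "\<bar>?h * (2 * (rad_a x * F1 x + rad_b x * F2 x))\<bar> \<le> 1 * \<bar>2 * (rad_a x * F1 x + rad_b x * F2 x)\<bar>"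
        unfolding abs_mult[of ?h] using h1 h by (intro mult_right_mono) auto
      with b show ?thesis by linarith
    qed
    have c3: "- (k\<^sup>2 * c / 4 * abs2 x) - 9 / (k\<^sup>2 * c) * ?Q \<le> ?h * (a x * F1 x + b x * F2 x) - 2 * (a x * F2 x - b x * F1 x)"
    proof -
      \<comment> \<open>Three copies of the Young bound occur, one from the multiplier part
        \<open>u\<close> and two from the doubled energy term; together they may use a quarter of
        \<open>k\<^sup>2 * c\<close>.\<close>
      define d where "d = k\<^sup>2 * c / 12"
      have d: "d > 0" using cpos k by (simp add: d_def)
      have 1: "\<bar>a x * F1 x + b x * F2 x\<bar> \<le> d * abs2 x + ?Q / (4 * d)"
        using young_pair[OF d, of "a x" "F1 x" "b x" "F2 x"] by (simp add: abs2_def)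
      have 2: "\<bar>a x * F2 x - b x * F1 x\<bar> \<le> d * abs2 x + ?Q / (4 * d)"
        using young_pair[OF d, of "a x" "F2 x" "b x" "- F1 x"] by (simp add: abs2_def add.commute)
      have 3: "\<bar>?h * (a x * F1 x + b x * F2 x)\<bar> \<le> 1 * \<bar>a x * F1 x + b x * F2 x\<bar>"
        unfolding abs_mult[of ?h] using h1 h by (intro mult_right_mono) auto
      have "3 * (d * abs2 x + ?Q / (4 * d)) = k\<^sup>2 * c / 4 * abs2 x + 9 / (k\<^sup>2 * c) * ?Q"
        using k cpos by (simp add: d_def field_simps)
      moreover have "- f - g \<le> r - 2 * q" if "\<bar>p\<bar> \<le> e" "\<bar>q\<bar> \<le> e" "\<bar>r\<bar> \<le> 1 * \<bar>p\<bar>" "3 * e = f + g"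
        for e f g p q r :: real
        using that by linarith
      ultimately show ?thesis using 1 2 3 by blast
    qed
    have "morawetz_div k x = ?h^3 * (k\<^sup>2 * abs2 x + grad2 x + 2 * k\<^sup>2 * (?t * grad2 x - ((rad_a x)\<^sup>2 + (rad_b x)\<^sup>2)))
      + k\<^sup>2 / 2 * abs2 x * (2 * ?h^3 - 3 * k\<^sup>2 * ?t * ?h^5)
      + ?h * (2 * (rad_a x * F1 x + rad_b x * F2 x)) + (?h * (a x * F1 x + b x * F2 x) - 2 * (a x * F2 x - b x * F1 x))"
      unfolding morawetz_div_def Let_def F distrib_left[of ?h] by simp
    with add_mono[OF add_mono[OF c1 c2] c3]
    have "c * (k\<^sup>2 / 2 * abs2 x + grad2 x) + (- (c * grad2 x) - R\<^sup>2 / c * ?Q) + (- (k\<^sup>2 * c / 4 * abs2 x) - 9 / (k\<^sup>2 * c) * ?Q) \<le> morawetz_div k x"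
      by (simp only:)
    moreover have "c * (k\<^sup>2 / 2 * abs2 x + grad2 x) + (- (c * grad2 x) - R\<^sup>2 / c * ?Q) + (- (k\<^sup>2 * c / 4 * abs2 x) - 9 / (k\<^sup>2 * c) * ?Q)
       = k\<^sup>2 * c / 4 * abs2 x - (R\<^sup>2 / c + 9 / (k\<^sup>2 * c)) * ?Q"
      by (simp add: algebra_simps)
    moreover have "indicator (cball 0 R) x * (k\<^sup>2 * c / 4 * abs2 x) = k\<^sup>2 * c / 4 * abs2 x" using xR by simp
    ultimately show ?thesis by (simp only:)
  qed
qed

text \<open>The lower bound for the divergence is integrated against the squared cutoff, while
  \<open>morawetz_flux_upper\<close> makes the flux term at most \<open>4 * \<delta>\<close>. The
  coefficient drops from a quarter to an eighth of \<open>k\<^sup>2 * c\<close> because the squared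
  cutoff is only known to be at least 1/2 on the disc.\<close>

lemma helmholtz_bound:
  assumes k: "k > 0" and R: "R > 0"
    and F: "\<And>x. a11 x + a22 x + k\<^sup>2 * a x = F1 x" "\<And>x. b11 x + b22 x + k\<^sup>2 * b x = F2 x"
    and Fs: "\<And>x. norm x > R \<Longrightarrow> F1 x = 0" "\<And>x. norm x > R \<Longrightarrow> F2 x = 0"
    and sommerfeld: "((\<lambda>x. som_defect k x / norm x) \<longlongrightarrow> 0) at_infinity"
    and dec: "((\<lambda>x. abs2 x / norm x) \<longlongrightarrow> 0) at_infinity"
    and c: "c = inverse (sqrt (1 + k\<^sup>2 * R\<^sup>2)) ^ 3"
  shows "k\<^sup>2 * c / 8 * (LBINT x. indicator (cball 0 R) x * abs2 x)
      \<le> (R\<^sup>2 / c + 9 / (k\<^sup>2 * c)) * (LBINT x. (F1 x)\<^sup>2 + (F2 x)\<^sup>2)"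
proof -
  define C where "C = R\<^sup>2 / c + 9 / (k\<^sup>2 * c)"
  let ?Q = "\<lambda>x. (F1 x)\<^sup>2 + (F2 x)\<^sup>2"
  let ?IU = "LBINT x. indicator (cball 0 R) x * abs2 x"
  let ?g = "\<lambda>x. x$1 * morawetz_field k 1 a1 b1 x + x$2 * morawetz_field k 2 a2 b2 x"
  have cpos: "c > 0" unfolding c by (simp add: add_pos_nonneg)
  have Cpos: "C \<ge> 0" using cpos by (simp add: C_def)
  have cF: "continuous_on UNIV F1" "continuous_on UNIV F2"
    unfolding F[symmetric, abs_def] by (intro continuous_intros cont)+
  have cg: "continuous_on UNIV ?g" unfolding morawetz_field_def by (intro continuous_intros cont)
  have cdG: "continuous_on UNIV (morawetz_div k)" unfolding morawetz_div_def Let_def by (intro continuous_intros cont)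
  have iQ: "integrable lborel ?Q"
    by (rule integrable_lborel_compact_support[where M=R]) (auto intro!: continuous_intros cF simp: Fs)
  have iU: "integrable lborel (\<lambda>x. indicator (cball 0 R) x * abs2 x)"
    using borel_integrable_compact[of "cball 0 R" abs2] continuous_on_subset[OF continuous_on_aux(1)] by simp
  have small: "\<forall>\<^sub>F x in at_infinity. ?g x \<le> \<delta>" if "\<delta> > 0" for \<delta>
  proof -
    have "((\<lambda>x. 3/2 * (som_defect k x / norm x) + abs2 x / norm x) \<longlongrightarrow> 3/2 * 0 + 0) at_infinity"
      by (intro tendsto_intros sommerfeld dec)
    then have "\<forall>\<^sub>F x in at_infinity. 3/2 * (som_defect k x / norm x) + abs2 x / norm x < k * \<delta>"
      using k that by (intro order_tendstoD(2)) auto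
    moreover have "\<forall>\<^sub>F x in at_infinity. x \<noteq> (0::R2)"
      by (rule eventually_not_equal_at_infinity)
    ultimately show ?thesis
    proof eventually_elim
      case (elim x)
      have "(3/2 * som_defect k x + abs2 x) / (k * norm x) = (3/2 * (som_defect k x / norm x) + abs2 x / norm x) / k"
        using k elim(2) by (simp add: field_simps)
      with morawetz_flux_upper[OF k elim(2)] have "?g x \<le> (3/2 * (som_defect k x / norm x) + abs2 x / norm x) / k"
        by simp
      also have "\<dots> \<le> k * \<delta> / k" using elim(1) k by (intro divide_right_mono) auto
      finally show ?case using k by simp
    qed
  qed
  have "k\<^sup>2 * c / 8 * ?IU \<le> C * (LBINT x. ?Q x) + 4 * \<delta>" if \<delta>: "\<delta> > 0" for \<delta>
  proof -
    obtain M0 where M0: "M0 > 0" "\<And>M. M \<ge> M0 \<Longrightarrow> (LBINT x. cutoff M x * ?g x) / M\<^sup>2 \<le> \<delta>"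
      using cutoff_integral_average_small[OF cg small \<delta>] by blast
    define M where "M = max M0 (2 * R)"
    have M: "M \<ge> M0" "M \<ge> 2 * R" "M > 0" using M0(1) by (auto simp: M_def)
    have "indicator (cball 0 R) x * (k\<^sup>2 * c / 8 * abs2 x) - C * ?Q x \<le> (cutoff M x)\<^sup>2 * morawetz_div k x" for x
    proof -
      have L: "indicator (cball 0 R) x * (k\<^sup>2 * c / 4 * abs2 x) - C * ?Q x \<le> morawetz_div k x"
        unfolding C_def by (rule morawetz_div_lower[OF k R F Fs c])
      have 1: "(cutoff M x)\<^sup>2 * (indicator (cball 0 R) x * (k\<^sup>2 * c / 4 * abs2 x) - C * ?Q x) \<le> (cutoff M x)\<^sup>2 * morawetz_div k x"
        by (intro mult_left_mono L) simp
      have "(cutoff M x)\<^sup>2 \<le> 1" using cutoff_bounds[of M x] by (simp add: power_le_one)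
      then have 2: "(cutoff M x)\<^sup>2 * (C * ?Q x) \<le> 1 * (C * ?Q x)"
        by (intro mult_right_mono) (use Cpos in auto)
      have 3: "indicator (cball 0 R) x * (k\<^sup>2 * c / 8 * abs2 x) \<le> (cutoff M x)\<^sup>2 * (indicator (cball 0 R) x * (k\<^sup>2 * c / 4 * abs2 x))"
      proof (cases "norm x \<le> R")
        case True
        have "1/2 * (k\<^sup>2 * c / 4 * abs2 x) \<le> (cutoff M x)\<^sup>2 * (k\<^sup>2 * c / 4 * abs2 x)"
          by (rule mult_right_mono[OF cutoff_ge_half[OF True M(2,3)]]) (use cpos nonneg(1)[of x] in auto)
        then show ?thesis using True by simp
      qed simp
      show ?thesis using 1 2 3 unfolding right_diff_distrib[of "(cutoff M x)\<^sup>2"] by linarith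
    qed
    then have "(LBINT x. indicator (cball 0 R) x * (k\<^sup>2 * c / 8 * abs2 x) - C * ?Q x) \<le> (LBINT x. (cutoff M x)\<^sup>2 * morawetz_div k x)"
      using integrable_mult_right[OF iU, of "k\<^sup>2 * c / 8"] integrable_mult_right[OF iQ, of C]
      by (intro Bochner_Integration.integral_mono Bochner_Integration.integrable_diff integrable_cutoff_mult M cdG)
         (simp_all add: algebra_simps)
    moreover have "(LBINT x. indicator (cball 0 R) x * (k\<^sup>2 * c / 8 * abs2 x) - C * ?Q x)
        = k\<^sup>2 * c / 8 * ?IU - C * (LBINT x. ?Q x)"
    proof -
      have e: "indicator (cball 0 R) x * (k\<^sup>2 * c / 8 * abs2 x) = k\<^sup>2 * c / 8 * (indicator (cball 0 R) x * abs2 x)" for x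
        by (simp add: algebra_simps)
      show ?thesis
        unfolding e Bochner_Integration.integral_diff[OF integrable_mult_right[OF iU] integrable_mult_right[OF iQ]]
          integral_mult_right_zero ..
    qed
    moreover have "(LBINT x. (cutoff M x)\<^sup>2 * morawetz_div k x) = 4 * ((LBINT x. cutoff M x * ?g x) / M\<^sup>2)"
      using morawetz_cutoff[OF M(3)] by simp
    ultimately show ?thesis using M0(2)[OF M(1)] by linarith
  qed
  note * = this
  show ?thesis
    unfolding C_def[symmetric]
  proof (rule field_le_epsilon)
    fix e :: real assume "e > 0"
    then show "k\<^sup>2 * c / 8 * ?IU \<le> C * (LBINT x. ?Q x) + e" using *[of "e / 4"] by simp
  qed
qed

section \<open>Modified Helmholtz equation: bounded energy, local bound and vanishing flux\<close>

definition rad_energy :: "R2 \<Rightarrow> real" where "rad_energy x = a x * rad_a x + b x * rad_b x"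

lemma rad_energy_cutoff:
  assumes M: "M > 0"
  shows "(LBINT x. (cutoff M x)\<^sup>2 * (grad2 x + a x * (a11 x + a22 x) + b x * (b11 x + b22 x))) =
         (4 / M\<^sup>2) * (LBINT x. cutoff M x * rad_energy x)"
proof -
  note p1 = pd_add[OF pd_mult[OF pda(1,3)] pd_mult[OF pdb(1,3)]]
  note p2 = pd_add[OF pd_mult[OF pda(2,6)] pd_mult[OF pdb(2,6)]]
  have "(LBINT x. (cutoff M x)\<^sup>2 * ((a1 x * a1 x + a x * a11 x + (b1 x * b1 x + b x * b11 x))
        + (a2 x * a2 x + a x * a22 x + (b2 x * b2 x + b x * b22 x)))) =
         (4 / M\<^sup>2) * (LBINT x. cutoff M x * (x$1 * (a x * a1 x + b x * b1 x) + x$2 * (a x * a2 x + b x * b2 x)))"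
    by (rule integral_cut_divergence[OF M p1 p2]) (intro continuous_intros cont)+
  then show ?thesis by (simp add: rad_energy_def grad2_def rad_a_def rad_b_def algebra_simps power2_eq_square)
qed

text \<open>A Sommerfeld solution of the modified equation decays, since the boundary term is absorbed by
  the coercive term.\<close>
lemma modified_energy:
  assumes k: "k > 0" 
    and F: "\<And>x. a11 x + a22 x - k\<^sup>2 * a x = F1 x" "\<And>x. b11 x + b22 x - k\<^sup>2 * b x = F2 x"
    and Fs: "\<And>x. norm x > R \<Longrightarrow> F1 x = 0" "\<And>x. norm x > R \<Longrightarrow> F2 x = 0"
    and sommerfeld: "((\<lambda>x. som_defect k x / norm x) \<longlongrightarrow> 0) at_infinity" and \<delta>: "\<delta> > 0"
  obtains M0 where "M0 > 0" "\<And>M. M \<ge> M0 \<Longrightarrow> (LBINT x. (cutoff M x)\<^sup>2 * (grad2 x + k\<^sup>2 / 4 * abs2 x))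
      \<le> (LBINT x. (F1 x)\<^sup>2 + (F2 x)\<^sup>2) / k\<^sup>2 + \<delta>"
proof -
  let ?Q = "\<lambda>x. (F1 x)\<^sup>2 + (F2 x)\<^sup>2"
  let ?e = "\<lambda>x. som_defect k x / (1 + norm x)"
  have cF: "continuous_on UNIV F1" "continuous_on UNIV F2"
    unfolding F[symmetric, abs_def] by (intro continuous_intros cont)+
  have iQ: "integrable lborel ?Q"
    by (rule integrable_lborel_compact_support[where M=R]) (auto intro!: continuous_intros cF simp: Fs)
  have small: "\<forall>\<^sub>F x in at_infinity. ?e x \<le> \<epsilon>" if "\<epsilon> > 0" for \<epsilon>
  proof -
    have "\<forall>\<^sub>F x in at_infinity. som_defect k x / norm x < \<epsilon>"
      using sommerfeld that by (intro order_tendstoD(2)) auto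
    moreover have "\<forall>\<^sub>F x in at_infinity. x \<noteq> (0::R2)"
      by (rule eventually_not_equal_at_infinity)
    ultimately show ?thesis
    proof eventually_elim
      case (elim x)
      have "?e x \<le> som_defect k x / norm x"
        using elim(2) nonneg(3)[of k x] by (intro divide_left_mono) (auto simp: add_pos_nonneg)
      with elim(1) show ?case by simp
    qed
  qed
  have "\<delta> * k\<^sup>2 / 16 > 0" using \<delta> k by simp
  from cball_integral_average_small[OF som_defect_div_continuous small this] obtain M1 where M1: "M1 > 0"
    "\<forall>M\<ge>M1. \<forall>\<psi>. \<psi> \<in> borel_measurable borel \<longrightarrow> (\<forall>x. 0 \<le> \<psi> x \<and> \<psi> x \<le> 1) \<longrightarrow>
      (\<forall>x. norm x > M \<longrightarrow> \<psi> x = 0) \<longrightarrow> (LBINT x. \<psi> x * ?e x) / M\<^sup>2 \<le> \<delta> * k\<^sup>2 / 16" by blast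
  show ?thesis
  proof (rule that[of "max M1 1"])
    fix M assume "max M1 1 \<le> M"
    then have M: "M \<ge> M1" "M \<ge> 1" "M > 0" using M1(1) by auto
    have Ie: "(LBINT x. indicator (cball 0 M) x * ?e x) / M\<^sup>2 \<le> \<delta> * k\<^sup>2 / 16"
      by (rule M1(2)[rule_format, OF M(1)]) (auto simp: indicator_def)
    have ie: "integrable lborel (\<lambda>x. indicator (cball 0 M) x * ?e x)"
      using borel_integrable_compact[of "cball 0 M" ?e] continuous_on_subset[OF som_defect_div_continuous] by simp
    have cD: "continuous_on UNIV rad_energy" unfolding rad_energy_def by (intro continuous_intros cont)
    \<comment> \<open>Write \<open>x . grad u\<close> as its Sommerfeld defect plus
      \<open>\<i> k |x| u\<close>; the second part drops out of the real part
      \<open>rad_energy\<close>. Young's inequality charges the rest to half of the coercive term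
      and to the squared defect. The factor 16 / M^4 of the latter and the crude bound
      \<open>1 + norm x \<le> 2 * M\<^sup>2\<close> leave the 1 / M^2 of a disc average.\<close>
    have b: "4 / M\<^sup>2 * (cutoff M x * rad_energy x) \<le> (cutoff M x)\<^sup>2 * (k\<^sup>2 / 2 * abs2 x) + 16 / (k\<^sup>2 * M\<^sup>2) * (indicator (cball 0 M) x * ?e x)" for x
    proof (cases "norm x \<le> M")
      case False
      then show ?thesis using cutoff_eq_0[OF M(3), of x] by simp
    next
      case True
      have "rad_energy x = a x * (rad_a x + k * norm x * b x) + b x * (rad_b x - k * norm x * a x)" by (simp add: rad_energy_def algebra_simps)
      then have "4 / M\<^sup>2 * (cutoff M x * rad_energy x) = (cutoff M x * a x) * (4 / M\<^sup>2 * (rad_a x + k * norm x * b x))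
           + (cutoff M x * b x) * (4 / M\<^sup>2 * (rad_b x - k * norm x * a x))" by (simp add: algebra_simps)
      also have "\<dots> \<le> k\<^sup>2/2 * ((cutoff M x * a x)\<^sup>2 + (cutoff M x * b x)\<^sup>2)
          + ((4 / M\<^sup>2 * (rad_a x + k * norm x * b x))\<^sup>2 + (4 / M\<^sup>2 * (rad_b x - k * norm x * a x))\<^sup>2) / (4 * (k\<^sup>2/2))"
        using young_pair[of "k\<^sup>2/2"] k by (smt (verit, best) half_gt_zero zero_less_power)
      also have "\<dots> = (cutoff M x)\<^sup>2 * (k\<^sup>2 / 2 * abs2 x) + (4 / M\<^sup>2)\<^sup>2 * som_defect k x / (2 * k\<^sup>2)"
        unfolding abs2_def som_defect_def power_mult_distrib by (simp add: algebra_simps add_divide_distrib)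
      also have "(4 / M\<^sup>2)\<^sup>2 * som_defect k x / (2 * k\<^sup>2) \<le> 16 / (k\<^sup>2 * M\<^sup>2) * ?e x"
      proof -
        have n1: "1 + norm x > 0" by (simp add: add_pos_nonneg)
        then have "som_defect k x = (1 + norm x) * ?e x" by simp
        also have "\<dots> \<le> (2 * M\<^sup>2) * ?e x"
        proof (rule mult_right_mono)
          have "M \<le> M\<^sup>2" using self_le_power[OF M(2), of 2] by simp
          then show "1 + norm x \<le> 2 * M\<^sup>2" using M(2) True by linarith
        qed (use nonneg(3)[of k x] n1 in simp)
        finally have "(4 / M\<^sup>2)\<^sup>2 * som_defect k x / (2 * k\<^sup>2) \<le> (4 / M\<^sup>2)\<^sup>2 * (2 * M\<^sup>2 * ?e x) / (2 * k\<^sup>2)"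
          by (intro divide_right_mono mult_left_mono) auto
        also have "\<dots> = 16 / (k\<^sup>2 * M\<^sup>2) * ?e x"
          using M(3) k by (simp add: power2_eq_square divide_simps)
        finally show ?thesis .
      qed
      finally show ?thesis using True by simp
    qed
    have i1: "integrable lborel (\<lambda>x. (cutoff M x)\<^sup>2 * (k\<^sup>2 / 2 * abs2 x))"
      by (intro integrable_cutoff_mult M continuous_intros)
    have "4 / M\<^sup>2 * (LBINT x. cutoff M x * rad_energy x) = (LBINT x. 4 / M\<^sup>2 * (cutoff M x * rad_energy x))" by simp
    also have "\<dots> \<le> (LBINT x. (cutoff M x)\<^sup>2 * (k\<^sup>2 / 2 * abs2 x) + 16 / (k\<^sup>2 * M\<^sup>2) * (indicator (cball 0 M) x * ?e x))"
      by (rule Bochner_Integration.integral_mono[OF integrable_mult_right[OF integrable_cutoff_mult(1)[OF M(3) cD]]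
            Bochner_Integration.integrable_add[OF i1 integrable_mult_right[OF ie]] b])
    also have "\<dots> = (LBINT x. (cutoff M x)\<^sup>2 * (k\<^sup>2 / 2 * abs2 x)) + 16 / k\<^sup>2 * ((LBINT x. indicator (cball 0 M) x * ?e x) / M\<^sup>2)"
      by (subst Bochner_Integration.integral_add[OF i1 integrable_mult_right[OF ie]], subst integral_mult_right_zero) simp
    also have "16 / k\<^sup>2 * ((LBINT x. indicator (cball 0 M) x * ?e x) / M\<^sup>2) \<le> 16 / k\<^sup>2 * (\<delta> * k\<^sup>2 / 16)"
      by (rule mult_left_mono[OF Ie]) simp
    also have "\<dots> = \<delta>" using k by simp
    finally have f1: "4 / M\<^sup>2 * (LBINT x. cutoff M x * rad_energy x) \<le> (LBINT x. (cutoff M x)\<^sup>2 * (k\<^sup>2 / 2 * abs2 x)) + \<delta>" by simp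
    have eqN: "grad2 x + a x * (a11 x + a22 x) + b x * (b11 x + b22 x) = grad2 x + k\<^sup>2 * abs2 x + (a x * F1 x + b x * F2 x)" for x
      by (simp add: F[symmetric] abs2_def power2_eq_square algebra_simps)
    \<comment> \<open>Of the coercive \<open>k\<^sup>2 * abs2 x\<close>, one half pays for the
      boundary term, a quarter for the source, and a quarter is kept.\<close>
    have b2: "(cutoff M x)\<^sup>2 * (grad2 x + k\<^sup>2 / 4 * abs2 x) + (cutoff M x)\<^sup>2 * (k\<^sup>2 / 2 * abs2 x) - ?Q x / k\<^sup>2
        \<le> (cutoff M x)\<^sup>2 * (grad2 x + a x * (a11 x + a22 x) + b x * (b11 x + b22 x))" for x
    proof -
      have "\<bar>a x * F1 x + b x * F2 x\<bar> \<le> k\<^sup>2/4 * abs2 x + ?Q x / (4 * (k\<^sup>2/4))"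
        unfolding abs2_def by (rule young_pair) (use k in auto)
      then have "- (k\<^sup>2/4 * abs2 x) - ?Q x / k\<^sup>2 \<le> a x * F1 x + b x * F2 x" by simp
      then have "(cutoff M x)\<^sup>2 * (grad2 x + k\<^sup>2 * abs2 x + (- (k\<^sup>2/4 * abs2 x) - ?Q x / k\<^sup>2)) \<le> (cutoff M x)\<^sup>2 * (grad2 x + k\<^sup>2 * abs2 x + (a x * F1 x + b x * F2 x))"
        by (intro mult_left_mono add_left_mono) auto
      moreover have "(cutoff M x)\<^sup>2 * (?Q x / k\<^sup>2) \<le> 1 * (?Q x / k\<^sup>2)"
        using cutoff_bounds[of M x] by (intro mult_right_mono) (simp_all add: power_le_one)
      moreover have "(cutoff M x)\<^sup>2 * (grad2 x + k\<^sup>2 * abs2 x + (- (k\<^sup>2/4 * abs2 x) - ?Q x / k\<^sup>2)) =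
         (cutoff M x)\<^sup>2 * (grad2 x + k\<^sup>2 / 4 * abs2 x) + (cutoff M x)\<^sup>2 * (k\<^sup>2 / 2 * abs2 x) - (cutoff M x)\<^sup>2 * (?Q x / k\<^sup>2)"
        by (simp add: algebra_simps)
      ultimately show ?thesis unfolding eqN by linarith
    qed
    have i2: "integrable lborel (\<lambda>x. (cutoff M x)\<^sup>2 * (grad2 x + k\<^sup>2 / 4 * abs2 x))"
      by (intro integrable_cutoff_mult M continuous_intros)
    have i3: "integrable lborel (\<lambda>x. (cutoff M x)\<^sup>2 * (grad2 x + a x * (a11 x + a22 x) + b x * (b11 x + b22 x)))"
      by (intro integrable_cutoff_mult M continuous_intros cont)
    have i4: "integrable lborel (\<lambda>x. ?Q x / k\<^sup>2)" using iQ by simp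
    have "(LBINT x. (cutoff M x)\<^sup>2 * (grad2 x + k\<^sup>2 / 4 * abs2 x) + (cutoff M x)\<^sup>2 * (k\<^sup>2 / 2 * abs2 x) - ?Q x / k\<^sup>2)
        \<le> (LBINT x. (cutoff M x)\<^sup>2 * (grad2 x + a x * (a11 x + a22 x) + b x * (b11 x + b22 x)))"
      by (rule Bochner_Integration.integral_mono[OF Bochner_Integration.integrable_diff[OF Bochner_Integration.integrable_add[OF i2 i1] i4] i3 b2])
    moreover have "(LBINT x. (cutoff M x)\<^sup>2 * (grad2 x + k\<^sup>2 / 4 * abs2 x) + (cutoff M x)\<^sup>2 * (k\<^sup>2 / 2 * abs2 x) - ?Q x / k\<^sup>2)
      = (LBINT x. (cutoff M x)\<^sup>2 * (grad2 x + k\<^sup>2 / 4 * abs2 x)) + (LBINT x. (cutoff M x)\<^sup>2 * (k\<^sup>2 / 2 * abs2 x)) - (LBINT x. ?Q x) / k\<^sup>2"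
      by (subst Bochner_Integration.integral_diff[OF Bochner_Integration.integrable_add[OF i2 i1] i4],
          subst Bochner_Integration.integral_add[OF i2 i1]) simp
    ultimately show "(LBINT x. (cutoff M x)\<^sup>2 * (grad2 x + k\<^sup>2 / 4 * abs2 x)) \<le> (LBINT x. ?Q x) / k\<^sup>2 + \<delta>"
      using rad_energy_cutoff[OF M(3)] f1 by linarith
  qed simp
qed

text \<open>The eighth is the quarter kept in \<open>modified_energy\<close>, halved by passing from
  the squared cutoff to the disc.\<close>

lemma modified_bound:
  assumes k: "k > 0"
    and F: "\<And>x. a11 x + a22 x - k\<^sup>2 * a x = F1 x" "\<And>x. b11 x + b22 x - k\<^sup>2 * b x = F2 x"
    and Fs: "\<And>x. norm x > R \<Longrightarrow> F1 x = 0" "\<And>x. norm x > R \<Longrightarrow> F2 x = 0"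
    and sommerfeld: "((\<lambda>x. som_defect k x / norm x) \<longlongrightarrow> 0) at_infinity"
  shows "k\<^sup>2 / 8 * (LBINT x. indicator (cball 0 R) x * abs2 x) \<le> (LBINT x. (F1 x)\<^sup>2 + (F2 x)\<^sup>2) / k\<^sup>2"
proof (rule field_le_epsilon)
  fix e :: real assume e: "e > 0"
  obtain M0 where M0: "M0 > 0" "\<And>M. M \<ge> M0 \<Longrightarrow> (LBINT x. (cutoff M x)\<^sup>2 * (grad2 x + k\<^sup>2 / 4 * abs2 x))
      \<le> (LBINT x. (F1 x)\<^sup>2 + (F2 x)\<^sup>2) / k\<^sup>2 + e"
    using modified_energy[OF k F Fs sommerfeld e] by blast
  define M where "M = max M0 (2 * R)"
  have M: "M \<ge> M0" "M \<ge> 2 * R" "M > 0" using M0(1) by (auto simp: M_def)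
  have "(LBINT x. indicator (cball 0 R) x * abs2 x) \<le> 2 * (LBINT x. (cutoff M x)\<^sup>2 * abs2 x)"
    by (rule integral_cball_le[OF continuous_on_aux(1) nonneg(1) M(2,3)])
  then have "k\<^sup>2 / 8 * (LBINT x. indicator (cball 0 R) x * abs2 x) \<le> k\<^sup>2 / 8 * (2 * (LBINT x. (cutoff M x)\<^sup>2 * abs2 x))"
    by (rule mult_left_mono) simp
  also have "\<dots> = (LBINT x. (cutoff M x)\<^sup>2 * (k\<^sup>2 / 4 * abs2 x))"
    by (simp add: mult.left_commute[of "_\<^sup>2" "k\<^sup>2"])
  also have "\<dots> \<le> (LBINT x. (cutoff M x)\<^sup>2 * (grad2 x + k\<^sup>2 / 4 * abs2 x))"
    by (intro Bochner_Integration.integral_mono integrable_cutoff_mult M continuous_intros mult_left_mono)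
       (use nonneg(2) in auto)
  finally show "k\<^sup>2 / 8 * (LBINT x. indicator (cball 0 R) x * abs2 x) \<le> (LBINT x. (F1 x)\<^sup>2 + (F2 x)\<^sup>2) / k\<^sup>2 + e"
    using M0(2)[OF M(1)] by linarith
qed

lemma rad_flux_abs_le: "\<bar>rad_flux x\<bar> \<le> norm x * (abs2 x + grad2 x)"
proof -
  have "\<bar>rad_flux x\<bar> \<le> norm x * sqrt (abs2 x) * sqrt (grad2 x)"
  proof (rule power2_le_imp_le)
    have "(rad_flux x)\<^sup>2 \<le> abs2 x * ((rad_a x)\<^sup>2 + (rad_b x)\<^sup>2)"
    proof -
      have "abs2 x * ((rad_a x)\<^sup>2 + (rad_b x)\<^sup>2) - (rad_flux x)\<^sup>2 = (a x * rad_a x + b x * rad_b x)\<^sup>2"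
        unfolding abs2_def rad_flux_def by algebra
      then show ?thesis by (smt (verit) zero_le_power2)
    qed
    also have "\<dots> \<le> abs2 x * ((norm x)\<^sup>2 * grad2 x)"
      by (intro mult_left_mono cauchy_schwarz_radial nonneg)
    also have "\<dots> = (norm x * sqrt (abs2 x) * sqrt (grad2 x))\<^sup>2"
      using nonneg(1,2)[of x] by (simp add: power_mult_distrib)
    finally show "\<bar>rad_flux x\<bar>\<^sup>2 \<le> (norm x * sqrt (abs2 x) * sqrt (grad2 x))\<^sup>2" by simp
  qed (use nonneg in auto)
  also have "\<dots> = norm x * (sqrt (abs2 x) * sqrt (grad2 x))" by simp
  also have "\<dots> \<le> norm x * (abs2 x + grad2 x)"
  proof (rule mult_left_mono)
    have "sqrt (abs2 x) * sqrt (grad2 x) \<le> 1 * (sqrt (abs2 x))\<^sup>2 + (sqrt (grad2 x))\<^sup>2 / (4 * 1)"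
      using young_mult[of 1 "sqrt (abs2 x)" "sqrt (grad2 x)"] by linarith
    then show "sqrt (abs2 x) * sqrt (grad2 x) \<le> abs2 x + grad2 x" using nonneg(1,2)[of x] by simp
  qed simp
  finally show ?thesis .
qed

text \<open>By \<open>modified_energy\<close> the energy on large discs is bounded independently of
  the radius. The flux density is at most |x| times the energy density and |x| is at most
  \<open>M\<close> on the support of the cutoff, so the factor \<open>4 / M\<^sup>2\<close> leaves
  O(1 / M).\<close>

lemma modified_flux_zero:
  assumes k: "k > 0"
    and F: "\<And>x. a11 x + a22 x - k\<^sup>2 * a x = F1 x" "\<And>x. b11 x + b22 x - k\<^sup>2 * b x = F2 x"
    and Fs: "\<And>x. norm x > R \<Longrightarrow> F1 x = 0" "\<And>x. norm x > R \<Longrightarrow> F2 x = 0"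
    and sommerfeld: "((\<lambda>x. som_defect k x / norm x) \<longlongrightarrow> 0) at_infinity"
  shows "(LBINT x. a x * F2 x - b x * F1 x) = 0"
proof -
  have cF: "continuous_on UNIV F1" "continuous_on UNIV F2"
    unfolding F[symmetric, abs_def] by (intro continuous_intros cont)+
  let ?q = "\<lambda>x. a x * F2 x - b x * F1 x"
  have lim: "((\<lambda>M. LBINT x. (cutoff M x)\<^sup>2 * ?q x) \<longlongrightarrow> (LBINT x. ?q x)) at_top"
    by (rule integral_cutoff_tendsto[where R=R]) (auto intro!: continuous_intros cont cF simp: Fs)
  have eq: "a x * (b11 x + b22 x) - b x * (a11 x + a22 x) = ?q x" for x
    by (simp add: F[symmetric] algebra_simps)
  have cJ: "continuous_on UNIV rad_flux" unfolding rad_flux_def by (intro continuous_intros cont)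
  obtain M0 K where M0: "M0 > 0" and K: "\<And>M. M \<ge> M0 \<Longrightarrow> (LBINT x. (cutoff M x)\<^sup>2 * (grad2 x + k\<^sup>2 / 4 * abs2 x)) \<le> K"
    using modified_energy[OF k F Fs sommerfeld zero_less_one] by blast
  \<comment> \<open>\<open>m\<close> compares the plain density \<open>abs2 + grad2\<close> with the
    weighted density of \<open>modified_energy\<close>.\<close>
  define m where "m = min 1 (k\<^sup>2 / 4)"
  have m: "m > 0" "m \<le> 1" "m \<le> k\<^sup>2 / 4" using k by (auto simp: m_def)
  have bound: "norm (LBINT x. (cutoff M x)\<^sup>2 * ?q x) \<le> 8 * K / m / M" if M: "M \<ge> M0" for M
  proof -
    have M': "M > 0" "2 * M > 0" "2 * M \<ge> M0" using M M0 by auto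
    have b: "\<bar>cutoff M x * rad_flux x\<bar> \<le> M * 2 * ((cutoff (2 * M) x)\<^sup>2 * ((grad2 x + k\<^sup>2 / 4 * abs2 x) / m))" for x
    proof -
      have "\<bar>cutoff M x * rad_flux x\<bar> \<le> cutoff M x * (norm x * (abs2 x + grad2 x))"
        unfolding abs_mult using cutoff_bounds[of M x] by (simp add: mult_left_mono[OF rad_flux_abs_le])
      also have "\<dots> = (cutoff M x * norm x) * (abs2 x + grad2 x)" by simp
      also have "\<dots> \<le> (M * (2 * (cutoff (2 * M) x)\<^sup>2)) * ((grad2 x + k\<^sup>2 / 4 * abs2 x) / m)"
      proof (rule mult_mono[OF cutoff_norm_le[OF M'(1)]])
        have "m * abs2 x \<le> k\<^sup>2 / 4 * abs2 x" "m * grad2 x \<le> 1 * grad2 x"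
          by (intro mult_right_mono m nonneg)+
        then have "(abs2 x + grad2 x) * m \<le> grad2 x + k\<^sup>2 / 4 * abs2 x" by (simp add: algebra_simps)
        then show "abs2 x + grad2 x \<le> (grad2 x + k\<^sup>2 / 4 * abs2 x) / m" using m(1) by (simp add: pos_le_divide_eq)
      qed (use M' in \<open>auto simp: nonneg(1,2) add_nonneg_nonneg\<close>)
      finally show ?thesis by simp
    qed
    have i: "integrable lborel (\<lambda>x. (cutoff (2*M) x)\<^sup>2 * ((grad2 x + k\<^sup>2 / 4 * abs2 x) / m))"
      by (intro integrable_cutoff_mult M' continuous_intros) (use m in auto)
    have "norm (LBINT x. cutoff M x * rad_flux x) \<le> (LBINT x. \<bar>cutoff M x * rad_flux x\<bar>)"
      using integral_norm_bound[of lborel "\<lambda>x. cutoff M x * rad_flux x"] by simp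
    also have "\<dots> \<le> (LBINT x. M * 2 * ((cutoff (2 * M) x)\<^sup>2 * ((grad2 x + k\<^sup>2 / 4 * abs2 x) / m)))"
      using integrable_cutoff_mult(1)[OF M'(1) cJ]
      by (intro Bochner_Integration.integral_mono integrable_mult_right i b integrable_abs) auto
    also have "\<dots> = M * 2 * ((LBINT x. (cutoff (2 * M) x)\<^sup>2 * (grad2 x + k\<^sup>2 / 4 * abs2 x)) / m)" by simp
    also have "\<dots> \<le> M * 2 * (K / m)"
      using K[OF M'(3)] m M' by (intro mult_left_mono divide_right_mono) auto
    finally have "norm (LBINT x. cutoff M x * rad_flux x) \<le> M * 2 * (K / m)" .
    then have "norm ((4 / M\<^sup>2) * (LBINT x. cutoff M x * rad_flux x)) \<le> (4 / M\<^sup>2) * (M * 2 * (K / m))"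
      by (simp only: norm_mult) (intro mult_mono, auto)
    also have "\<dots> = 8 * K / m / M" using M' by (simp add: power2_eq_square)
    finally show ?thesis using rad_flux_cutoff[OF M'(1)] unfolding eq by simp
  qed
  have "((\<lambda>M. LBINT x. (cutoff M x)\<^sup>2 * ?q x) \<longlongrightarrow> 0) at_top"
  proof (rule Lim_null_comparison)
    show "\<forall>\<^sub>F M in at_top. norm (LBINT x. (cutoff M x)\<^sup>2 * ?q x) \<le> 8 * K / m / M"
      using eventually_ge_at_top[of M0] by eventually_elim (rule bound)
    show "((\<lambda>M. 8 * K / m / M) \<longlongrightarrow> 0) at_top"
      by (rule real_tendsto_divide_at_top[OF tendsto_const filterlim_ident])
  qed
  then show ?thesis by (rule tendsto_unique[OF trivial_limit_at_top_linorder lim])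
qed

end

subsection \<open>Convolution and the Sommerfeld condition\<close>

definition grad_at :: "(R2 \<Rightarrow> 'a::real_normed_vector) \<Rightarrow> (R2 \<Rightarrow> 'a) \<Rightarrow> (R2 \<Rightarrow> 'a) \<Rightarrow> R2 \<Rightarrow> bool" where
  "grad_at u u1 u2 x \<longleftrightarrow> (u has_derivative (\<lambda>h. h$1 *\<^sub>R u1 x + h$2 *\<^sub>R u2 x)) (at x)"

lemma grad_at_line:
  assumes "grad_at u u1 u2 x"
  shows "((\<lambda>t. u (x + t *\<^sub>R axis 1 1)) has_vector_derivative u1 x) (at 0)"
    "((\<lambda>t. u (x + t *\<^sub>R axis 2 1)) has_vector_derivative u2 x) (at 0)"
proof -
  have d: "((\<lambda>t. x + t *\<^sub>R e) has_derivative (\<lambda>t. t *\<^sub>R e)) (at 0)" for e :: R2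
    by (auto intro!: derivative_eq_intros)
  have *: "((\<lambda>t. u (x + t *\<^sub>R e)) has_derivative (\<lambda>t. (t *\<^sub>R e)$1 *\<^sub>R u1 x + (t *\<^sub>R e)$2 *\<^sub>R u2 x)) (at 0)" for e
  proof -
    have "(u has_derivative (\<lambda>h. h$1 *\<^sub>R u1 x + h$2 *\<^sub>R u2 x)) (at (x + 0 *\<^sub>R e))"
      using assms by (simp add: grad_at_def)
    from has_derivative_compose[OF d this] show ?thesis .
  qed
  show "((\<lambda>t. u (x + t *\<^sub>R axis 1 1)) has_vector_derivative u1 x) (at 0)"
    using *[of "axis 1 1"] by (simp add: has_vector_derivative_def axis_nth_2)
  show "((\<lambda>t. u (x + t *\<^sub>R axis 2 1)) has_vector_derivative u2 x) (at 0)"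
    using *[of "axis 2 1"] by (simp add: has_vector_derivative_def axis_nth_2)
qed

lemma has_vector_derivative_Re_Im:
  assumes "(f has_vector_derivative f') F"
  shows "((\<lambda>t. Re (f t)) has_real_derivative Re f') F" "((\<lambda>t. Im (f t)) has_real_derivative Im f') F"
  using bounded_linear.has_vector_derivative[OF bounded_linear_Re assms]
    bounded_linear.has_vector_derivative[OF bounded_linear_Im assms]
  by (simp_all add: has_real_derivative_iff_has_vector_derivative)

lemma grad_at_pd:
  assumes "\<And>x. grad_at u u1 u2 x"
  shows "pd 1 (\<lambda>x. Re (u x)) (\<lambda>x. Re (u1 x))" "pd 2 (\<lambda>x. Re (u x)) (\<lambda>x. Re (u2 x))"
    "pd 1 (\<lambda>x. Im (u x)) (\<lambda>x. Im (u1 x))" "pd 2 (\<lambda>x. Im (u x)) (\<lambda>x. Im (u2 x))"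
  unfolding pd_def
  using has_vector_derivative_Re_Im[OF grad_at_line(1)[OF assms]] has_vector_derivative_Re_Im[OF grad_at_line(2)[OF assms]]
  by auto

lemma integral_vector_pd_eq_0:
  fixes G G' :: "R2 \<Rightarrow> complex"
  assumes d: "\<And>x. ((\<lambda>t. G (x + t *\<^sub>R axis i 1)) has_vector_derivative G' x) (at 0)"
    and c: "continuous_on UNIV G" "continuous_on UNIV G'" and s: "\<And>x. norm x > M \<Longrightarrow> G x = 0"
    "\<And>x. norm x > M \<Longrightarrow> G' x = 0"
  shows "(LBINT x. G' x) = 0"
proof -
  have i: "integrable lborel G'" by (rule integrable_lborel_compact_support[OF c(2) s(2)])
  have "(LBINT x. Re (G' x)) = 0" "(LBINT x. Im (G' x)) = 0"
    by (rule integral_pd_eq_0[where i=i and M=M and G="\<lambda>x. Re (G x)"] integral_pd_eq_0[where i=i and M=M and G="\<lambda>x. Im (G x)"];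
        use has_vector_derivative_Re_Im[OF d] s in \<open>auto simp: pd_def intro!: continuous_intros c\<close>)+
  then show ?thesis using i by (simp add: complex_eq_iff)
qed

text \<open>With r = |x| this is sqrt r times the modulus of d_r u - i k u, since
  \<open>x . grad u\<close> is r d_r u. In this form its square is the Sommerfeld defect over |x|,
  the quantity in the energy estimates.\<close>

definition sommerfeld :: "real \<Rightarrow> (R2 \<Rightarrow> complex) \<Rightarrow> (R2 \<Rightarrow> complex) \<Rightarrow> (R2 \<Rightarrow> complex) \<Rightarrow> bool" where
  "sommerfeld k u u1 u2 \<longleftrightarrow> ((\<lambda>x. cmod (x$1 *\<^sub>R u1 x + x$2 *\<^sub>R u2 x - \<i> * of_real (k * norm x) * u x) / sqrt (norm x)) \<longlongrightarrow> 0) at_infinity"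

lemma sommerfeld_add:
  assumes "sommerfeld k u u1 u2" "sommerfeld k v v1 v2"
  shows "sommerfeld k (\<lambda>x. u x + v x) (\<lambda>x. u1 x + v1 x) (\<lambda>x. u2 x + v2 x)"
  unfolding sommerfeld_def
proof (rule Lim_null_comparison)
  let ?s = "\<lambda>u u1 u2 (x::R2). cmod (x$1 *\<^sub>R u1 x + x$2 *\<^sub>R u2 x - \<i> * of_real (k * norm x) * u x)"
  show "((\<lambda>x. ?s u u1 u2 x / sqrt (norm x) + ?s v v1 v2 x / sqrt (norm x)) \<longlongrightarrow> 0) at_infinity"
    using tendsto_add[OF assms[unfolded sommerfeld_def]] by simp
  show "\<forall>\<^sub>F x in at_infinity. norm (?s (\<lambda>x. u x + v x) (\<lambda>x. u1 x + v1 x) (\<lambda>x. u2 x + v2 x) x / sqrt (norm x))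
     \<le> ?s u u1 u2 x / sqrt (norm x) + ?s v v1 v2 x / sqrt (norm x)"
  proof (intro always_eventually allI)
    fix x :: R2
    have "?s (\<lambda>x. u x + v x) (\<lambda>x. u1 x + v1 x) (\<lambda>x. u2 x + v2 x) x =
       cmod ((x$1 *\<^sub>R u1 x + x$2 *\<^sub>R u2 x - \<i> * of_real (k * norm x) * u x) + (x$1 *\<^sub>R v1 x + x$2 *\<^sub>R v2 x - \<i> * of_real (k * norm x) * v x))"
      by (simp add: algebra_simps)
    also have "\<dots> \<le> ?s u u1 u2 x + ?s v v1 v2 x" by (rule norm_triangle_ineq)
    finally have "?s (\<lambda>x. u x + v x) (\<lambda>x. u1 x + v1 x) (\<lambda>x. u2 x + v2 x) x / sqrt (norm x) \<le> (?s u u1 u2 x + ?s v v1 v2 x) / sqrt (norm x)"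
      by (rule divide_right_mono) simp
    then show "norm (?s (\<lambda>x. u x + v x) (\<lambda>x. u1 x + v1 x) (\<lambda>x. u2 x + v2 x) x / sqrt (norm x))
     \<le> ?s u u1 u2 x / sqrt (norm x) + ?s v v1 v2 x / sqrt (norm x)"
      by (simp add: add_divide_distrib)
  qed
qed

lemma sommerfeld_cmult:
  assumes "sommerfeld k u u1 u2"
  shows "sommerfeld k (\<lambda>x. c * u x) (\<lambda>x. c * u1 x) (\<lambda>x. c * u2 x)"
proof -
  have "cmod (x$1 *\<^sub>R (c * u1 x) + x$2 *\<^sub>R (c * u2 x) - \<i> * of_real (k * norm x) * (c * u x)) =
     cmod c * cmod (x$1 *\<^sub>R u1 x + x$2 *\<^sub>R u2 x - \<i> * of_real (k * norm x) * u x)" for x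
    by (simp add: norm_mult[symmetric] algebra_simps)
  then show ?thesis
    using tendsto_mult_left_zero[OF assms[unfolded sommerfeld_def], of "cmod c"]
      tendsto_mult_right_zero[OF assms[unfolded sommerfeld_def], of "cmod c"] by (simp add: sommerfeld_def)
qed

text \<open>Along a ray, \<open>exp (- \<i> k r) u\<close> has derivative of size \<open>o(r powr - 1/2)\<close>.\<close>
lemma sommerfeld_growth:
  assumes d: "\<And>x. norm x > R \<Longrightarrow> grad_at u u1 u2 x" and sommerfeld: "sommerfeld k u u1 u2"
  shows "((\<lambda>x. cmod (u x) / sqrt (norm x)) \<longlongrightarrow> 0) at_infinity"
proof (rule tendstoI)
  fix e :: real assume e: "e > 0"
  define \<delta> where "\<delta> = e / 4"
  have \<delta>: "\<delta> > 0" using e by (simp add: \<delta>_def)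
  let ?s = "\<lambda>x. cmod (x$1 *\<^sub>R u1 x + x$2 *\<^sub>R u2 x - \<i> * of_real (k * norm x) * u x)"
  have "\<forall>\<^sub>F x in at_infinity. ?s x / sqrt (norm x) < \<delta>"
    using sommerfeld \<delta> unfolding sommerfeld_def by (rule order_tendstoD(2))
  then obtain \<rho>0 where \<rho>0: "\<And>x. norm x \<ge> \<rho>0 \<Longrightarrow> ?s x / sqrt (norm x) < \<delta>"
    by (auto simp: eventually_at_infinity)
  define \<rho> where "\<rho> = max (max \<rho>0 (R + 1)) 1"
  have \<rho>: "\<rho> > 0" "\<rho> \<ge> \<rho>0" "\<rho> > R" by (auto simp: \<rho>_def)
  have "continuous_on (sphere 0 \<rho>) u"
  proof (rule continuous_at_imp_continuous_on, rule ballI)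
    fix x :: R2 assume "x \<in> sphere 0 \<rho>"
    then show "isCont u x" using d[of x] \<rho> by (auto simp: grad_at_def intro: has_derivative_continuous)
  qed
  then have "bounded (u ` sphere 0 \<rho>)" by (intro compact_imp_bounded compact_continuous_image) auto
  then obtain C where C: "C > 0" "\<And>x. norm x = \<rho> \<Longrightarrow> cmod (u x) \<le> C" by (auto simp: bounded_pos)
  have main: "cmod (u x) \<le> C + 2 * \<delta> * sqrt (norm x)" if x: "norm x > \<rho>" for x
  proof -
    define r where "r = norm x"
    define \<theta> where "\<theta> = x /\<^sub>R r"
    have r: "r > \<rho>" "r > 0" using x \<rho> by (auto simp: r_def)
    have n\<theta>: "norm \<theta> = 1" using r by (simp add: \<theta>_def r_def)
    define \<psi> where "\<psi> t = exp (- (\<i> * of_real (k * t))) * u (t *\<^sub>R \<theta>)" for t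
    define \<psi>' where "\<psi>' t = exp (- (\<i> * of_real (k * t))) * (\<theta>$1 *\<^sub>R u1 (t *\<^sub>R \<theta>) + \<theta>$2 *\<^sub>R u2 (t *\<^sub>R \<theta>) - \<i> * of_real k * u (t *\<^sub>R \<theta>))" for t
    have der: "(\<psi> has_vector_derivative \<psi>' t) (at t)" if t: "t \<ge> \<rho>" for t
    proof -
      have "norm (t *\<^sub>R \<theta>) > R" using t \<rho> n\<theta> by simp
      from d[OF this] have "(u has_derivative (\<lambda>h. h$1 *\<^sub>R u1 (t *\<^sub>R \<theta>) + h$2 *\<^sub>R u2 (t *\<^sub>R \<theta>))) (at (t *\<^sub>R \<theta>))"
        by (simp add: grad_at_def)
      moreover have "((\<lambda>t. t *\<^sub>R \<theta>) has_derivative (\<lambda>s. s *\<^sub>R \<theta>)) (at t)"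
        by (auto intro!: derivative_eq_intros)
      ultimately have "((\<lambda>t. u (t *\<^sub>R \<theta>)) has_derivative (\<lambda>s. (s *\<^sub>R \<theta>)$1 *\<^sub>R u1 (t *\<^sub>R \<theta>) + (s *\<^sub>R \<theta>)$2 *\<^sub>R u2 (t *\<^sub>R \<theta>))) (at t)"
        by (intro has_derivative_compose[where g=u and f="\<lambda>t. t *\<^sub>R \<theta>"])
      then have 1: "((\<lambda>t. u (t *\<^sub>R \<theta>)) has_vector_derivative (\<theta>$1 *\<^sub>R u1 (t *\<^sub>R \<theta>) + \<theta>$2 *\<^sub>R u2 (t *\<^sub>R \<theta>))) (at t)"
        by (simp add: has_vector_derivative_def scaleR_add_right)
      have 2: "((\<lambda>t. exp (- (\<i> * of_real (k * t)))) has_vector_derivative exp (- (\<i> * of_real (k * t))) * - (\<i> * of_real k)) (at t)"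
      proof -
        have "((\<lambda>z. exp (- (\<i> * (of_real k * z)))) has_field_derivative exp (- (\<i> * of_real (k * t))) * - (\<i> * of_real k)) (at (of_real t))"
          by (auto intro!: derivative_eq_intros)
        from has_vector_derivative_real_field[OF this] show ?thesis by simp
      qed
      show ?thesis
        unfolding \<psi>_def \<psi>'_def using has_vector_derivative_mult[OF 2 1] by (simp add: algebra_simps)
    qed
    \<comment> \<open>\<open>2 * \<delta> * sqrt t\<close> is an antiderivative of
      \<open>\<delta> / sqrt t\<close>, which bounds the derivative of \<open>\<psi>\<close> along
      the ray by the Sommerfeld condition.\<close>
    have "norm (\<psi> r - \<psi> \<rho>) \<le> 2 * \<delta> * sqrt r - 2 * \<delta> * sqrt \<rho>"
    proof (rule differentiable_bound_general[OF r(1)])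
      show "continuous_on {\<rho>..r} \<psi>"
        using der by (intro continuous_at_imp_continuous_on ballI) (auto intro: has_vector_derivative_continuous)
      show "continuous_on {\<rho>..r} (\<lambda>r. 2 * \<delta> * sqrt r)" by (intro continuous_intros)
      fix t assume t: "\<rho> < t" "t < r"
      show "(\<psi> has_vector_derivative \<psi>' t) (at t)" using der t by simp
      show "((\<lambda>r. 2 * \<delta> * sqrt r) has_vector_derivative \<delta> / sqrt t) (at t)"
        unfolding has_real_derivative_iff_has_vector_derivative[symmetric]
        using t \<rho> by (auto intro!: derivative_eq_intros simp: field_simps)
      have nt: "norm (t *\<^sub>R \<theta>) = t" using t \<rho> n\<theta> by simp
      have "?s (t *\<^sub>R \<theta>) / sqrt t < \<delta>" using \<rho>0[of "t *\<^sub>R \<theta>"] nt t \<rho> by simp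
      moreover have "?s (t *\<^sub>R \<theta>) = t * norm (\<psi>' t)"
      proof -
        have "(t *\<^sub>R \<theta>)$1 *\<^sub>R u1 (t *\<^sub>R \<theta>) + (t *\<^sub>R \<theta>)$2 *\<^sub>R u2 (t *\<^sub>R \<theta>) - \<i> * of_real (k * norm (t *\<^sub>R \<theta>)) * u (t *\<^sub>R \<theta>)
          = of_real t * (\<theta>$1 *\<^sub>R u1 (t *\<^sub>R \<theta>) + \<theta>$2 *\<^sub>R u2 (t *\<^sub>R \<theta>) - \<i> * of_real k * u (t *\<^sub>R \<theta>))"
          unfolding nt by (simp add: scaleR_conv_of_real[where 'a=complex] algebra_simps)
        then have "?s (t *\<^sub>R \<theta>) = t * cmod (\<theta>$1 *\<^sub>R u1 (t *\<^sub>R \<theta>) + \<theta>$2 *\<^sub>R u2 (t *\<^sub>R \<theta>) - \<i> * of_real k * u (t *\<^sub>R \<theta>))"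
          using t \<rho> by (simp only: norm_mult norm_of_real abs_of_pos)
        then show ?thesis unfolding \<psi>'_def by (simp add: norm_mult norm_exp_eq_Re)
      qed
      ultimately have "t * norm (\<psi>' t) \<le> \<delta> * sqrt t" using t \<rho> by (simp add: field_simps)
      then have "norm (\<psi>' t) \<le> \<delta> * sqrt t / t" using t \<rho> by (simp add: field_simps)
      also have "\<dots> = \<delta> / sqrt t" 
      proof -
        have "sqrt t * sqrt t = t" "t > 0" using t \<rho> by simp_all
        then show ?thesis by (simp add: divide_simps)
      qed
      finally show "norm (\<psi>' t) \<le> \<delta> / sqrt t" .
    qed
    then have "norm (\<psi> r) \<le> norm (\<psi> \<rho>) + 2 * \<delta> * sqrt r"
      using norm_triangle_ineq2[of "\<psi> r" "\<psi> \<rho>"] \<delta> \<rho> by (smt (verit) mult_nonneg_nonneg real_sqrt_ge_zero)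
    moreover have "norm (\<psi> t) = cmod (u (t *\<^sub>R \<theta>))" for t
      unfolding \<psi>_def by (simp add: norm_mult norm_exp_eq_Re)
    moreover have "cmod (u (\<rho> *\<^sub>R \<theta>)) \<le> C" using C(2) n\<theta> \<rho> by simp
    moreover have "r *\<^sub>R \<theta> = x" using r by (simp add: \<theta>_def)
    ultimately show ?thesis by (simp add: r_def)
  qed
  define \<rho>1 where "\<rho>1 = max (\<rho> + 1) ((C / \<delta>)\<^sup>2)"
  show "\<forall>\<^sub>F x in at_infinity. dist (cmod (u x) / sqrt (norm x)) 0 < e"
    unfolding eventually_at_infinity
  proof (intro exI[of _ \<rho>1] allI impI)
    fix x :: R2 assume x: "norm x \<ge> \<rho>1"
    then have nx: "norm x > \<rho>" "norm x > 0" "norm x \<ge> (C / \<delta>)\<^sup>2" using \<rho> by (auto simp: \<rho>1_def)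
    have "C / \<delta> \<le> sqrt (norm x)" using nx(3) by (rule real_le_rsqrt)
    then have "C \<le> \<delta> * sqrt (norm x)" using \<delta> by (simp add: field_simps)
    with main[OF nx(1)] have "cmod (u x) \<le> 3 * \<delta> * sqrt (norm x)" by linarith
    also have "\<dots> < e * sqrt (norm x)" using nx(2) e by (simp add: \<delta>_def)
    finally show "dist (cmod (u x) / sqrt (norm x)) 0 < e" using nx(2) by (simp add: field_simps)
  qed
qed

section \<open>Convolution of locally integrable functions with compactly supported kernels\<close>

definition loc_integrable :: "(R2 \<Rightarrow> complex) \<Rightarrow> bool" where
  "loc_integrable w \<longleftrightarrow> w \<in> borel_measurable borel \<and> (\<forall>r. integrable lborel (\<lambda>x. indicator (cball 0 r) x *\<^sub>R w x))"

text \<open>Radius 2 serves all mollifiers with parameter at most 1, together with their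
  derivatives.\<close>

definition C1_kernel :: "(R2 \<Rightarrow> real) \<Rightarrow> (R2 \<Rightarrow> real) \<Rightarrow> (R2 \<Rightarrow> real) \<Rightarrow> bool" where
  "C1_kernel \<sigma> \<sigma>1 \<sigma>2 \<longleftrightarrow> (\<forall>x. grad_at \<sigma> \<sigma>1 \<sigma>2 x) \<and> continuous_on UNIV \<sigma>1 \<and> continuous_on UNIV \<sigma>2 \<and>
     (\<forall>x. norm x > 2 \<longrightarrow> \<sigma> x = 0 \<and> \<sigma>1 x = 0 \<and> \<sigma>2 x = 0)"

definition convol :: "(R2 \<Rightarrow> complex) \<Rightarrow> (R2 \<Rightarrow> real) \<Rightarrow> R2 \<Rightarrow> complex" where
  "convol w \<sigma> x = (LBINT y. w y * of_real (\<sigma> (x - y)))"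

lemma C1_kernel_continuous: "C1_kernel \<sigma> \<sigma>1 \<sigma>2 \<Longrightarrow> continuous_on UNIV \<sigma>"
  by (auto simp: C1_kernel_def grad_at_def intro!: continuous_at_imp_continuous_on has_derivative_continuous)

text \<open>Turns uniform estimates for a kernel into estimates for the convolution. It is applied
  to kernels, to their increments and to their Taylor remainders, so that only local integrability
  of \<open>w\<close> enters.\<close>

lemma convol_bound_aux:
  fixes \<tau> :: "R2 \<Rightarrow> real"
  assumes w: "loc_integrable w" and \<tau>: "continuous_on UNIV \<tau>" and b: "\<And>y. \<bar>\<tau> y\<bar> \<le> e * indicator (cball 0 r) y"
  shows "integrable lborel (\<lambda>y. w y * of_real (\<tau> y))"
    "cmod (LBINT y. w y * of_real (\<tau> y)) \<le> e * (LBINT y. indicator (cball 0 r) y * cmod (w y))"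
proof -
  have [measurable]: "w \<in> borel_measurable borel" "\<tau> \<in> borel_measurable borel"
    using w \<tau> by (auto simp: loc_integrable_def intro: borel_measurable_continuous_onI)
  have "integrable lborel (\<lambda>x. norm (indicator (cball 0 r) x *\<^sub>R w x))"
    using w by (intro integrable_norm) (auto simp: loc_integrable_def)
  then have i1: "integrable lborel (\<lambda>x. e * (indicator (cball 0 r) x * cmod (w x)))" by simp
  have b': "cmod (w y * of_real (\<tau> y)) \<le> e * (indicator (cball 0 r) y * cmod (w y))" for y
    using mult_right_mono[OF b[of y], of "cmod (w y)"] by (simp add: norm_mult mult_ac)
  show i: "integrable lborel (\<lambda>y. w y * of_real (\<tau> y))"
    by (rule Bochner_Integration.integrable_bound[OF i1]) (auto intro!: AE_I2 order_trans[OF b'])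
  have "cmod (LBINT y. w y * of_real (\<tau> y)) \<le> (LBINT y. cmod (w y * of_real (\<tau> y)))"
    by (rule integral_norm_bound)
  also have "\<dots> \<le> (LBINT y. e * (indicator (cball 0 r) y * cmod (w y)))"
    by (rule Bochner_Integration.integral_mono[OF integrable_norm[OF i] i1 b'])
  finally show "cmod (LBINT y. w y * of_real (\<tau> y)) \<le> e * (LBINT y. indicator (cball 0 r) y * cmod (w y))" by simp
qed

lemma convol_integrable:
  assumes w: "loc_integrable w" and \<sigma>: "continuous_on UNIV \<sigma>" "\<And>x. norm x > 2 \<Longrightarrow> \<sigma> x = 0"
  shows "integrable lborel (\<lambda>y. w y * of_real (\<sigma> (x - y)))"
proof -
  obtain B where B: "B > 0" "\<And>x. norm (\<sigma> x) \<le> B" using bounded_compact_support[OF \<sigma>] by blast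
  show ?thesis
  proof (rule convol_bound_aux(1)[OF w, where e=B and r="norm x + 2"])
    show "continuous_on UNIV (\<lambda>y. \<sigma> (x - y))"
      by (intro continuous_on_compose2[OF \<sigma>(1)] continuous_intros) auto
    fix y
    show "\<bar>\<sigma> (x - y)\<bar> \<le> B * indicator (cball 0 (norm x + 2)) y"
    proof (cases "norm (x - y) > 2")
      case False
      then have "norm y \<le> norm x + 2" using norm_triangle_ineq2[of y x] by (simp add: norm_minus_commute)
      then show ?thesis using B by simp
    qed (use \<sigma>(2) B in auto)
  qed
qed

text \<open>If either point lies in the disc of radius 2, an increment of length at most 1 keeps
  both in the compact disc of radius 3; otherwise both values are zero.\<close>

lemma uniform_continuous_compact_support:
  fixes \<sigma> :: "R2 \<Rightarrow> real"
  assumes \<sigma>: "continuous_on UNIV \<sigma>" "\<And>x. norm x > 2 \<Longrightarrow> \<sigma> x = 0" and e: "e > 0"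
  obtains d where "d > 0" "d \<le> 1" "\<And>z h. norm h < d \<Longrightarrow> \<bar>\<sigma> (z + h) - \<sigma> z\<bar> < e"
proof -
  have "uniformly_continuous_on (cball 0 3) \<sigma>"
    by (rule compact_uniformly_continuous[OF continuous_on_subset[OF \<sigma>(1)]]) auto
  then obtain d where d: "d > 0" "\<And>x x'. x \<in> cball 0 3 \<Longrightarrow> x' \<in> cball 0 3 \<Longrightarrow> dist x' x < d \<Longrightarrow> dist (\<sigma> x') (\<sigma> x) < e"
    using e unfolding uniformly_continuous_on_def by metis
  show ?thesis
  proof (rule that[of "min d 1"])
    fix z h :: R2 assume h: "norm h < min d 1"
    show "\<bar>\<sigma> (z + h) - \<sigma> z\<bar> < e"
    proof (cases "norm z \<le> 2 \<or> norm (z + h) \<le> 2")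
      case True
      have "norm z \<le> 3" "norm (z + h) \<le> 3"
        using True h norm_triangle_ineq[of z h] norm_diff_ineq[of z h] by auto
      moreover have "dist (z + h) z < d" using h by (simp add: dist_norm)
      ultimately show ?thesis using d(2)[of z "z + h"] by (simp add: dist_real_def)
    qed (use \<sigma>(2) e in auto)
  qed (use d in auto)
qed

lemma continuous_on_convol:
  assumes w: "loc_integrable w" and \<sigma>: "continuous_on UNIV \<sigma>" "\<And>x. norm x > 2 \<Longrightarrow> \<sigma> x = 0"
  shows "continuous_on UNIV (convol w \<sigma>)"
proof (rule continuous_at_imp_continuous_on, rule ballI)
  fix x :: R2
  define I where "I = (LBINT y. indicator (cball 0 (norm x + 3)) y * cmod (w y))"
  have I: "I \<ge> 0" unfolding I_def by (rule Bochner_Integration.integral_nonneg) simp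
  show "isCont (convol w \<sigma>) x"
    unfolding continuous_at_eps_delta
  proof (intro allI impI)
    fix e :: real assume e: "e > 0"
    \<comment> \<open>\<open>I\<close> is the mass of \<open>w\<close> on a ball that contains the
      kernel supports for all points within distance 1 of \<open>x\<close>. Adding 1 keeps the
      denominator positive when this mass is zero.\<close>
    define e' where "e' = e / (I + 1)"
    have e': "e' > 0" using e I by (simp add: e'_def)
    obtain d where d: "d > 0" "d \<le> 1" "\<And>z h. norm h < d \<Longrightarrow> \<bar>\<sigma> (z + h) - \<sigma> z\<bar> < e'"
      using uniform_continuous_compact_support[OF \<sigma> e'] by blast
    show "\<exists>d>0. \<forall>x'. dist x' x < d \<longrightarrow> dist (convol w \<sigma> x') (convol w \<sigma> x) < e"
    proof (intro exI[of _ d] conjI allI impI d(1))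
      fix x' assume x': "dist x' x < d"
      have "convol w \<sigma> x' - convol w \<sigma> x = (LBINT y. w y * of_real (\<sigma> (x' - y) - \<sigma> (x - y)))"
        unfolding convol_def by (subst Bochner_Integration.integral_diff[symmetric])
          (auto simp: algebra_simps intro!: convol_integrable[OF w \<sigma>])
      also have "cmod \<dots> \<le> e' * I"
        unfolding I_def
      proof (rule convol_bound_aux(2)[OF w])
        show "continuous_on UNIV (\<lambda>y. \<sigma> (x' - y) - \<sigma> (x - y))"
          by (intro continuous_intros continuous_on_compose2[OF \<sigma>(1)]) auto
        fix y
        have xx: "norm (x' - x) < d" using x' by (simp add: dist_norm)
        show "\<bar>\<sigma> (x' - y) - \<sigma> (x - y)\<bar> \<le> e' * indicator (cball 0 (norm x + 3)) y"
        proof (cases "norm y \<le> norm x + 3")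
          case True
          then show ?thesis using d(3)[OF xx, of "x - y"] by simp
        next
          case False
          then have "norm (x - y) > 2" "norm (x' - y) > 2"
            using norm_triangle_ineq2[of y x] norm_triangle_ineq2[of "y - x" "x' - x"] xx d(2)
            by (auto simp: norm_minus_commute)
          then show ?thesis using \<sigma>(2) e' by simp
        qed
      qed
      also have "\<dots> < e" using e I by (simp add: e'_def field_simps)
      finally show "dist (convol w \<sigma> x') (convol w \<sigma> x) < e" by (simp add: dist_norm)
    qed
  qed
qed

text \<open>Differentiation under the integral sign requires a remainder that is small uniformly in
  the base point. The mean value inequality is applied to the kernel minus its linearisation at
  \<open>z\<close>, whose derivative is an increment of the uniformly continuous gradient.\<close>

lemma C1_kernel_uniform:
  assumes \<sigma>: "C1_kernel \<sigma> \<sigma>1 \<sigma>2" and e: "e > 0"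
  obtains d where "d > 0" "d \<le> 1"
    "\<And>z h. norm h < d \<Longrightarrow> \<bar>\<sigma> (z + h) - \<sigma> z - (h$1 * \<sigma>1 z + h$2 * \<sigma>2 z)\<bar> \<le> e * norm h"
proof -
  note C = \<sigma>[unfolded C1_kernel_def]
  have e2: "e / 2 > 0" using e by simp
  obtain d1 where d1: "d1 > 0" "d1 \<le> 1" "\<And>z h. norm h < d1 \<Longrightarrow> \<bar>\<sigma>1 (z + h) - \<sigma>1 z\<bar> < e / 2"
    using uniform_continuous_compact_support[of \<sigma>1, OF _ _ e2] C by blast
  obtain d2 where d2: "d2 > 0" "d2 \<le> 1" "\<And>z h. norm h < d2 \<Longrightarrow> \<bar>\<sigma>2 (z + h) - \<sigma>2 z\<bar> < e / 2"
    using uniform_continuous_compact_support[of \<sigma>2, OF _ _ e2] C by blast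
  define d where "d = min d1 d2"
  show ?thesis
  proof (rule that[of d])
    fix z h :: R2 assume h: "norm h < d"
    let ?f = "\<lambda>y. \<sigma> y - (y$1 * \<sigma>1 z + y$2 * \<sigma>2 z)"
    have "norm (?f (z + h) - ?f z) \<le> e * norm ((z + h) - z)"
    proof (rule differentiable_bound[of "ball z d"])
      fix y assume y: "y \<in> ball z d"
      have "(\<sigma> has_derivative (\<lambda>h. h$1 * \<sigma>1 y + h$2 * \<sigma>2 y)) (at y within ball z d)"
        using C[THEN conjunct1, rule_format, of y] by (simp add: grad_at_def has_derivative_at_withinI)
      then show "(?f has_derivative (\<lambda>h. h$1 * (\<sigma>1 y - \<sigma>1 z) + h$2 * (\<sigma>2 y - \<sigma>2 z))) (at y within ball z d)"
        by (auto intro!: derivative_eq_intros bounded_linear_imp_has_derivative[OF bounded_linear_vec_nth] simp: algebra_simps)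
      have "\<bar>\<sigma>1 y - \<sigma>1 z\<bar> < e / 2" "\<bar>\<sigma>2 y - \<sigma>2 z\<bar> < e / 2"
        using d1(3)[of "y - z" z] d2(3)[of "y - z" z] y by (auto simp: d_def dist_norm norm_minus_commute)
      then have *: "\<bar>h$1 * (\<sigma>1 y - \<sigma>1 z)\<bar> \<le> norm h * (e / 2)" "\<bar>h$2 * (\<sigma>2 y - \<sigma>2 z)\<bar> \<le> norm h * (e / 2)" for h :: R2
        unfolding abs_mult using component_le_norm_cart[of h 1] component_le_norm_cart[of h 2]
        by (auto intro!: mult_mono simp del: times_divide_eq_right)
      show "onorm (\<lambda>h::R2. h$1 * (\<sigma>1 y - \<sigma>1 z) + h$2 * (\<sigma>2 y - \<sigma>2 z)) \<le> e"
      proof (rule onorm_le)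
        fix h :: R2
        show "norm (h$1 * (\<sigma>1 y - \<sigma>1 z) + h$2 * (\<sigma>2 y - \<sigma>2 z)) \<le> e * norm h"
          using add_mono[OF *[of h]] abs_triangle_ineq[of "h$1 * (\<sigma>1 y - \<sigma>1 z)" "h$2 * (\<sigma>2 y - \<sigma>2 z)"]
          unfolding real_norm_def by argo
      qed
    qed (use h d1 d2 in \<open>auto simp: d_def dist_norm\<close>)
    then show "\<bar>\<sigma> (z + h) - \<sigma> z - (h$1 * \<sigma>1 z + h$2 * \<sigma>2 z)\<bar> \<le> e * norm h"
      by (simp add: algebra_simps)
  qed (use d1 d2 in \<open>auto simp: d_def\<close>)
qed

lemma grad_at_convol:
  assumes w: "loc_integrable w" and \<sigma>: "C1_kernel \<sigma> \<sigma>1 \<sigma>2"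
  shows "grad_at (convol w \<sigma>) (convol w \<sigma>1) (convol w \<sigma>2) x"
proof -
  have c: "continuous_on UNIV \<sigma>" "continuous_on UNIV \<sigma>1" "continuous_on UNIV \<sigma>2"
    and s: "\<And>x. norm x > 2 \<Longrightarrow> \<sigma> x = 0" "\<And>x. norm x > 2 \<Longrightarrow> \<sigma>1 x = 0" "\<And>x. norm x > 2 \<Longrightarrow> \<sigma>2 x = 0"
    using \<sigma> C1_kernel_continuous[OF \<sigma>] by (auto simp: C1_kernel_def)
  define I where "I = (LBINT y. indicator (cball 0 (norm x + 3)) y * cmod (w y))"
  have I: "I \<ge> 0" unfolding I_def by (rule Bochner_Integration.integral_nonneg) simp
  show ?thesis
    unfolding grad_at_def has_derivative_at_alt
  proof (intro conjI allI impI)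
    show "bounded_linear (\<lambda>h. h $ 1 *\<^sub>R convol w \<sigma>1 x + h $ 2 *\<^sub>R convol w \<sigma>2 x)"
      by (intro bounded_linear_add bounded_linear_compose[OF bounded_linear_scaleR_left bounded_linear_vec_nth])
    fix e :: real assume e: "e > 0"
    define e' where "e' = e / (I + 1)"
    have e': "e' > 0" using e I by (simp add: e'_def)
    obtain d where d: "d > 0" "d \<le> 1"
      "\<And>z h. norm h < d \<Longrightarrow> \<bar>\<sigma> (z + h) - \<sigma> z - (h$1 * \<sigma>1 z + h$2 * \<sigma>2 z)\<bar> \<le> e' * norm h"
      using C1_kernel_uniform[OF \<sigma> e'] by blast
    show "\<exists>d>0. \<forall>y. norm (y - x) < d \<longrightarrow> norm (convol w \<sigma> y - convol w \<sigma> x - ((y - x)$1 *\<^sub>R convol w \<sigma>1 x + (y - x)$2 *\<^sub>R convol w \<sigma>2 x)) \<le> e * norm (y - x)"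
    proof (intro exI[of _ d] conjI allI impI d(1))
      fix x' assume x': "norm (x' - x) < d"
      define h where "h = x' - x"
      have h: "norm h < d" "x' = x + h" using x' by (auto simp: h_def)
      let ?\<tau> = "\<lambda>y. \<sigma> (x' - y) - \<sigma> (x - y) - (h$1 * \<sigma>1 (x - y) + h$2 * \<sigma>2 (x - y))"
      have "convol w \<sigma> x' - convol w \<sigma> x - (h$1 *\<^sub>R convol w \<sigma>1 x + h$2 *\<^sub>R convol w \<sigma>2 x) = (LBINT y. w y * of_real (?\<tau> y))"
      proof -
        note i = convol_integrable[OF w c(1) s(1)] convol_integrable[OF w c(2) s(2)] convol_integrable[OF w c(3) s(3)]
        have "(\<lambda>y. w y * of_real (?\<tau> y)) = (\<lambda>y. w y * of_real (\<sigma> (x' - y)) - w y * of_real (\<sigma> (x - y))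
            - (of_real (h$1) * (w y * of_real (\<sigma>1 (x - y))) + of_real (h$2) * (w y * of_real (\<sigma>2 (x - y)))))"
          by (simp add: algebra_simps)
        then show ?thesis
          by (simp add: convol_def i scaleR_conv_of_real)
      qed
      also have "cmod \<dots> \<le> (e' * norm h) * I"
        unfolding I_def
      proof (rule convol_bound_aux(2)[OF w])
        show "continuous_on UNIV ?\<tau>"
          by (intro continuous_intros continuous_on_compose2[OF c(1)] continuous_on_compose2[OF c(2)] continuous_on_compose2[OF c(3)]) auto
        fix y
        show "\<bar>?\<tau> y\<bar> \<le> e' * norm h * indicator (cball 0 (norm x + 3)) y"
        proof (cases "norm y \<le> norm x + 3")
          case True
          have "x' - y = (x - y) + h" by (simp add: h)
          show ?thesis using True d(3)[OF h(1), of "x - y"] unfolding \<open>x' - y = (x - y) + h\<close> by simp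
        next
          case False
          then have "norm (x - y) > 2" "norm (x' - y) > 2"
            using norm_triangle_ineq2[of y x] norm_triangle_ineq2[of "y - x" "x' - x"] x' d(2)
            by (auto simp: norm_minus_commute)
          then show ?thesis using s e' by simp
        qed
      qed
      also have "\<dots> \<le> e * norm h"
      proof -
        have "e' * I \<le> e" using e I by (simp add: e'_def field_simps)
        then have "norm h * (e' * I) \<le> norm h * e" by (rule mult_left_mono) simp
        then show ?thesis by (simp add: mult_ac)
      qed
      finally show "norm (convol w \<sigma> x' - convol w \<sigma> x - ((x' - x)$1 *\<^sub>R convol w \<sigma>1 x + (x' - x)$2 *\<^sub>R convol w \<sigma>2 x)) \<le> e * norm (x' - x)"
        by (simp only: h_def)
    qed
  qed
qed

lemma norm_line_derivative:
  assumes "(y::R2) \<noteq> 0"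
  shows "((\<lambda>t. norm (y + t *\<^sub>R axis i 1)) has_real_derivative y $ i / norm y) (at 0)"
proof -
  have "(norm y)\<^sup>2 > 0" using assms by simp
  then have "((\<lambda>t. sqrt ((norm (y + t *\<^sub>R axis i 1))\<^sup>2)) has_real_derivative
      inverse (sqrt ((norm (y + 0 *\<^sub>R axis i 1))\<^sup>2)) / 2 * (2 * y $ i)) (at 0)"
    by (intro DERIV_chain2[OF DERIV_real_sqrt pdD[OF pd_norm2]]) simp
  then show ?thesis by (simp add: divide_simps)
qed

lemma axis_line_nth: "(y + t *\<^sub>R axis i 1 :: R2) $ i = y $ i + t"
  by (simp add: axis_def)

text \<open>The exterior solution and the factor 1 / |y| are controlled only for large |y|. For
  \<open>x\<close> far out the kernel vanishes at the other points, and the two open regions cover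
  the plane.\<close>

lemma continuous_on_piecewise_zero:
  fixes f :: "R2 \<Rightarrow> 'b::real_normed_vector"
  assumes f: "continuous_on {y. norm y > R} f" and z: "\<And>y. norm (x - y) > 2 \<Longrightarrow> f y = 0" and x: "norm x > R + 2"
  shows "continuous_on UNIV f"
proof -
  have "{y. norm y > R} \<union> {y. norm (x - y) > 2} = UNIV"
  proof (intro equalityI subsetI UNIV_I)
    fix y
    show "y \<in> {y. norm y > R} \<union> {y. norm (x - y) > 2}"
      using norm_triangle_ineq2[of x y] norm_triangle_ineq2[of x "x - y"] x by auto
  qed
  moreover have "continuous_on {y. norm (x - y) > 2} f"
    by (rule continuous_on_cong[THEN iffD1, OF refl _ continuous_on_const[of _ 0]]) (use z in auto)
  moreover have "open {y::R2. norm y > R}" "open {y. norm (x - y) > 2}"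
    by (intro open_Collect_less continuous_intros)+
  ultimately show ?thesis using f continuous_on_open_Un by metis
qed

text \<open>The gain of 1 / |x| compensates for the growth of the solution, which is only known to
  be o(sqrt |x|).\<close>

lemma direction_diff:
  assumes "norm (x - y :: R2) \<le> 2" "norm x > 0" "norm y > 0"
  shows "\<bar>x $ i / norm x - y $ i / norm y\<bar> \<le> 4 / norm x"
proof -
  have "x $ i / norm x - y $ i / norm y = (x - y) $ i / norm x + y $ i / norm y * ((norm y - norm x) / norm x)"
    using assms by (simp add: field_simps)
  moreover have "\<bar>(x - y) $ i / norm x\<bar> \<le> 2 / norm x"
    using component_le_norm_cart[of "x - y" i] assms by (auto simp: divide_right_mono)
  moreover have "\<bar>y $ i / norm y * ((norm y - norm x) / norm x)\<bar> \<le> 2 / norm x"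
  proof -
    have "\<bar>y $ i / norm y\<bar> \<le> 1" using component_le_norm_cart[of y i] assms by simp
    moreover have "\<bar>(norm y - norm x) / norm x\<bar> \<le> 2 / norm x"
      using norm_triangle_ineq3[of y x] assms by (auto simp: norm_minus_commute divide_right_mono)
    ultimately have "\<bar>y $ i / norm y\<bar> * \<bar>(norm y - norm x) / norm x\<bar> \<le> 1 * (2 / norm x)"
      by (intro mult_mono) auto
    then show ?thesis by (simp add: abs_mult)
  qed
  ultimately show ?thesis by linarith
qed

text \<open>The mollified Laplacian of \<open>w\<close> is the convolution of \<open>w\<close> with the Laplacian of the mollifier, so the
  Sommerfeld condition passes from \<open>w\<close> to it as well.\<close>
lemma sommerfeld_convol:
  fixes v g1 g2 :: "R2 \<Rightarrow> complex"
  assumes w: "loc_integrable w" and ae: "AE x in lborel. norm x > R \<longrightarrow> w x = v x" and R: "R > 0" and k: "k > 0"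
    and v: "\<And>x. norm x > R \<Longrightarrow> grad_at v g1 g2 x"
    and g: "continuous_on {x. norm x > R} g1" "continuous_on {x. norm x > R} g2"
    and sommerfeld: "sommerfeld k v g1 g2" and \<sigma>: "C1_kernel \<sigma> \<sigma>1 \<sigma>2"
  shows "sommerfeld k (convol w \<sigma>) (convol w \<sigma>1) (convol w \<sigma>2)"
proof -
  have c: "continuous_on UNIV \<sigma>" "continuous_on UNIV \<sigma>1" "continuous_on UNIV \<sigma>2"
    and s: "\<And>x. norm x > 2 \<Longrightarrow> \<sigma> x = 0" "\<And>x. norm x > 2 \<Longrightarrow> \<sigma>1 x = 0" "\<And>x. norm x > 2 \<Longrightarrow> \<sigma>2 x = 0"
    using \<sigma> C1_kernel_continuous[OF \<sigma>] by (auto simp: C1_kernel_def)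
  obtain B0 where B0: "B0 > 0" "\<And>x. norm (\<sigma> x) \<le> B0" using bounded_compact_support[OF c(1) s(1)] by blast
  obtain B1 where B1: "B1 > 0" "\<And>x. norm (\<sigma>1 x) \<le> B1" using bounded_compact_support[OF c(2) s(2)] by blast
  obtain B2 where B2: "B2 > 0" "\<And>x. norm (\<sigma>2 x) \<le> B2" using bounded_compact_support[OF c(3) s(3)] by blast
  have convol: "continuous_on {x. norm x > R} v"
    by (intro continuous_at_imp_continuous_on ballI) (use v in \<open>auto simp: grad_at_def intro: has_derivative_continuous\<close>)
  define sv where "sv y = (y$1 / norm y) *\<^sub>R g1 y + (y$2 / norm y) *\<^sub>R g2 y - \<i> * of_real k * v y" for y
  \<comment> \<open>In the radial derivative of the kernel, \<open>x / |x|\<close> is split into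
    \<open>y / |y|\<close> and the difference. The part along \<open>y / |y|\<close> is integrated
    by parts: the derivative falling on \<open>v\<close> joins \<open>- \<i> k v\<close> to form
    \<open>sv\<close>, and the term with 1 / |y| comes from the divergence of \<open>y / |y|\<close>
    in the plane.\<close>
  define \<Phi> where "\<Phi> x y = sv y * of_real (\<sigma> (x - y)) + v y * of_real (\<sigma>1 (x - y) * (x$1 / norm x - y$1 / norm y)
          + \<sigma>2 (x - y) * (x$2 / norm x - y$2 / norm y) + \<sigma> (x - y) / norm y)" for x y
  define area where "area = measure lborel (cball (0::R2) 2)"
  have identity: "x$1 *\<^sub>R convol w \<sigma>1 x + x$2 *\<^sub>R convol w \<sigma>2 x - \<i> * of_real (k * norm x) * convol w \<sigma> x
      = of_real (norm x) * (LBINT y. \<Phi> x y)"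
    and int: "integrable lborel (\<Phi> x)"
    if x: "norm x > R + 3" for x
  proof -
    have x0: "norm x > 0" "norm x > R + 2" using x R by auto
    let ?m = "\<lambda>i y. \<sigma> (x - y) * (y $ i / norm y)"
    let ?m' = "\<lambda>i \<tau> y. - \<tau> (x - y) * (y $ i / norm y) + \<sigma> (x - y) * (1 / norm y - (y $ i)\<^sup>2 / (norm y)^3)"
    let ?G = "\<lambda>i y. ?m i y *\<^sub>R v y"
    let ?G' = "\<lambda>i g \<tau> y. ?m i y *\<^sub>R g y + ?m' i \<tau> y *\<^sub>R v y"
    have far: "norm y > R" if "\<not> norm (x - y) > 2" for y
      using norm_triangle_ineq2[of x y] norm_triangle_ineq2[of x "x - y"] x that by auto
    have ynz: "y \<noteq> 0" "norm y > 0" if "norm y > R" for y :: R2 using that R by auto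
    have comp: "continuous_on A (\<lambda>y. \<tau> (x - y))" if "continuous_on UNIV \<tau>" for \<tau> :: "R2 \<Rightarrow> real" and A
      by (rule continuous_on_compose2[OF that]) (auto intro!: continuous_intros)
    have cont: "continuous_on UNIV f" if "continuous_on {y. norm y > R} f" "\<And>y. norm (x - y) > 2 \<Longrightarrow> f y = 0" for f :: "R2 \<Rightarrow> complex"
      by (rule continuous_on_piecewise_zero[OF that x0(2)])
    have zero: "(LBINT y. ?G' i g \<tau> y) = 0" "integrable lborel (?G' i g \<tau>)"
      if i: "(i = 1 \<and> g = g1 \<and> \<tau> = \<sigma>1) \<or> (i = 2 \<and> g = g2 \<and> \<tau> = \<sigma>2)" for i g \<tau>
    proof -
      have cG: "continuous_on UNIV (?G i)"
        by (rule cont) (use R ynz s in \<open>auto intro!: continuous_intros comp c convol\<close>)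
      have cG': "continuous_on UNIV (?G' i g \<tau>)"
        by (rule cont) (use R ynz s g i in \<open>auto intro!: continuous_intros comp c convol\<close>)
      have supp: "norm (x - y) > 2" if "norm y > norm x + 2" for y
        using norm_triangle_ineq2[of y x] that by (simp add: norm_minus_commute)
      have d: "((\<lambda>t. ?G i (y + t *\<^sub>R axis i 1)) has_vector_derivative ?G' i g \<tau> y) (at 0)" for y
      proof (cases "norm (x - y) > 2")
        case True
        have "open {t. norm (x - (y + t *\<^sub>R axis i 1)) > 2}" (is "open ?T")
          by (intro open_Collect_less continuous_intros)
        moreover have "0 \<in> ?T" using True by simp
        moreover have "?G i (y + t *\<^sub>R axis i 1) = 0" if "t \<in> ?T" for t using that s by simp
        ultimately have "((\<lambda>t. ?G i (y + t *\<^sub>R axis i 1)) has_vector_derivative 0) (at 0)"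
          by (intro has_vector_derivative_transform_within_open[OF has_vector_derivative_const[of 0], of ?T 0]) auto
        then show ?thesis using True s i by auto
      next
        case False
        have ny: "norm y > R" "y \<noteq> 0" "norm y \<noteq> 0" using far[OF False] ynz by auto
        have dv: "((\<lambda>t. v (y + t *\<^sub>R axis i 1)) has_vector_derivative g y) (at 0)"
          using grad_at_line[OF v[OF ny(1)]] i by auto
        have d\<sigma>: "((\<lambda>t. \<sigma> (x - (y + t *\<^sub>R axis i 1))) has_real_derivative - \<tau> (x - y)) (at 0)"
        proof -
          have "grad_at \<sigma> \<sigma>1 \<sigma>2 (x - y)" using \<sigma> by (simp add: C1_kernel_def)
          then have "((\<lambda>t. \<sigma> ((x - y) + t *\<^sub>R axis i 1)) has_real_derivative \<tau> (x - y)) (at (- 0))"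
            using grad_at_line[of \<sigma> \<sigma>1 \<sigma>2 "x - y"] i by (auto simp: has_real_derivative_iff_has_vector_derivative)
          from DERIV_mirror[THEN iffD1, OF this] show ?thesis by (simp add: algebra_simps)
        qed
        have dn: "((\<lambda>t. (y + t *\<^sub>R axis i 1) $ i / norm (y + t *\<^sub>R axis i 1)) has_real_derivative
            (1 / norm y - (y $ i)\<^sup>2 / (norm y)^3)) (at 0)"
          unfolding axis_line_nth
          by (rule DERIV_cong[OF DERIV_divide[OF DERIV_add[OF DERIV_const DERIV_ident] norm_line_derivative[OF ny(2)]]])
             (use ny in \<open>auto simp: field_simps power2_eq_square power3_eq_cube\<close>)
        have dm: "((\<lambda>t. ?m i (y + t *\<^sub>R axis i 1)) has_real_derivative ?m' i \<tau> y) (at 0)"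
          by (rule DERIV_cong[OF DERIV_mult[OF d\<sigma> dn]]) simp
        show ?thesis using has_vector_derivative_scaleR[OF dm dv] by simp
      qed
      have z: "?G i y = 0" "?G' i g \<tau> y = 0" if "norm y > norm x + 2" for y
        using supp[OF that] s i by auto
      show "(LBINT y. ?G' i g \<tau> y) = 0"
        by (rule integral_vector_pd_eq_0[OF d cG cG' z])
      show "integrable lborel (?G' i g \<tau>)"
        by (rule integrable_lborel_compact_support[OF cG' z(2)])
    qed
    have cint: "integrable lborel (\<lambda>y. v y * of_real (\<tau> (x - y)))" if "continuous_on UNIV \<tau>" "\<And>x. norm x > 2 \<Longrightarrow> \<tau> x = 0" for \<tau>
    proof (rule integrable_lborel_compact_support[where M="norm x + 2"])
      show "continuous_on UNIV (\<lambda>y. v y * of_real (\<tau> (x - y)))"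
        by (rule cont) (use that in \<open>auto intro!: continuous_intros comp convol\<close>)
      fix y :: R2 assume "norm y > norm x + 2"
      then have "norm (x - y) > 2" using norm_triangle_ineq2[of y x] by (simp add: norm_minus_commute)
      then show "v y * of_real (\<tau> (x - y)) = 0" using that by simp
    qed
    have [measurable]: "w \<in> borel_measurable borel" using w by (simp add: loc_integrable_def)
    have eqcv: "convol w \<tau> x = (LBINT y. v y * of_real (\<tau> (x - y)))" if "continuous_on UNIV \<tau>" "\<And>x. norm x > 2 \<Longrightarrow> \<tau> x = 0" for \<tau>
      unfolding convol_def
    proof (rule integral_cong_AE)
      show "AE y in lborel. w y * of_real (\<tau> (x - y)) = v y * of_real (\<tau> (x - y))"
        using ae by eventually_elim (use that far in auto)
      show "(\<lambda>y. w y * of_real (\<tau> (x - y))) \<in> borel_measurable lborel"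
        using convol_integrable[OF w that] by (rule borel_measurable_integrable)
      show "(\<lambda>y. v y * of_real (\<tau> (x - y))) \<in> borel_measurable lborel"
        using cint[OF that] by (rule borel_measurable_integrable)
    qed
    have z1: "(LBINT y. ?G' 1 g1 \<sigma>1 y) = 0" "integrable lborel (?G' 1 g1 \<sigma>1)" by (rule zero; simp)+
    have z2: "(LBINT y. ?G' 2 g2 \<sigma>2 y) = 0" "integrable lborel (?G' 2 g2 \<sigma>2)" by (rule zero; simp)+
    note ii = cint[OF c(1) s(1)] cint[OF c(2) s(2)] cint[OF c(3) s(3)]
    let ?P = "\<lambda>y. of_real (x$1 / norm x) * (v y * of_real (\<sigma>1 (x - y))) + of_real (x$2 / norm x) * (v y * of_real (\<sigma>2 (x - y)))
      - \<i> * of_real k * (v y * of_real (\<sigma> (x - y)))"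
    \<comment> \<open>\<open>?P\<close> is the integrand of the radial derivative and value of the
      convolution; \<open>\<Phi>\<close> differs from it by two partial derivatives of compactly
      supported functions, which integrate to zero.\<close>
    have \<Phi>: "\<Phi> x y = ?P y + (?G' 1 g1 \<sigma>1 y + ?G' 2 g2 \<sigma>2 y)" for y
    proof (cases "norm (x - y) > 2")
      case True
      then show ?thesis using s by (simp add: \<Phi>_def)
    next
      case False
      have ny: "norm y > 0" using far[OF False] ynz by auto
      have r: "1 / norm y = (1 / norm y - (y $ 1)\<^sup>2 / (norm y)^3) + (1 / norm y - (y $ 2)\<^sup>2 / (norm y)^3)"
      proof -
        have "(y $ 1)\<^sup>2 / (norm y)^3 + (y $ 2)\<^sup>2 / (norm y)^3 = (norm y)\<^sup>2 / (norm y)^3"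
          unfolding norm_R2 by (simp add: add_divide_distrib)
        also have "\<dots> = 1 / norm y" using ny by (simp add: power2_eq_square power3_eq_cube)
        finally show ?thesis by simp
      qed
      have r': "\<sigma> (x - y) / norm y = \<sigma> (x - y) * (1 / norm y - (y $ 1)\<^sup>2 / (norm y)^3) + \<sigma> (x - y) * (1 / norm y - (y $ 2)\<^sup>2 / (norm y)^3)"
        using arg_cong[OF r, of "\<lambda>z. \<sigma> (x - y) * z"]
        unfolding distrib_left[symmetric] by simp
      show ?thesis
        unfolding r' sv_def \<Phi>_def
        by (simp add: scaleR_conv_of_real algebra_simps)
    qed
    have iP: "integrable lborel ?P"
      by (intro Bochner_Integration.integrable_diff Bochner_Integration.integrable_add integrable_mult_right ii)
    have \<Phi>': "\<Phi> x = (\<lambda>y. ?P y + (?G' 1 g1 \<sigma>1 y + ?G' 2 g2 \<sigma>2 y))" using \<Phi> by (rule ext)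
    show "integrable lborel (\<Phi> x)"
      unfolding \<Phi>' by (intro Bochner_Integration.integrable_add iP z1 z2)
    have "(LBINT y. \<Phi> x y) = (LBINT y. ?P y)"
      unfolding \<Phi> by (simp only: Bochner_Integration.integral_add[OF iP Bochner_Integration.integrable_add[OF z1(2) z2(2)]]
         Bochner_Integration.integral_add[OF z1(2) z2(2)] z1(1) z2(1) add_0_right)
    also have "\<dots> = of_real (x$1 / norm x) * convol w \<sigma>1 x + of_real (x$2 / norm x) * convol w \<sigma>2 x - \<i> * of_real k * convol w \<sigma> x"
      using ii by (simp add: eqcv[OF c(1) s(1)] eqcv[OF c(2) s(2)] eqcv[OF c(3) s(3)])
    finally show "x$1 *\<^sub>R convol w \<sigma>1 x + x$2 *\<^sub>R convol w \<sigma>2 x - \<i> * of_real (k * norm x) * convol w \<sigma> x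
      = of_real (norm x) * (LBINT y. \<Phi> x y)"
      using x0 by (simp add: scaleR_conv_of_real field_simps)
  qed
  have growth: "((\<lambda>x. cmod (v x) / sqrt (norm x)) \<longlongrightarrow> 0) at_infinity"
    by (rule sommerfeld_growth[OF v sommerfeld])
  have area: "area \<ge> 0" by (simp add: area_def)
  \<comment> \<open>\<open>C - 1\<close> collects the kernel bounds and the area of a disc of radius
    2 from the pointwise estimate below; the added 1 makes \<open>C\<close> positive and the final
    inequality strict.\<close>
  define C where "C = 2 * (B0 + 4 * B1 + 4 * B2 + 2 * B0) * area + 1"
  have C: "C > 0" using B0(1) B1(1) B2(1) area by (simp add: C_def add_nonneg_pos)
  show ?thesis
    unfolding sommerfeld_def
  proof (rule tendstoI)
    fix e :: real assume e: "e > 0"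
    define \<delta> where "\<delta> = e / C"
    have \<delta>: "\<delta> > 0" using e C by (simp add: \<delta>_def)
    have "\<forall>\<^sub>F x in at_infinity. cmod (v x) / sqrt (norm x) < \<delta>"
      using growth \<delta> by (rule order_tendstoD(2))
    moreover have "\<forall>\<^sub>F x in at_infinity. cmod (x$1 *\<^sub>R g1 x + x$2 *\<^sub>R g2 x - \<i> * of_real (k * norm x) * v x) / sqrt (norm x) < \<delta>"
      using sommerfeld \<delta> unfolding sommerfeld_def by (rule order_tendstoD(2))
    ultimately have "\<forall>\<^sub>F x in at_infinity. cmod (v x) / sqrt (norm x) < \<delta> \<and>
       cmod (x$1 *\<^sub>R g1 x + x$2 *\<^sub>R g2 x - \<i> * of_real (k * norm x) * v x) / sqrt (norm x) < \<delta>"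
      by (rule eventually_conj)
    then obtain \<rho> where \<rho>: "\<And>y. norm y \<ge> \<rho> \<Longrightarrow> cmod (v y) / sqrt (norm y) < \<delta> \<and>
       cmod (y$1 *\<^sub>R g1 y + y$2 *\<^sub>R g2 y - \<i> * of_real (k * norm y) * v y) / sqrt (norm y) < \<delta>"
      by (auto simp: eventually_at_infinity)
    show "\<forall>\<^sub>F x in at_infinity. dist (cmod (x$1 *\<^sub>R convol w \<sigma>1 x + x$2 *\<^sub>R convol w \<sigma>2 x - \<i> * of_real (k * norm x) * convol w \<sigma> x) / sqrt (norm x)) 0 < e"
      unfolding eventually_at_infinity
    proof (intro exI[of _ "max (max (\<rho> + 2) (R + 4)) 4"] allI impI)
      fix x :: R2 assume "norm x \<ge> max (max (\<rho> + 2) (R + 4)) 4"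
      then have x: "norm x \<ge> \<rho> + 2" "norm x > R + 3" "norm x \<ge> 4" "norm x > 0" by auto
      let ?q = "sqrt (norm x)"
      have q: "?q > 0" "?q * ?q = norm x" using x by auto
      \<comment> \<open>On the kernel support \<open>sv\<close> is of size \<delta> / sqrt |x|. The
        function \<open>v\<close> may be as large as \<delta> sqrt |x|, but its factors, the change
        of direction and 1 / |y|, are of order 1 / |x|.\<close>
      have b: "norm (\<Phi> x y) \<le> (2 * \<delta> / ?q * (B0 + 4 * B1 + 4 * B2 + 2 * B0)) * indicator (cball x 2) y" for y
      proof (cases "norm (x - y) > 2")
        case True
        then show ?thesis using s by (simp add: dist_norm \<Phi>_def)
      next
        case False
        then have xy: "norm (x - y) \<le> 2" by simp
        have y: "norm y \<ge> \<rho>" "norm y \<ge> norm x / 2" "norm y \<le> 4 * norm x" "norm y > 0"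
          using norm_triangle_ineq2[of x y] norm_triangle_ineq2[of y x] xy x by (auto simp: norm_minus_commute)
        have p: "sqrt (norm y) > 0" "sqrt (norm y) * sqrt (norm y) = norm y" using y by auto
        have qy: "sqrt (norm y) \<le> 2 * ?q"
        proof -
          have "sqrt (norm y) \<le> sqrt (4 * norm x)" using y(3) by simp
          then show ?thesis by (simp add: real_sqrt_mult)
        qed
        have qx: "?q \<le> 2 * sqrt (norm y)"
        proof -
          have "?q \<le> sqrt (4 * norm y)" using y(2,4) by (intro real_sqrt_le_mono) linarith
          then show ?thesis by (simp add: real_sqrt_mult)
        qed
        have vy: "cmod (v y) \<le> 2 * \<delta> * ?q"
        proof -
          have "cmod (v y) \<le> \<delta> * sqrt (norm y)" using \<rho>[OF y(1)] p by (simp add: field_simps)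
          also have "\<dots> \<le> \<delta> * (2 * ?q)" using \<delta> qy by (intro mult_left_mono) auto
          finally show ?thesis by simp
        qed
        have sy: "cmod (sv y) \<le> 2 * \<delta> / ?q"
        proof -
          have "y$1 *\<^sub>R g1 y + y$2 *\<^sub>R g2 y - \<i> * of_real (k * norm y) * v y = of_real (norm y) * sv y"
            using y(4) by (simp add: sv_def scaleR_conv_of_real algebra_simps)
          then have "cmod (y$1 *\<^sub>R g1 y + y$2 *\<^sub>R g2 y - \<i> * of_real (k * norm y) * v y) = norm y * cmod (sv y)"
            by (simp only: norm_mult norm_of_real abs_norm_cancel)
          then have "norm y * cmod (sv y) < \<delta> * sqrt (norm y)" using \<rho>[OF y(1)] p by (simp add: pos_divide_less_eq)
          then have "sqrt (norm y) * (sqrt (norm y) * cmod (sv y)) < sqrt (norm y) * \<delta>"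
            using p by (simp only: mult.assoc[symmetric] p(2)) (simp add: mult.commute)
          then have "sqrt (norm y) * cmod (sv y) < \<delta>" using p(1) by simp
          moreover have "?q * cmod (sv y) \<le> 2 * sqrt (norm y) * cmod (sv y)" using qx by (intro mult_right_mono) auto
          ultimately have "?q * cmod (sv y) \<le> 2 * \<delta>" by linarith
          then show ?thesis using q by (simp add: pos_le_divide_eq mult.commute)
        qed
        have d: "\<bar>x$1 / norm x - y$1 / norm y\<bar> \<le> 4 / norm x" "\<bar>x$2 / norm x - y$2 / norm y\<bar> \<le> 4 / norm x"
          by (rule direction_diff[OF xy x(4) y(4)])+
        have t01: "\<bar>\<sigma>1 (x - y) * (x$1 / norm x - y$1 / norm y)\<bar> \<le> B1 * (4 / norm x)"
          unfolding abs_mult using B1 d(1) by (intro mult_mono) auto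
        have t02: "\<bar>\<sigma>2 (x - y) * (x$2 / norm x - y$2 / norm y)\<bar> \<le> B2 * (4 / norm x)"
          unfolding abs_mult using B2 d(2) by (intro mult_mono) auto
        have t03: "\<bar>\<sigma> (x - y) / norm y\<bar> \<le> B0 * (2 / norm x)"
        proof -
          have "1 / norm y \<le> 2 / norm x" using y x by (simp add: field_simps)
          then have "\<bar>\<sigma> (x - y)\<bar> * (1 / norm y) \<le> B0 * (2 / norm x)" using B0 y by (intro mult_mono) auto
          then show ?thesis by simp
        qed
        note t0 = t01 t02 t03
        have t: "\<bar>\<sigma>1 (x - y) * (x$1 / norm x - y$1 / norm y)
          + \<sigma>2 (x - y) * (x$2 / norm x - y$2 / norm y) + \<sigma> (x - y) / norm y\<bar> \<le> (4 * B1 + 4 * B2 + 2 * B0) / norm x"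
          (is "\<bar>?t\<bar> \<le> _")
        proof -
          have "\<bar>p + q + r\<bar> \<le> p' + q' + r'" if "\<bar>p\<bar> \<le> p'" "\<bar>q\<bar> \<le> q'" "\<bar>r\<bar> \<le> r'" for p q r p' q' r' :: real
            using that by linarith
          moreover have "B1 * (4 / norm x) + B2 * (4 / norm x) + B0 * (2 / norm x) = (4 * B1 + 4 * B2 + 2 * B0) / norm x"
            by (simp add: add_divide_distrib mult.commute)
          ultimately show ?thesis using t0 by metis
        qed
        have "norm (\<Phi> x y) \<le> cmod (sv y) * \<bar>\<sigma> (x - y)\<bar> + cmod (v y) * \<bar>?t\<bar>"
          unfolding \<Phi>_def by (rule order_trans[OF norm_triangle_ineq]) (simp add: norm_mult del: of_real_add of_real_mult of_real_diff of_real_divide)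
        also have "\<dots> \<le> 2 * \<delta> / ?q * B0 + 2 * \<delta> * ?q * ((4 * B1 + 4 * B2 + 2 * B0) / norm x)"
          using sy vy t B0 \<delta> q by (intro add_mono mult_mono) auto
        also have "2 * \<delta> * ?q * ((4 * B1 + 4 * B2 + 2 * B0) / norm x) = 2 * \<delta> / ?q * (4 * B1 + 4 * B2 + 2 * B0)"
        proof -
          have "2 * \<delta> * z * (c / (z * z)) = 2 * \<delta> / z * c" if "z > 0" for z c :: real using that by (simp add: field_simps)
          from this[OF q(1)] show ?thesis by (simp only: q(2))
        qed
        finally show ?thesis using xy by (simp add: dist_norm distrib_left mult_ac)
      qed
      have nI: "cmod (LBINT y. \<Phi> x y) \<le> 2 * \<delta> / ?q * (B0 + 4 * B1 + 4 * B2 + 2 * B0) * area"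
      proof -
        have "cmod (LBINT y. \<Phi> x y) \<le> (LBINT y. norm (\<Phi> x y))" by (rule integral_norm_bound)
        also have "\<dots> \<le> (LBINT y. (2 * \<delta> / ?q * (B0 + 4 * B1 + 4 * B2 + 2 * B0)) * indicator (cball x 2) y)"
        proof (rule Bochner_Integration.integral_mono[OF integrable_norm[OF int[OF x(2)]] _ b])
          show "integrable lborel (\<lambda>y. 2 * \<delta> / ?q * (B0 + 4 * B1 + 4 * B2 + 2 * B0) * indicat_real (cball x 2) y)"
            by (intro integrable_mult_right integrable_indicator_cball)
        qed
        also have "\<dots> = 2 * \<delta> / ?q * (B0 + 4 * B1 + 4 * B2 + 2 * B0) * area"
          by (simp add: area_def content_cball)
        finally show ?thesis .
      qed
      have "cmod (x$1 *\<^sub>R convol w \<sigma>1 x + x$2 *\<^sub>R convol w \<sigma>2 x - \<i> * of_real (k * norm x) * convol w \<sigma> x) = norm x * cmod (LBINT y. \<Phi> x y)"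
        unfolding identity[OF x(2)] by (simp only: norm_mult norm_of_real abs_norm_cancel)
      also have "\<dots> \<le> (?q * ?q) * (2 * \<delta> / ?q * (B0 + 4 * B1 + 4 * B2 + 2 * B0) * area)"
        unfolding q(2) using nI by (rule mult_left_mono) simp
      also have "\<dots> = ?q * (\<delta> * (C - 1))"
      proof -
        have "(z * z) * (2 * \<delta> / z * c * area) = z * (\<delta> * (2 * c * area))" if "z > 0" for z c :: real
          using that by (simp add: field_simps)
        from this[OF q(1)] show ?thesis by (simp only: C_def add_diff_cancel_right')
      qed
      finally have "cmod (x$1 *\<^sub>R convol w \<sigma>1 x + x$2 *\<^sub>R convol w \<sigma>2 x - \<i> * of_real (k * norm x) * convol w \<sigma> x) / ?q \<le> \<delta> * (C - 1)"
        using q(1) by (simp add: pos_divide_le_eq mult.commute)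
      also have "\<dots> < e" using e C by (simp add: \<delta>_def field_simps)
      finally show "dist (cmod (x$1 *\<^sub>R convol w \<sigma>1 x + x$2 *\<^sub>R convol w \<sigma>2 x - \<i> * of_real (k * norm x) * convol w \<sigma> x) / ?q) 0 < e"
        using q(1) by simp
    qed
  qed
qed

subsection \<open>Mollifiers\<close>

text \<open>\<open>bump k\<close> is the \<open>k\<close>-th derivative of \<open>(max 0 (1 - t\<^sup>2))^4\<close>, for \<open>k \<le> 3\<close>.\<close>
definition bump :: "nat \<Rightarrow> real \<Rightarrow> real" where
  "bump k t = (let m = max 0 (1 - t\<^sup>2) in
     if k = 0 then m^4 else if k = 1 then - 8 * t * m^3
     else if k = 2 then 48 * t\<^sup>2 * m\<^sup>2 - 8 * m^3 else 144 * t * m\<^sup>2 - 192 * t^3 * m)"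

lemma continuous_on_bump: "continuous_on A (bump k)"
  unfolding bump_def Let_def
  by (cases "k = 0"; cases "k = 1"; cases "k = 2"; simp; intro continuous_intros)

lemma bump_eq_0: "\<bar>t\<bar> \<ge> 1 \<Longrightarrow> bump k t = 0"
proof -
  assume "\<bar>t\<bar> \<ge> 1"
  then have "1 \<le> t\<^sup>2" using power_mono[of 1 "\<bar>t\<bar>" 2] by simp
  then show ?thesis by (simp add: bump_def Let_def)
qed

lemma bump_0_nonneg: "bump 0 t \<ge> 0"
  by (simp add: bump_def Let_def)

text \<open>The exponent 4 leaves three continuous derivatives, the last with one factor of the
  positive part. Order three is reached when a first derivative of the mollified Laplacian of
  \<open>w\<close> is put on the kernel.\<close>

lemma DERIV_bump:
  assumes "k < 3"
  shows "(bump k has_real_derivative bump (Suc k) t) (at t)"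
proof -
  let ?m = "\<lambda>t::real. max 0 (1 - t\<^sup>2)"
  have m: "((\<lambda>t. (?m t)^(n + 2)) has_real_derivative real (n + 2) * (?m t)^(n + 1) * (- 2 * t)) (at t)" for n
    by (rule DERIV_chain2[OF DERIV_max0_power]) (auto intro!: derivative_eq_intros)
  have 4: "((\<lambda>t. (?m t)^4) has_real_derivative 4 * (?m t)^3 * (- 2 * t)) (at t)" using m[of 2] by simp
  have 3: "((\<lambda>t. (?m t)^3) has_real_derivative 3 * (?m t)\<^sup>2 * (- 2 * t)) (at t)" using m[of 1] by (simp add: numeral_2_eq_2 numeral_3_eq_3)
  have 2: "((\<lambda>t. (?m t)\<^sup>2) has_real_derivative 2 * ?m t * (- 2 * t)) (at t)" using m[of 0] by (simp add: power2_eq_square)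
  have e: "bump 0 = (\<lambda>t. (?m t)^4)" "bump 1 = (\<lambda>t. - 8 * t * (?m t)^3)" "bump 2 = (\<lambda>t. 48 * t\<^sup>2 * (?m t)\<^sup>2 - 8 * (?m t)^3)"
      "bump 3 = (\<lambda>t. 144 * t * (?m t)\<^sup>2 - 192 * t^3 * ?m t)"
    by (simp_all add: bump_def Let_def fun_eq_iff)
  have suc: "Suc 0 = 1" "Suc 1 = 2" "Suc 2 = 3" by simp_all
  consider "k = 0" | "k = 1" | "k = 2" using assms by linarith
  then show ?thesis
  proof cases
    case 1
    show ?thesis unfolding 1 suc e by (rule DERIV_cong[OF 4]) simp
  next
    case k: 2
    show ?thesis unfolding k suc e
      by (rule DERIV_cong[OF DERIV_mult[OF DERIV_cmult[OF DERIV_ident] 3]])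
         (simp add: power2_eq_square algebra_simps)
  next
    case k: 3
    have sq: "((\<lambda>t. 48 * t\<^sup>2) has_real_derivative 96 * t) (at t)" by (auto intro!: derivative_eq_intros)
    show ?thesis unfolding k suc e
      by (rule DERIV_cong[OF DERIV_diff[OF DERIV_mult[OF sq 2] DERIV_cmult[OF 3]]])
         (simp add: power2_eq_square power3_eq_cube algebra_simps)
  qed
qed

text \<open>The normalising factor is left as an integral, so that unit mass holds by construction
  and only positivity has to be proved.\<close>

definition bump_mass :: "real \<Rightarrow> real" where
  "bump_mass e = (\<integral>x. bump 0 (x$1 / e) * bump 0 (x$2 / e) \<partial>(lborel :: R2 measure))"

text \<open>\<open>mollifier e i j\<close> is the derivative of order \<open>(i, j)\<close> of \<open>mollifier e 0 0\<close>, for \<open>i, j \<le> 3\<close>.\<close>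
definition mollifier :: "real \<Rightarrow> nat \<Rightarrow> nat \<Rightarrow> R2 \<Rightarrow> real" where
  "mollifier e i j x = bump i (x$1 / e) * bump j (x$2 / e) / (e^(i + j) * bump_mass e)"

lemma norm_le_component_sum: "norm (x::R2) \<le> \<bar>x$1\<bar> + \<bar>x$2\<bar>"
  using norm_le_l1_cart[of x] by (simp add: sum_2)

lemma bump2_eq_0:
  assumes "e > 0" "norm (x::R2) > 2 * e"
  shows "bump i (x$1 / e) * bump j (x$2 / e) = 0"
proof -
  have "\<bar>x$1\<bar> \<ge> e \<or> \<bar>x$2\<bar> \<ge> e" using norm_le_component_sum[of x] assms by linarith
  then have "\<bar>x$1 / e\<bar> \<ge> 1 \<or> \<bar>x$2 / e\<bar> \<ge> 1" using assms(1) by simp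
  then show ?thesis using bump_eq_0 by auto
qed

lemma continuous_on_bump2: "e > 0 \<Longrightarrow> continuous_on A (\<lambda>x::R2. bump i (x$1 / e) * bump j (x$2 / e))"
  by (intro continuous_intros continuous_on_compose2[OF continuous_on_bump[of UNIV]]) auto

lemma integrable_bump2: "e > 0 \<Longrightarrow> integrable lborel (\<lambda>x::R2. bump i (x$1 / e) * bump j (x$2 / e))"
  by (rule integrable_lborel_compact_support[where M="2*e"]) (use continuous_on_bump2 bump2_eq_0 in auto)

text \<open>On the disc of radius \<open>e / 2\<close> both scaled coordinates are at most 1/2, so
  each factor is at least (3/4)^4.\<close>

lemma bump_mass_pos:
  assumes e: "e > 0"
  shows "bump_mass e > 0"
proof -
  define c where "c = ((3/4::real)^4)\<^sup>2"
  have c: "c > 0" by (simp add: c_def)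
  have le: "c * indicator (cball 0 (e/2)) x \<le> bump 0 (x$1 / e) * bump 0 (x$2 / e)" for x :: R2
  proof (cases "norm x \<le> e/2")
    case True
    have "(3/4)^4 \<le> bump 0 (x$i / e)" for i
    proof -
      have "\<bar>x$i\<bar> \<le> e/2" using True component_le_norm_cart[of x i] by linarith
      then have "\<bar>x$i / e\<bar> \<le> 1/2" using e by (simp add: field_simps)
      then have "\<bar>x$i / e\<bar> \<le> \<bar>1/2\<bar>" by simp
      then have "(x$i / e)\<^sup>2 \<le> (1/2)\<^sup>2" by (rule abs_le_square_iff[THEN iffD1])
      also have "(1/2::real)\<^sup>2 = 1/4" by (simp add: power2_eq_square)
      finally have m: "3/4 \<le> max 0 (1 - (x$i / e)\<^sup>2)" by linarith
      have "(3/4)^4 \<le> (max 0 (1 - (x$i / e)\<^sup>2))^4" by (rule power_mono[OF m]) simp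
      then show ?thesis by (simp only: bump_def Let_def refl if_True)
    qed
    then have "(3/4)^4 * (3/4)^4 \<le> bump 0 (x$1 / e) * bump 0 (x$2 / e)"
      by (intro mult_mono) (auto simp: bump_0_nonneg)
    then show ?thesis using True by (simp add: c_def power2_eq_square)
  next
    case False
    then show ?thesis by (simp add: bump_0_nonneg)
  qed
  have "0 < c * measure lborel (cball (0::R2) (e/2))"
    using c e by (subst content_cball) (auto simp: unit_ball_vol_2)
  also have "\<dots> = (LBINT x. c * indicator (cball (0::R2) (e/2)) x)" by simp
  also have "\<dots> \<le> bump_mass e"
    unfolding bump_mass_def
  proof (rule Bochner_Integration.integral_mono[OF _ integrable_bump2[OF e] le])
    show "integrable lborel (\<lambda>x. c * indicat_real (cball (0::R2) (e/2)) x)"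
      by (intro integrable_mult_right integrable_indicator_cball)
  qed
  finally show ?thesis .
qed

lemma continuous_on_mollifier: "e > 0 \<Longrightarrow> continuous_on A (mollifier e i j)"
  using bump_mass_pos[of e] unfolding mollifier_def
  by (intro continuous_on_divide continuous_on_bump2) (auto intro!: continuous_intros)

lemma mollifier_eq_0: "e > 0 \<Longrightarrow> norm x > 2 * e \<Longrightarrow> mollifier e i j x = 0"
  using bump2_eq_0[of e x i j] by (auto simp: mollifier_def)

lemma mollifier_nonneg: "e > 0 \<Longrightarrow> mollifier e 0 0 x \<ge> 0"
  using bump_mass_pos[of e] by (simp add: mollifier_def bump_0_nonneg)

lemma integral_mollifier: "e > 0 \<Longrightarrow> (LBINT x. mollifier e 0 0 x) = 1"
  using bump_mass_pos[of e] by (simp add: mollifier_def bump_mass_def)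

lemma grad_at_mollifier:
  assumes e: "e > 0" and ij: "i < 3" "j < 3"
  shows "grad_at (mollifier e i j) (mollifier e (Suc i) j) (mollifier e i (Suc j)) x"
proof -
  have lin: "((\<lambda>x::R2. x$l / e) has_derivative (\<lambda>h. h$l / e)) (at x)" for l
    by (intro bounded_linear_imp_has_derivative bounded_linear_divide bounded_linear_vec_nth
        bounded_linear_compose[OF bounded_linear_divide bounded_linear_vec_nth])
  have b: "((\<lambda>x::R2. bump n (x$l / e)) has_derivative (\<lambda>h. bump (Suc n) (x$l / e) * (h$l / e))) (at x)" if "n < 3" for n l
    using has_derivative_compose[OF lin[of l], of "bump n" "\<lambda>s. bump (Suc n) (x$l / e) * s"] DERIV_bump[OF that]
    by (simp add: has_field_derivative_def)
  have m: "bump_mass e \<noteq> 0" using bump_mass_pos[OF e] by simp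
  have "((\<lambda>x. bump i (x$1 / e) * bump j (x$2 / e) * (1 / (e^(i + j) * bump_mass e))) has_derivative
     (\<lambda>h. (bump i (x$1 / e) * (bump (Suc j) (x$2 / e) * (h$2 / e)) + bump (Suc i) (x$1 / e) * (h$1 / e) * bump j (x$2 / e)) * (1 / (e^(i + j) * bump_mass e)))) (at x)"
    by (rule has_derivative_mult_left[OF has_derivative_mult[OF b[OF ij(1)] b[OF ij(2)]]])
  moreover have "(bump i (x$1 / e) * (bump (Suc j) (x$2 / e) * (h$2 / e)) + bump (Suc i) (x$1 / e) * (h$1 / e) * bump j (x$2 / e)) * (1 / (e^(i + j) * bump_mass e))
      = h$1 *\<^sub>R mollifier e (Suc i) j x + h$2 *\<^sub>R mollifier e i (Suc j) x" for h :: R2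
    using e m by (simp add: mollifier_def field_simps)
  ultimately show ?thesis by (simp add: grad_at_def mollifier_def[abs_def])
qed

lemma C1_kernel_mollifier: "0 < e \<Longrightarrow> e \<le> 1 \<Longrightarrow> i < 3 \<Longrightarrow> j < 3 \<Longrightarrow> C1_kernel (mollifier e i j) (mollifier e (Suc i) j) (mollifier e i (Suc j))"
  unfolding C1_kernel_def using grad_at_mollifier continuous_on_mollifier[of e UNIV] mollifier_eq_0[of e] by auto

subsection \<open>Estimates for mollified solutions\<close>

lemma sommerfeld_energy:
  assumes "sommerfeld k u u1 u2"
  shows "((\<lambda>x. ((x$1 * Re (u1 x) + x$2 * Re (u2 x) + k * norm x * Im (u x))\<^sup>2 +
     (x$1 * Im (u1 x) + x$2 * Im (u2 x) - k * norm x * Re (u x))\<^sup>2) / norm x) \<longlongrightarrow> 0) at_infinity"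
proof -
  have "(cmod (x$1 *\<^sub>R u1 x + x$2 *\<^sub>R u2 x - \<i> * of_real (k * norm x) * u x) / sqrt (norm x))\<^sup>2 =
     ((x$1 * Re (u1 x) + x$2 * Re (u2 x) + k * norm x * Im (u x))\<^sup>2 +
     (x$1 * Im (u1 x) + x$2 * Im (u2 x) - k * norm x * Re (u x))\<^sup>2) / norm x" for x :: R2
    by (simp add: power_divide cmod_power2)
  then show ?thesis
    using tendsto_power[OF assms[unfolded sommerfeld_def], of 2] by simp
qed

lemma growth_energy:
  assumes "\<And>x. grad_at u u1 u2 x" "sommerfeld k u u1 u2"
  shows "((\<lambda>x. ((Re (u x))\<^sup>2 + (Im (u x))\<^sup>2) / norm x) \<longlongrightarrow> 0) at_infinity"
proof -
  have "(cmod (u x) / sqrt (norm x))\<^sup>2 = ((Re (u x))\<^sup>2 + (Im (u x))\<^sup>2) / norm x" for x :: R2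
    by (simp add: power_divide cmod_power2)
  then show ?thesis
    using tendsto_power[OF sommerfeld_growth[where R=0, OF assms], of 2] by simp
qed

lemma C2_pair_complex:
  assumes g: "\<And>x. grad_at u u1 u2 x" "\<And>x. grad_at u1 u11 u12 x" "\<And>x. grad_at u2 u12 u22 x"
    and c: "continuous_on UNIV u" "continuous_on UNIV u1" "continuous_on UNIV u2"
      "continuous_on UNIV u11" "continuous_on UNIV u12" "continuous_on UNIV u22"
  shows "C2_pair (\<lambda>x. Re (u x)) (\<lambda>x. Re (u1 x)) (\<lambda>x. Re (u2 x)) (\<lambda>x. Re (u11 x)) (\<lambda>x. Re (u12 x)) (\<lambda>x. Re (u22 x))
     (\<lambda>x. Im (u x)) (\<lambda>x. Im (u1 x)) (\<lambda>x. Im (u2 x)) (\<lambda>x. Im (u11 x)) (\<lambda>x. Im (u12 x)) (\<lambda>x. Im (u22 x))"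
  by unfold_locales
     (use grad_at_pd[OF g(1)] grad_at_pd[OF g(2)] grad_at_pd[OF g(3)] in \<open>auto intro!: continuous_intros c\<close>)

text \<open>The quotient of the two constants in \<open>helmholtz_bound\<close>.\<close>

definition helm_const :: "real \<Rightarrow> real \<Rightarrow> real" where
  "helm_const k R = (let c = inverse (sqrt (1 + k\<^sup>2 * R\<^sup>2)) ^ 3 in 8 / (k\<^sup>2 * c) * (R\<^sup>2 / c + 9 / (k\<^sup>2 * c)))"

text \<open>Both equations take the form Delta u = \<tau> u + F, with \<tau> = - k^2 or k^2, as they
  come out of the factorization. The imaginary part of \<open>F x * cnj (u x)\<close> is the
  integrand of the two flux lemmas.\<close>

lemma complex_estimates:
  assumes g: "\<And>x. grad_at u u1 u2 x" "\<And>x. grad_at u1 u11 u12 x" "\<And>x. grad_at u2 u12 u22 x"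
    and c: "continuous_on UNIV u" "continuous_on UNIV u1" "continuous_on UNIV u2"
      "continuous_on UNIV u11" "continuous_on UNIV u12" "continuous_on UNIV u22"
    and sommerfeld: "sommerfeld k u u1 u2" and k: "k > 0" and R: "R > 0"
    and Fs: "\<And>x. norm x > R \<Longrightarrow> F x = 0"
  shows "(\<And>x. u11 x + u22 x = of_real (- k\<^sup>2) * u x + F x) \<Longrightarrow> Im (LBINT x. F x * cnj (u x)) \<ge> 0"
    and "(\<And>x. u11 x + u22 x = of_real (- k\<^sup>2) * u x + F x) \<Longrightarrow>
      (LBINT x. indicator (cball 0 R) x * (cmod (u x))\<^sup>2) \<le> helm_const k R * (LBINT x. (cmod (F x))\<^sup>2)"
    and "(\<And>x. u11 x + u22 x = of_real (k\<^sup>2) * u x + F x) \<Longrightarrow> Im (LBINT x. F x * cnj (u x)) = 0"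
    and "(\<And>x. u11 x + u22 x = of_real (k\<^sup>2) * u x + F x) \<Longrightarrow>
      (LBINT x. indicator (cball 0 R) x * (cmod (u x))\<^sup>2) \<le> 8 / k^4 * (LBINT x. (cmod (F x))\<^sup>2)"
proof -
  interpret C2_pair "\<lambda>x. Re (u x)" "\<lambda>x. Re (u1 x)" "\<lambda>x. Re (u2 x)" "\<lambda>x. Re (u11 x)" "\<lambda>x. Re (u12 x)" "\<lambda>x. Re (u22 x)"
     "\<lambda>x. Im (u x)" "\<lambda>x. Im (u1 x)" "\<lambda>x. Im (u2 x)" "\<lambda>x. Im (u11 x)" "\<lambda>x. Im (u12 x)" "\<lambda>x. Im (u22 x)"
    by (rule C2_pair_complex[OF g c])
  have S: "((\<lambda>x. som_defect k x / norm x) \<longlongrightarrow> 0) at_infinity"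
    using sommerfeld_energy[OF sommerfeld] by (simp add: som_defect_def rad_a_def rad_b_def)
  have Ul: "((\<lambda>x. abs2 x / norm x) \<longlongrightarrow> 0) at_infinity"
    using growth_energy[OF g(1) sommerfeld] by (simp add: abs2_def)
  have Ueq: "abs2 x = (cmod (u x))\<^sup>2" for x by (simp add: abs2_def cmod_power2)
  have Fs': "\<And>x. norm x > R \<Longrightarrow> Re (F x) = 0" "\<And>x. norm x > R \<Longrightarrow> Im (F x) = 0" by (simp_all add: Fs)
  have Feq: "(Re (F x))\<^sup>2 + (Im (F x))\<^sup>2 = (cmod (F x))\<^sup>2" for x by (simp add: cmod_power2)
  have Imeq: "Re (u x) * Im (F x) - Im (u x) * Re (F x) = Im (F x * cnj (u x))" for x by (simp add: algebra_simps)
  have Imint: "Im (LBINT x. F x * cnj (u x)) = (LBINT x. Re (u x) * Im (F x) - Im (u x) * Re (F x))"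
    if "continuous_on UNIV F"
  proof -
    have "integrable lborel (\<lambda>x. F x * cnj (u x))"
      by (rule integrable_lborel_compact_support[where M=R]) (auto intro!: continuous_intros that c simp: Fs)
    from integral_Im[OF this] show ?thesis unfolding Imeq by simp
  qed
  {
    assume eq: "\<And>x. u11 x + u22 x = of_real (- k\<^sup>2) * u x + F x"
    then have F: "F = (\<lambda>x. u11 x + u22 x + of_real (k\<^sup>2) * u x)" by (auto simp: fun_eq_iff algebra_simps)
    have cF: "continuous_on UNIV F" unfolding F by (intro continuous_intros c)
    have e1: "Re (u11 x) + Re (u22 x) + k\<^sup>2 * Re (u x) = Re (F x)" for x by (simp add: F)
    have e2: "Im (u11 x) + Im (u22 x) + k\<^sup>2 * Im (u x) = Im (F x)" for x by (simp add: F)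
    show "Im (LBINT x. F x * cnj (u x)) \<ge> 0"
      using helmholtz_flux_nonneg[OF k e1 e2 Fs' S] unfolding Imint[OF cF] .
    define c where "c = inverse (sqrt (1 + k\<^sup>2 * R\<^sup>2)) ^ 3"
    have cp: "k\<^sup>2 * c / 8 > 0" using k unfolding c_def by (simp add: add_pos_nonneg)
    have "k\<^sup>2 * c / 8 * (LBINT x. indicator (cball 0 R) x * (cmod (u x))\<^sup>2)
      \<le> (R\<^sup>2 / c + 9 / (k\<^sup>2 * c)) * (LBINT x. (cmod (F x))\<^sup>2)"
      using helmholtz_bound[OF k R e1 e2 Fs' S Ul c_def] unfolding Ueq Feq .
    then have "(LBINT x. indicator (cball 0 R) x * (cmod (u x))\<^sup>2) \<le> (R\<^sup>2 / c + 9 / (k\<^sup>2 * c)) * (LBINT x. (cmod (F x))\<^sup>2) / (k\<^sup>2 * c / 8)"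
      using cp by (simp only: pos_le_divide_eq mult.commute)
    also have "\<dots> = helm_const k R * (LBINT x. (cmod (F x))\<^sup>2)"
      unfolding helm_const_def Let_def c_def[symmetric] by simp
    finally show "(LBINT x. indicator (cball 0 R) x * (cmod (u x))\<^sup>2) \<le> helm_const k R * (LBINT x. (cmod (F x))\<^sup>2)" .
  next
    assume eq: "\<And>x. u11 x + u22 x = of_real (k\<^sup>2) * u x + F x"
    then have F: "F = (\<lambda>x. u11 x + u22 x - of_real (k\<^sup>2) * u x)" by (auto simp: fun_eq_iff algebra_simps)
    have cF: "continuous_on UNIV F" unfolding F by (intro continuous_intros c)
    have e1: "Re (u11 x) + Re (u22 x) - k\<^sup>2 * Re (u x) = Re (F x)" for x by (simp add: F)
    have e2: "Im (u11 x) + Im (u22 x) - k\<^sup>2 * Im (u x) = Im (F x)" for x by (simp add: F)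
    show "Im (LBINT x. F x * cnj (u x)) = 0"
      using modified_flux_zero[OF k e1 e2 Fs' S] unfolding Imint[OF cF] .
    have "k\<^sup>2 / 8 * (LBINT x. indicator (cball 0 R) x * (cmod (u x))\<^sup>2) \<le> (LBINT x. (cmod (F x))\<^sup>2) / k\<^sup>2"
      using modified_bound[OF k e1 e2 Fs' S] unfolding Ueq Feq .
    then have "(LBINT x. indicator (cball 0 R) x * (cmod (u x))\<^sup>2) \<le> (LBINT x. (cmod (F x))\<^sup>2) / k\<^sup>2 / (k\<^sup>2 / 8)"
      using k by (subst pos_le_divide_eq) (simp_all only: mult.commute zero_less_power zero_less_divide_iff zero_less_numeral simp_thms)
    also have "\<dots> = 8 / k^4 * (LBINT x. (cmod (F x))\<^sup>2)" using k by (simp add: field_simps power4_eq_xxxx power2_eq_square)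
    finally show "(LBINT x. indicator (cball 0 R) x * (cmod (u x))\<^sup>2) \<le> 8 / k^4 * (LBINT x. (cmod (F x))\<^sup>2)" .
  }
qed

lemma convol_add: "loc_integrable w \<Longrightarrow> loc_integrable z \<Longrightarrow> continuous_on UNIV \<sigma> \<Longrightarrow> (\<And>x. norm x > 2 \<Longrightarrow> \<sigma> x = 0) \<Longrightarrow>
   convol (\<lambda>x. w x + c * z x) \<sigma> x = convol w \<sigma> x + c * convol z \<sigma> x"
  unfolding convol_def distrib_right
  by (subst Bochner_Integration.integral_add)
     (auto simp: mult.assoc intro!: convol_integrable integrable_mult_right)

lemma loc_integrable_add: "loc_integrable w \<Longrightarrow> loc_integrable z \<Longrightarrow> loc_integrable (\<lambda>x. w x + c * z x)"
  unfolding loc_integrable_def scaleR_add_right by (auto simp: mult_scaleR_right[symmetric] simp del: mult_scaleR_right)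

lemma convol_support:
  assumes e: "0 < e" "e \<le> 1" and F: "\<And>x. norm x > R \<Longrightarrow> F x = 0" and x: "norm x > R + 2"
  shows "convol F (mollifier e i j) x = 0"
proof -
  have "F y * of_real (mollifier e i j (x - y)) = 0" for y
  proof (cases "norm y > R")
    case False
    then have "norm (x - y) > 2" using norm_triangle_ineq2[of x y] x by linarith
    then show ?thesis using mollifier_eq_0[of e "x - y"] e by simp
  qed (simp add: F)
  then show ?thesis unfolding convol_def by (simp only: Bochner_Integration.integral_zero)
qed

lemma integrable_cball_mult:
  "continuous_on UNIV (f :: R2 \<Rightarrow> real) \<Longrightarrow> integrable lborel (\<lambda>x. indicator (cball 0 R) x * f x)"
  using borel_integrable_compact[of "cball 0 R" f] continuous_on_subset[of UNIV f] by simp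

text \<open>The constant for (p - u) / (2 k^2): the square of a difference costs a factor 2 and the
  denominator 4 k^4.\<close>

definition total_const :: "real \<Rightarrow> real \<Rightarrow> real" where
  "total_const k R = (helm_const k R + 8 / k^4) / (2 * k^4)"

lemma total_const_nonneg: "k > 0 \<Longrightarrow> total_const k R \<ge> 0"
  unfolding total_const_def helm_const_def Let_def by (simp add: add_nonneg_nonneg)

text \<open>The factorization \<open>\<Delta>\<^sup>2 - k\<^sup>4 = (\<Delta> + k\<^sup>2) (\<Delta> - k\<^sup>2)\<close> splits \<open>w\<close> into \<open>L - k\<^sup>2 w\<close> and \<open>L + k\<^sup>2 w\<close>, where
  \<open>L = \<Delta> w\<close>.\<close>
lemma mollified_estimates:
  fixes w L F v g1 g2 :: "R2 \<Rightarrow> complex"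
  assumes k: "k > 0" and e: "0 < e" "e \<le> 1" and w: "loc_integrable w" and L: "loc_integrable L" and F: "loc_integrable F"
    and ae: "AE x in lborel. norm x > R \<longrightarrow> w x = v x" and R: "R > 0"
    and v: "\<And>x. norm x > R \<Longrightarrow> grad_at v g1 g2 x"
    and g: "continuous_on {x. norm x > R} g1" "continuous_on {x. norm x > R} g2"
    and sommerfeld: "sommerfeld k v g1 g2"
    and wL: "\<And>x i j. i + j \<le> 1 \<Longrightarrow> convol w (mollifier e (i + 2) j) x + convol w (mollifier e i (j + 2)) x = convol L (mollifier e i j) x"
    and LF: "\<And>x. convol L (mollifier e 2 0) x + convol L (mollifier e 0 2) x = of_real (k^4) * convol w (mollifier e 0 0) x + convol F (mollifier e 0 0) x"
    and Fs: "\<And>x. norm x > R0 \<Longrightarrow> F x = 0" and R0: "R0 \<ge> 0"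
  shows "Im (LBINT x. convol F (mollifier e 0 0) x * cnj (convol w (mollifier e 0 0) x)) \<le> 0"
    and "(LBINT x. indicator (cball 0 (R0 + 2)) x * (cmod (convol w (mollifier e 0 0) x))\<^sup>2)
      \<le> total_const k (R0 + 2) * (LBINT x. (cmod (convol F (mollifier e 0 0) x))\<^sup>2)"
proof -
  let ?F = "convol F (mollifier e 0 0)" and ?w = "convol w (mollifier e 0 0)"
  \<comment> \<open>The value \<open>- k\<^sup>2\<close> of \<open>\<tau>\<close> gives the
    Helmholtz component and \<open>k\<^sup>2\<close> the modified one; \<open>i\<close> and
    \<open>j\<close> count the derivatives placed on the kernel.\<close>
  define u where "u \<tau> i j = convol (\<lambda>x. L x + of_real \<tau> * w x) (mollifier e i j)" for \<tau> :: real and i j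
  have Kc: "continuous_on UNIV (mollifier e i j)" "\<And>x. norm x > 2 \<Longrightarrow> mollifier e i j x = 0" for i j
    using continuous_on_mollifier[OF e(1)] mollifier_eq_0[OF e(1)] e by auto
  have u: "u \<tau> i j x = convol L (mollifier e i j) x + of_real \<tau> * convol w (mollifier e i j) x" for \<tau> i j x
    unfolding u_def by (rule convol_add[OF L w Kc])
  have lz: "loc_integrable (\<lambda>x. L x + of_real \<tau> * w x)" for \<tau> by (rule loc_integrable_add[OF L w])
  have gr: "grad_at (u \<tau> i j) (u \<tau> (Suc i) j) (u \<tau> i (Suc j)) x" if "i < 3" "j < 3" for \<tau> i j x
    unfolding u_def by (rule grad_at_convol[OF lz C1_kernel_mollifier[OF e that]])
  have cu: "continuous_on UNIV (u \<tau> i j)" for \<tau> i j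
    unfolding u_def by (rule continuous_on_convol[OF lz Kc])
  have sw: "sommerfeld k (convol w (mollifier e i j)) (convol w (mollifier e (Suc i) j)) (convol w (mollifier e i (Suc j)))" if "i < 3" "j < 3" for i j
    by (rule sommerfeld_convol[OF w ae R k v g sommerfeld C1_kernel_mollifier[OF e that]])
  \<comment> \<open>The mollified \<open>L\<close> and its gradient are convolutions of
    \<open>w\<close> with kernels of order two and three, so the condition for \<open>w\<close>
    carries over by linearity.\<close>
  have sL: "sommerfeld k (convol L (mollifier e 0 0)) (convol L (mollifier e 1 0)) (convol L (mollifier e 0 1))"
  proof -
    have "convol L (mollifier e 0 0) = (\<lambda>x. convol w (mollifier e 2 0) x + convol w (mollifier e 0 2) x)"
      "convol L (mollifier e 1 0) = (\<lambda>x. convol w (mollifier e 3 0) x + convol w (mollifier e 1 2) x)"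
      "convol L (mollifier e 0 1) = (\<lambda>x. convol w (mollifier e 2 1) x + convol w (mollifier e 0 3) x)"
      using wL[of 0 0] wL[of 1 0] wL[of 0 1] by (auto simp: fun_eq_iff eval_nat_numeral)
    then show ?thesis
      using sommerfeld_add[OF sw[of 2 0] sw[of 0 2]] by (simp add: eval_nat_numeral)
  qed
  have su: "sommerfeld k (u \<tau> 0 0) (u \<tau> 1 0) (u \<tau> 0 1)" for \<tau>
    using sommerfeld_add[OF sL sommerfeld_cmult[OF sw[of 0 0], of "of_real \<tau>"]] by (simp add: u[abs_def])
  \<comment> \<open>(Delta - \<tau>)(Delta + \<tau>) = Delta^2 - \<tau>^2, applied to
    \<open>w\<close>, for either root of \<tau>^2 = k^4.\<close>
  have lap: "u \<tau> 2 0 x + u \<tau> 0 2 x = of_real \<tau> * u \<tau> 0 0 x + ?F x" if "\<tau>\<^sup>2 = k^4" for \<tau> x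
  proof -
    have "u \<tau> 2 0 x + u \<tau> 0 2 x = (convol L (mollifier e 2 0) x + convol L (mollifier e 0 2) x) + of_real \<tau> * (convol w (mollifier e 2 0) x + convol w (mollifier e 0 2) x)"
      by (simp add: u algebra_simps)
    also have "\<dots> = of_real (\<tau>\<^sup>2) * convol w (mollifier e 0 0) x + ?F x + of_real \<tau> * convol L (mollifier e 0 0) x"
      using LF[of x] wL[of 0 0 x] unfolding that by (simp add: numeral_2_eq_2)
    finally show ?thesis by (simp add: u algebra_simps power2_eq_square)
  qed
  have R2: "R0 + 2 > 0" using R0 by simp
  have F0: "?F x = 0" if "norm x > R0 + 2" for x by (rule convol_support[OF e Fs that])
  note est = complex_estimates[where u="u \<tau> 0 0" and ?u1.0="u \<tau> 1 0" and ?u2.0="u \<tau> 0 1" and ?u11.0="u \<tau> 2 0"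
      and ?u12.0="u \<tau> 1 1" and ?u22.0="u \<tau> 0 2" and F="?F" and R="R0 + 2" and k=k for \<tau>, OF _ _ _ cu cu cu cu cu cu su k R2 F0]
  have gr': "grad_at (u \<tau> 0 0) (u \<tau> 1 0) (u \<tau> 0 1) x" "grad_at (u \<tau> 1 0) (u \<tau> 2 0) (u \<tau> 1 1) x" "grad_at (u \<tau> 0 1) (u \<tau> 1 1) (u \<tau> 0 2) x" for \<tau> x
    using gr[of 0 0 \<tau> x] gr[of 1 0 \<tau> x] gr[of 0 1 \<tau> x] by (simp_all add: numeral_2_eq_2)
  let ?u = "u (- k\<^sup>2) 0 0" and ?p = "u (k\<^sup>2) 0 0"
  have k4: "(- k\<^sup>2)\<^sup>2 = k^4" "(k\<^sup>2)\<^sup>2 = k^4" by simp_all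
  have u1: "Im (LBINT x. ?F x * cnj (?u x)) \<ge> 0"
    by (rule est(1)[OF gr' _ lap[OF k4(1)]])
  have u2: "(LBINT x. indicator (cball 0 (R0 + 2)) x * (cmod (?u x))\<^sup>2) \<le> helm_const k (R0 + 2) * (LBINT x. (cmod (?F x))\<^sup>2)"
    by (rule est(2)[OF gr' _ lap[OF k4(1)]])
  have p1: "Im (LBINT x. ?F x * cnj (?p x)) = 0"
    by (rule est(3)[OF gr' _ lap[OF k4(2)]])
  have p2: "(LBINT x. indicator (cball 0 (R0 + 2)) x * (cmod (?p x))\<^sup>2) \<le> 8 / k^4 * (LBINT x. (cmod (?F x))\<^sup>2)"
    by (rule est(4)[OF gr' _ lap[OF k4(2)]])
  have weq: "?w x = (?p x - ?u x) * of_real (1 / (2 * k\<^sup>2))" for x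
    using k by (simp add: u algebra_simps)
  have cF: "continuous_on UNIV ?F" by (rule continuous_on_convol[OF F Kc])
  have iF: "integrable lborel (\<lambda>x. ?F x * cnj (u \<tau> 0 0 x))" for \<tau>
    by (rule integrable_lborel_compact_support[where M="R0 + 2"]) (auto intro!: continuous_intros cF cu simp: F0)
  have "(LBINT x. ?F x * cnj (?w x)) = (LBINT x. (?F x * cnj (?p x) - ?F x * cnj (?u x)) * of_real (1 / (2 * k\<^sup>2)))"
    unfolding weq by (simp add: algebra_simps)
  also have "\<dots> = ((LBINT x. ?F x * cnj (?p x)) - (LBINT x. ?F x * cnj (?u x))) * of_real (1 / (2 * k\<^sup>2))"
    by (simp only: integral_mult_left_zero Bochner_Integration.integral_diff[OF iF iF])
  finally have "Im (LBINT x. ?F x * cnj (?w x)) = (0 - Im (LBINT x. ?F x * cnj (?u x))) * (1 / (2 * k\<^sup>2))"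
    using p1 by simp
  then show "Im (LBINT x. ?F x * cnj (?w x)) \<le> 0"
    using u1 k by (simp add: mult_nonpos_nonneg)
  have ii: "integrable lborel (\<lambda>x. indicator (cball 0 (R0 + 2)) x * (cmod (u \<tau> 0 0 x))\<^sup>2)" for \<tau>
    by (intro integrable_cball_mult continuous_intros cu)
  have wc: "continuous_on UNIV ?w" by (rule continuous_on_convol[OF w Kc])
  have iw: "integrable lborel (\<lambda>x. indicator (cball 0 (R0 + 2)) x * (cmod (?w x))\<^sup>2)"
    by (intro integrable_cball_mult continuous_intros wc)
  have pw: "indicator (cball 0 (R0 + 2)) x * (cmod (?w x))\<^sup>2 \<le> (1 / (2 * k^4)) *
     (indicator (cball 0 (R0 + 2)) x * (cmod (?p x))\<^sup>2 + indicator (cball 0 (R0 + 2)) x * (cmod (?u x))\<^sup>2)" for x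
  proof -
    have "(cmod (?w x))\<^sup>2 = (cmod (?p x - ?u x))\<^sup>2 * (1 / (4 * k^4))"
    proof -
      have "cmod (of_real (1 / (2 * k\<^sup>2))) = 1 / (2 * k\<^sup>2)" by (simp only: norm_of_real) simp
      then show ?thesis unfolding weq norm_mult by (simp only: power_mult_distrib power_divide) simp
    qed
    moreover have "(cmod (?p x - ?u x))\<^sup>2 \<le> 2 * ((cmod (?p x))\<^sup>2 + (cmod (?u x))\<^sup>2)"
    proof -
      have "(cmod (?p x - ?u x))\<^sup>2 \<le> (cmod (?p x) + cmod (?u x))\<^sup>2"
        by (intro power_mono norm_triangle_ineq4) simp
      also have "\<dots> \<le> 2 * ((cmod (?p x))\<^sup>2 + (cmod (?u x))\<^sup>2)"
        using sum_squares_bound[of "cmod (?p x)" "cmod (?u x)"] by (simp add: power2_sum)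
      finally show ?thesis .
    qed
    ultimately have "(cmod (?w x))\<^sup>2 \<le> 2 * ((cmod (?p x))\<^sup>2 + (cmod (?u x))\<^sup>2) * (1 / (4 * k^4))"
      by (simp add: divide_right_mono)
    also have "2 * ((cmod (?p x))\<^sup>2 + (cmod (?u x))\<^sup>2) * (1 / (4 * k^4)) = (1 / (2 * k^4)) * ((cmod (?p x))\<^sup>2 + (cmod (?u x))\<^sup>2)"
      using k by (simp add: field_simps)
    finally have "(cmod (?w x))\<^sup>2 \<le> (1 / (2 * k^4)) * ((cmod (?p x))\<^sup>2 + (cmod (?u x))\<^sup>2)" .
    then show ?thesis by (cases "x \<in> cball 0 (R0 + 2)") simp_all
  qed
  have "(LBINT x. indicator (cball 0 (R0 + 2)) x * (cmod (?w x))\<^sup>2) \<le> (1 / (2 * k^4)) *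
     ((LBINT x. indicator (cball 0 (R0 + 2)) x * (cmod (?p x))\<^sup>2) + (LBINT x. indicator (cball 0 (R0 + 2)) x * (cmod (?u x))\<^sup>2))"
    using Bochner_Integration.integral_mono[OF iw integrable_mult_right[OF Bochner_Integration.integrable_add[OF ii ii]] pw]
    unfolding integral_mult_right_zero Bochner_Integration.integral_add[OF ii ii] .
  also have "\<dots> \<le> (1 / (2 * k^4)) * (8 / k^4 * (LBINT x. (cmod (?F x))\<^sup>2) + helm_const k (R0 + 2) * (LBINT x. (cmod (?F x))\<^sup>2))"
    by (intro mult_left_mono add_mono p2 u2) simp
  also have "\<dots> = total_const k (R0 + 2) * (LBINT x. (cmod (?F x))\<^sup>2)"
    by (simp add: total_const_def algebra_simps add_divide_distrib)
  finally show "(LBINT x. indicator (cball 0 (R0 + 2)) x * (cmod (?w x))\<^sup>2)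
      \<le> total_const k (R0 + 2) * (LBINT x. (cmod (?F x))\<^sup>2)" .
qed

subsection \<open>Mean square convergence of mollifications\<close>

definition L2_borel :: "(R2 \<Rightarrow> complex) \<Rightarrow> bool" where
  "L2_borel g \<longleftrightarrow> g \<in> borel_measurable borel \<and> integrable lborel (\<lambda>x. (cmod (g x))\<^sup>2)"

definition L2_sq :: "(R2 \<Rightarrow> complex) \<Rightarrow> real" where
  "L2_sq g = (LBINT x. (cmod (g x))\<^sup>2)"

lemma L2_sq_nonneg: "L2_sq g \<ge> 0"
  unfolding L2_sq_def by (rule Bochner_Integration.integral_nonneg) simp

lemma cmod_add_sq: "(cmod (a + b))\<^sup>2 \<le> 2 * (cmod a)\<^sup>2 + 2 * (cmod b)\<^sup>2"
proof -
  have "(cmod (a + b))\<^sup>2 \<le> (cmod a + cmod b)\<^sup>2" by (intro power_mono norm_triangle_ineq) simp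
  also have "\<dots> \<le> 2 * (cmod a)\<^sup>2 + 2 * (cmod b)\<^sup>2"
    using sum_squares_bound[of "cmod a" "cmod b"] by (simp add: power2_sum)
  finally show ?thesis .
qed

lemma L2_borel_bound:
  assumes "g \<in> borel_measurable borel" "integrable lborel h" "\<And>x. (cmod (g x))\<^sup>2 \<le> h x"
  shows "L2_borel g"
  unfolding L2_borel_def
proof
  have [measurable]: "g \<in> borel_measurable borel" by fact
  show "integrable lborel (\<lambda>x. (cmod (g x))\<^sup>2)"
    by (rule Bochner_Integration.integrable_bound[OF assms(2)]) (auto intro!: AE_I2 order_trans[OF assms(3)])
qed fact

lemma L2_borel_add:
  assumes f: "L2_borel f" and g: "L2_borel g"
  shows "L2_borel (\<lambda>x. f x + g x)" "L2_sq (\<lambda>x. f x + g x) \<le> 2 * L2_sq f + 2 * L2_sq g"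
proof -
  have i: "integrable lborel (\<lambda>x. 2 * (cmod (f x))\<^sup>2 + 2 * (cmod (g x))\<^sup>2)"
    using f g by (simp add: L2_borel_def)
  have [measurable]: "f \<in> borel_measurable borel" "g \<in> borel_measurable borel" using f g by (auto simp: L2_borel_def)
  show *: "L2_borel (\<lambda>x. f x + g x)"
    by (rule L2_borel_bound[OF _ i cmod_add_sq]) measurable
  have "L2_sq (\<lambda>x. f x + g x) \<le> (LBINT x. 2 * (cmod (f x))\<^sup>2 + 2 * (cmod (g x))\<^sup>2)"
    unfolding L2_sq_def using * by (intro Bochner_Integration.integral_mono i cmod_add_sq) (simp add: L2_borel_def)
  also have "\<dots> = 2 * L2_sq f + 2 * L2_sq g" using f g by (simp add: L2_sq_def L2_borel_def)
  finally show "L2_sq (\<lambda>x. f x + g x) \<le> 2 * L2_sq f + 2 * L2_sq g" .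
qed

lemma L2_borel_minus: "L2_borel g \<Longrightarrow> L2_borel (\<lambda>x. - g x)" "L2_sq (\<lambda>x. - g x) = L2_sq g"
  by (auto simp: L2_borel_def L2_sq_def)

lemma L2_borel_diff:
  assumes f: "L2_borel f" and g: "L2_borel g"
  shows "L2_borel (\<lambda>x. f x - g x)" "L2_sq (\<lambda>x. f x - g x) \<le> 2 * L2_sq f + 2 * L2_sq g"
  using L2_borel_add[OF f L2_borel_minus(1)[OF g]] by (simp_all add: L2_borel_minus(2))

lemma L2_sq_diff_commute: "L2_sq (\<lambda>x. f x - g x) = L2_sq (\<lambda>x. g x - f x)"
  by (simp add: L2_sq_def norm_minus_commute)

lemma L2_borel_continuous:
  assumes "continuous_on UNIV c" "\<And>x. norm x > M \<Longrightarrow> c x = 0"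
  shows "L2_borel c"
  unfolding L2_borel_def
proof
  show "c \<in> borel_measurable borel" using assms(1) by (rule borel_measurable_continuous_onI)
  show "integrable lborel (\<lambda>x. (cmod (c x))\<^sup>2)"
    by (rule integrable_lborel_compact_support[where M=M]) (auto intro!: continuous_intros assms simp: assms(2))
qed

lemma L2_borel_loc_integrable:
  assumes g: "L2_borel g"
  shows "loc_integrable g"
  unfolding loc_integrable_def
proof (intro conjI allI)
  show m[measurable]: "g \<in> borel_measurable borel" using g by (simp add: L2_borel_def)
  fix r
  show "integrable lborel (\<lambda>x. indicator (cball 0 r) x *\<^sub>R g x)"
  proof (rule Bochner_Integration.integrable_bound)
    have "integrable lborel (indicat_real (cball (0::R2) r))"
      by (rule integrable_indicator_cball)
    then show "integrable lborel (\<lambda>x. indicator (cball 0 r) x + (cmod (g x))\<^sup>2)"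
      using g by (simp add: L2_borel_def)
    have "cmod z \<le> 1 + (cmod z)\<^sup>2" for z
    proof (cases "cmod z \<le> 1")
      case False
      then have "cmod z \<le> (cmod z)\<^sup>2" using self_le_power[of "cmod z" 2] by simp
      then show ?thesis by simp
    qed (simp add: add_increasing2)
    then show "AE x in lborel. norm (indicator (cball 0 r) x *\<^sub>R g x) \<le> norm (indicator (cball 0 r) x + (cmod (g x))\<^sup>2)"
      by (auto intro!: AE_I2 simp: indicator_def)
    show "(\<lambda>x. indicator (cball 0 r) x *\<^sub>R g x) \<in> borel_measurable lborel"
      using m by (intro borel_measurable_scaleR borel_measurable_indicator) auto
  qed
qed

lemma mollifier_continuous_compact:
  assumes "0 < e" "e \<le> 1"
  shows "continuous_on UNIV (mollifier e i j)" "\<And>x. norm x > 2 \<Longrightarrow> mollifier e i j x = 0"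
  using continuous_on_mollifier[OF assms(1)] mollifier_eq_0[OF assms(1)] assms(2) by auto

text \<open>The mass is one in either variable: in \<open>y\<close> for averaging, where evenness of
  the mollifier enters, and in \<open>x\<close> for exchanging the order of integration.\<close>

lemma mollifier_translate:
  assumes e: "0 < e" "e \<le> 1"
  shows "integrable lborel (\<lambda>y. mollifier e 0 0 (x - y))" "(LBINT y. mollifier e 0 0 (x - y)) = 1"
    "(\<integral>\<^sup>+x. ennreal (mollifier e 0 0 (x - y)) \<partial>lborel) = 1"
proof -
  have iK: "integrable lborel (mollifier e 0 0)"
    by (rule integrable_lborel_compact_support[OF mollifier_continuous_compact[OF e]])
  have Km[measurable]: "mollifier e 0 0 \<in> borel_measurable borel"
    by (rule borel_measurable_continuous_onI[OF mollifier_continuous_compact(1)[OF e]])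
  have even: "mollifier e 0 0 (- z) = mollifier e 0 0 z" for z by (simp add: mollifier_def bump_def Let_def)
  have eq: "mollifier e 0 0 (x - y) = mollifier e 0 0 (y + (- x))" for x y using even[of "y - x"] by simp
  show "integrable lborel (\<lambda>y. mollifier e 0 0 (x - y))"
    unfolding eq by (rule integrable_lborel_translate[OF Km iK])
  show "(LBINT y. mollifier e 0 0 (x - y)) = 1"
    unfolding eq lborel_integral_translate[OF Km] by (rule integral_mollifier[OF e(1)])
  have i2: "integrable lborel (\<lambda>x. mollifier e 0 0 (x - y))"
    using integrable_lborel_translate[OF Km iK, of "- y"] by simp
  have "(\<integral>\<^sup>+x. ennreal (mollifier e 0 0 (x - y)) \<partial>lborel) = ennreal (LBINT x. mollifier e 0 0 (x - y))"
    by (rule nn_integral_eq_integral[OF i2]) (use mollifier_nonneg[OF e(1)] in auto)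
  also have "(LBINT x. mollifier e 0 0 (x - y)) = 1"
    using lborel_integral_translate[OF Km, of "- y"] integral_mollifier[OF e(1)] by simp
  finally show "(\<integral>\<^sup>+x. ennreal (mollifier e 0 0 (x - y)) \<partial>lborel) = 1" by simp
qed

lemma integrable_mult_mollifier:
  fixes f :: "R2 \<Rightarrow> real"
  assumes e: "0 < e" "e \<le> 1" and f: "integrable lborel f"
  shows "integrable lborel (\<lambda>y. f y * mollifier e 0 0 (x - y))"
proof -
  obtain B where B: "B > 0" "\<And>x. norm (mollifier e 0 0 x) \<le> B"
    using bounded_compact_support[OF mollifier_continuous_compact[OF e]] by blast
  have [measurable]: "mollifier e 0 0 \<in> borel_measurable borel"
    by (rule borel_measurable_continuous_onI[OF mollifier_continuous_compact(1)[OF e]])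
  have [measurable]: "f \<in> borel_measurable borel" using f by (simp add: borel_measurable_integrable)
  show ?thesis
  proof (rule Bochner_Integration.integrable_bound[OF integrable_mult_right[OF integrable_norm[OF f], of B]])
    have "\<bar>f y\<bar> * \<bar>mollifier e 0 0 (x - y)\<bar> \<le> \<bar>f y\<bar> * B" for y
      using B(2)[of "x - y"] by (intro mult_left_mono) auto
    then show "AE y in lborel. norm (f y * mollifier e 0 0 (x - y)) \<le> norm (B * norm (f y))"
      using B(1) by (auto intro!: AE_I2 simp: abs_mult mult.commute)
  qed measurable
qed

text \<open>Jensen's inequality, from the nonnegativity of the variance.\<close>
lemma convol_sq_le:
  assumes e: "0 < e" "e \<le> 1" and g: "L2_borel g"
  shows "(cmod (convol g (mollifier e 0 0) x))\<^sup>2 \<le> (LBINT y. (cmod (g y))\<^sup>2 * mollifier e 0 0 (x - y))"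
proof -
  let ?K = "\<lambda>y. mollifier e 0 0 (x - y)"
  define m where "m = convol g (mollifier e 0 0) x"
  have i1: "integrable lborel (\<lambda>y. (cmod (g y))\<^sup>2 * ?K y)"
    using g by (intro integrable_mult_mollifier[OF e]) (simp add: L2_borel_def)
  have i2: "integrable lborel (\<lambda>y. g y * of_real (?K y))"
    by (rule convol_integrable[OF L2_borel_loc_integrable[OF g] mollifier_continuous_compact[OF e]])
  have i2': "integrable lborel (\<lambda>y. Re (g y * of_real (?K y) * cnj m))"
    by (intro integrable_Re integrable_mult_left i2)
  have i3: "integrable lborel (\<lambda>y. (cmod m)\<^sup>2 * ?K y)" by (intro integrable_mult_right mollifier_translate[OF e])
  have eq: "(cmod (g y - m))\<^sup>2 * ?K y = (cmod (g y))\<^sup>2 * ?K y - 2 * Re (g y * of_real (?K y) * cnj m) + (cmod m)\<^sup>2 * ?K y" for y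
    unfolding cmod_power2 by (simp add: power2_eq_square algebra_simps)
  have "0 \<le> (LBINT y. (cmod (g y - m))\<^sup>2 * ?K y)"
    by (rule Bochner_Integration.integral_nonneg) (simp add: mollifier_nonneg[OF e(1)])
  also have "\<dots> = (LBINT y. (cmod (g y))\<^sup>2 * ?K y) - 2 * (LBINT y. Re (g y * of_real (?K y) * cnj m)) + (LBINT y. (cmod m)\<^sup>2 * ?K y)"
    unfolding eq
    by (simp only: Bochner_Integration.integral_add[OF Bochner_Integration.integrable_diff[OF i1 integrable_mult_right[OF i2']] i3]
        Bochner_Integration.integral_diff[OF i1 integrable_mult_right[OF i2']] integral_mult_right_zero)
  also have "(LBINT y. Re (g y * of_real (?K y) * cnj m)) = Re (m * cnj m)"
    using i2 by (simp only: integral_Re[OF integrable_mult_left[OF i2]] integral_mult_left_zero m_def convol_def)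
  also have "(LBINT y. (cmod m)\<^sup>2 * ?K y) = (cmod m)\<^sup>2"
    using mollifier_translate(2)[OF e] by simp
  also have "Re (m * cnj m) = (cmod m)\<^sup>2" unfolding cmod_power2 by (simp add: power2_eq_square)
  finally show ?thesis by (simp add: m_def)
qed

text \<open>Integrate \<open>convol_sq_le\<close> in \<open>x\<close> and exchange the integrals;
  the kernel has mass one in \<open>x\<close> as well. Working with nonnegative integrals, this
  yields integrability together with the bound.\<close>

lemma L2_borel_convol:
  assumes e: "0 < e" "e \<le> 1" and g: "L2_borel g"
  shows "L2_borel (convol g (mollifier e 0 0))" "L2_sq (convol g (mollifier e 0 0)) \<le> L2_sq g"
proof -
  have [measurable]: "g \<in> borel_measurable borel" using g by (simp add: L2_borel_def)
  have [measurable]: "mollifier e 0 0 \<in> borel_measurable borel"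
    by (rule borel_measurable_continuous_onI[OF mollifier_continuous_compact(1)[OF e]])
  have cc: "continuous_on UNIV (convol g (mollifier e 0 0))"
    by (rule continuous_on_convol[OF L2_borel_loc_integrable[OF g] mollifier_continuous_compact[OF e]])
  then have cm[measurable]: "convol g (mollifier e 0 0) \<in> borel_measurable borel" by (rule borel_measurable_continuous_onI)
  have "(\<integral>\<^sup>+x. ennreal ((cmod (convol g (mollifier e 0 0) x))\<^sup>2) \<partial>lborel) \<le> (\<integral>\<^sup>+x. \<integral>\<^sup>+y. ennreal ((cmod (g y))\<^sup>2 * mollifier e 0 0 (x - y)) \<partial>lborel \<partial>lborel)"
  proof (rule nn_integral_mono)
    fix x
    have "(\<integral>\<^sup>+y. ennreal ((cmod (g y))\<^sup>2 * mollifier e 0 0 (x - y)) \<partial>lborel) = ennreal (LBINT y. (cmod (g y))\<^sup>2 * mollifier e 0 0 (x - y))"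
      using g mollifier_nonneg[OF e(1)] by (intro nn_integral_eq_integral integrable_mult_mollifier[OF e]) (auto simp: L2_borel_def)
    then show "ennreal ((cmod (convol g (mollifier e 0 0) x))\<^sup>2) \<le> (\<integral>\<^sup>+y. ennreal ((cmod (g y))\<^sup>2 * mollifier e 0 0 (x - y)) \<partial>lborel)"
      using convol_sq_le[OF e g, of x] by (simp add: ennreal_leI)
  qed
  also have "\<dots> = (\<integral>\<^sup>+y. \<integral>\<^sup>+x. ennreal ((cmod (g y))\<^sup>2 * mollifier e 0 0 (x - y)) \<partial>lborel \<partial>lborel)"
    by (rule lborel_pair.Fubini') measurable
  also have "\<dots> = (\<integral>\<^sup>+y. ennreal ((cmod (g y))\<^sup>2) \<partial>lborel)"
  proof (rule nn_integral_cong)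
    fix y
    show "(\<integral>\<^sup>+x. ennreal ((cmod (g y))\<^sup>2 * mollifier e 0 0 (x - y)) \<partial>lborel) = ennreal ((cmod (g y))\<^sup>2)"
      using mollifier_translate(3)[OF e, of y] mollifier_nonneg[OF e(1)] by (simp add: ennreal_mult nn_integral_cmult)
  qed
  also have "\<dots> = ennreal (L2_sq g)"
    unfolding L2_sq_def using g by (intro nn_integral_eq_integral) (auto simp: L2_borel_def)
  finally have b: "(\<integral>\<^sup>+x. ennreal ((cmod (convol g (mollifier e 0 0) x))\<^sup>2) \<partial>lborel) \<le> ennreal (L2_sq g)" .
  have i: "integrable lborel (\<lambda>x. (cmod (convol g (mollifier e 0 0) x))\<^sup>2)"
    by (rule integrableI_bounded) (use b in \<open>auto simp: less_top[symmetric] top_unique intro: le_less_trans\<close>)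
  then show "L2_borel (convol g (mollifier e 0 0))" by (simp add: L2_borel_def)
  have "ennreal (L2_sq (convol g (mollifier e 0 0))) \<le> ennreal (L2_sq g)"
    using b nn_integral_eq_integral[OF i] by (simp add: L2_sq_def)
  then show "L2_sq (convol g (mollifier e 0 0)) \<le> L2_sq g" using L2_sq_nonneg by (simp add: ennreal_le_iff)
qed

lemma L2_borel_truncate:
  assumes g: "L2_borel g" and \<delta>: "\<delta> > 0"
  obtains N where "N > 0" "L2_sq (\<lambda>x. g x - (if cmod (g x) \<le> real N \<and> norm x \<le> real N then g x else 0)) < \<delta>"
proof -
  let ?t = "\<lambda>(N::nat) x. g x - (if cmod (g x) \<le> real N \<and> norm x \<le> real N then g x else 0)"
  have [measurable]: "g \<in> borel_measurable borel" using g by (simp add: L2_borel_def)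
  have "(\<lambda>N. LBINT x. (cmod (?t N x))\<^sup>2) \<longlonglongrightarrow> (\<integral>x. 0 \<partial>(lborel :: R2 measure))"
  proof (rule integral_dominated_convergence[where w="\<lambda>x. (cmod (g x))\<^sup>2"])
    show "AE x in lborel. (\<lambda>N. (cmod (?t N x))\<^sup>2) \<longlonglongrightarrow> 0"
    proof (rule AE_I2, rule tendsto_eventually)
      fix x
      obtain N0 :: nat where N0: "max (cmod (g x)) (norm x) \<le> real N0" using real_arch_simple by blast
      show "\<forall>\<^sub>F N in sequentially. (cmod (?t N x))\<^sup>2 = 0"
        using eventually_ge_at_top[of N0]
      proof eventually_elim
        case (elim N)
        then have "real N0 \<le> real N" by simp
        with N0 have "cmod (g x) \<le> real N" "norm x \<le> real N" by linarith+
        then show ?case by simp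
      qed
    qed
  qed (use g in \<open>auto simp: L2_borel_def intro!: AE_I2\<close>)
  then have "\<forall>\<^sub>F N in sequentially. L2_sq (?t N) < \<delta>"
    using \<delta> unfolding L2_sq_def by (intro order_tendstoD(2)) auto
  then have "\<forall>\<^sub>F N in sequentially. L2_sq (?t N) < \<delta> \<and> N > 0"
    using eventually_gt_at_top[of 0] by (rule eventually_conj)
  then obtain N where "L2_sq (?t N) < \<delta>" "N > 0" by (auto simp: eventually_sequentially)
  then show ?thesis using that by blast
qed

text \<open>A measurable function is an almost everywhere limit of continuous ones, which may be
  unbounded and spread out. Composing with \<open>cl\<close>, the radial retraction onto the disc of
  radius \<open>N\<close>, and multiplying by the cutoff \<open>\<zeta>\<close> cures both without
  changing the limit, because \<open>g\<close> has been truncated first. Dominated convergence then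
  gives mean square closeness.\<close>

lemma L2_borel_approx_continuous:
  assumes g: "L2_borel g" and \<delta>: "\<delta> > 0"
  obtains c M where "continuous_on UNIV c" "\<And>x. norm x > M \<Longrightarrow> c x = 0" "L2_sq (\<lambda>x. g x - c x) < \<delta>"
proof -
  have \<delta>4: "\<delta> / 4 > 0" using \<delta> by simp
  obtain N :: nat where N: "N > 0"
    "L2_sq (\<lambda>x. g x - (if cmod (g x) \<le> real N \<and> norm x \<le> real N then g x else 0)) < \<delta> / 4"
    using L2_borel_truncate[OF g \<delta>4] by blast
  define gN where "gN x = (if cmod (g x) \<le> real N \<and> norm x \<le> real N then g x else 0)" for x
  have [measurable]: "g \<in> borel_measurable borel" using g by (simp add: L2_borel_def)
  have m[measurable]: "gN \<in> borel_measurable borel" unfolding gN_def by measurable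
  have gN2: "L2_borel gN"
    by (rule L2_borel_bound[OF m, of "\<lambda>x. (cmod (g x))\<^sup>2"]) (use g in \<open>auto simp: L2_borel_def gN_def\<close>)
  have "gN \<in> borel_measurable lebesgue" by (rule measurable_completion) simp
  from lebesgue_measurable_imp_measurable_on[OF this, of UNIV] obtain Z f where Z: "negligible Z" and f: "\<And>n. continuous_on UNIV (f n)" and lim: "\<And>x. x \<notin> Z \<Longrightarrow> (\<lambda>n. f n x) \<longlonglongrightarrow> gN x"
    unfolding measurable_on_def by auto
  define cl where "cl z = z / of_real (max 1 (cmod z / N))" for z :: complex
  define \<zeta> where "\<zeta> x = max 0 (min 1 (real N + 1 - norm x))" for x :: R2
  have mx: "max 1 (cmod z / N) \<noteq> 0" "max 1 (cmod z / N) > 0" for z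
    using less_le_trans[OF zero_less_one max.cobounded1[of 1 "cmod z / N"]] by simp_all
  have ccl: "continuous_on A cl" for A
    unfolding cl_def by (intro continuous_intros) (use N mx in auto)
  have clb: "cmod (cl z) \<le> N" for z
  proof -
    have "cmod (cl z) = cmod z / max 1 (cmod z / N)" unfolding cl_def norm_divide norm_of_real using mx(2)[of z] by simp
    moreover have "cmod z \<le> N * max 1 (cmod z / N)" using N(1) by (simp add: max_def)
    ultimately show ?thesis using mx(2)[of z] by (simp add: pos_divide_le_eq)
  qed
  have cli: "cl z = z" if "cmod z \<le> N" for z
  proof -
    have "max 1 (cmod z / N) = 1" using that N(1) by (simp add: max_def)
    then show ?thesis by (simp add: cl_def)
  qed
  define d where "d n x = of_real (\<zeta> x) * cl (f n x)" for n x
  have c\<zeta>: "continuous_on UNIV \<zeta>" unfolding \<zeta>_def by (intro continuous_intros)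
  have cd: "continuous_on UNIV (d n)" for n
    unfolding d_def by (intro continuous_intros c\<zeta> continuous_on_compose2[OF ccl[of UNIV] f]) auto
  have ds: "d n x = 0" if "norm x > real N + 1" for n x using that by (simp add: d_def \<zeta>_def)
  have [measurable]: "d n \<in> borel_measurable borel" for n using cd by (rule borel_measurable_continuous_onI)
  have "(\<lambda>n. LBINT x. (cmod (gN x - d n x))\<^sup>2) \<longlonglongrightarrow> (\<integral>x. 0 \<partial>(lborel :: R2 measure))"
  proof (rule integral_dominated_convergence[where w="\<lambda>x. (2 * real N)\<^sup>2 * indicator (cball 0 (real N + 1)) x"])
    show "integrable lborel (\<lambda>x. (2 * real N)\<^sup>2 * indicat_real (cball (0::R2) (real N + 1)) x)"
      by (intro integrable_mult_right integrable_indicator_cball)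
    have "AE x in lebesgue. x \<notin> Z" using Z by (simp add: negligible_iff_null_sets AE_not_in)
    then have "AE x in lborel. x \<notin> Z" by (simp add: AE_completion_iff)
    then show "AE x in lborel. (\<lambda>n. (cmod (gN x - d n x))\<^sup>2) \<longlonglongrightarrow> 0"
    proof eventually_elim
      case (elim x)
      have "isCont cl (gN x)" using ccl[of UNIV] by (simp add: continuous_on_eq_continuous_at)
      then have "(\<lambda>n. cl (f n x)) \<longlonglongrightarrow> cl (gN x)" using lim[OF elim] by (rule isCont_tendsto_compose)
      then have "(\<lambda>n. (cmod (gN x - d n x))\<^sup>2) \<longlonglongrightarrow> (cmod (gN x - of_real (\<zeta> x) * cl (gN x)))\<^sup>2"
        unfolding d_def by (intro tendsto_intros)
      moreover have "of_real (\<zeta> x) * cl (gN x) = gN x"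
      proof (cases "gN x = 0")
        case False
        then have "cmod (gN x) \<le> N" "norm x \<le> N" by (auto simp: gN_def split: if_splits)
        then show ?thesis by (simp add: cli \<zeta>_def)
      qed (simp add: cl_def)
      ultimately show ?case by simp
    qed
    fix n
    show "AE x in lborel. norm ((cmod (gN x - d n x))\<^sup>2) \<le> (2 * real N)\<^sup>2 * indicator (cball 0 (real N + 1)) x"
    proof (rule AE_I2)
      fix x
      show "norm ((cmod (gN x - d n x))\<^sup>2) \<le> (2 * real N)\<^sup>2 * indicator (cball 0 (real N + 1)) x"
      proof (cases "norm x \<le> real N + 1")
        case True
        have "cmod (d n x) = \<zeta> x * cmod (cl (f n x))" by (simp add: d_def norm_mult \<zeta>_def)
        also have "\<dots> \<le> 1 * real N" by (intro mult_mono clb) (auto simp: \<zeta>_def)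
        finally have "cmod (d n x) \<le> N" by simp
        moreover have "cmod (gN x) \<le> N" by (simp add: gN_def)
        ultimately have "cmod (gN x - d n x) \<le> 2 * N" using norm_triangle_ineq4[of "gN x" "d n x"] by linarith
        then have "(cmod (gN x - d n x))\<^sup>2 \<le> (2 * real N)\<^sup>2" by (intro power_mono) auto
        then show ?thesis using True by simp
      next
        case False
        then show ?thesis using ds[of x n] by (simp add: gN_def)
      qed
    qed
  qed measurable
  then have "\<forall>\<^sub>F n in sequentially. L2_sq (\<lambda>x. gN x - d n x) < \<delta> / 4"
    using \<delta>4 unfolding L2_sq_def by (intro order_tendstoD(2)) auto
  then obtain n where n: "L2_sq (\<lambda>x. gN x - d n x) < \<delta> / 4" by (auto simp: eventually_sequentially)
  have d2: "L2_borel (d n)" by (rule L2_borel_continuous[OF cd ds])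
  have "L2_sq (\<lambda>x. g x - d n x) = L2_sq (\<lambda>x. (g x - gN x) + (gN x - d n x))" by simp
  also have "\<dots> \<le> 2 * L2_sq (\<lambda>x. g x - gN x) + 2 * L2_sq (\<lambda>x. gN x - d n x)"
    by (rule L2_borel_add(2)[OF L2_borel_diff(1)[OF g gN2] L2_borel_diff(1)[OF gN2 d2]])
  also have "\<dots> < \<delta>" using N(2) n by (simp add: gN_def)
  finally show ?thesis using that[OF cd ds] by blast
qed

lemma convol_continuous_approx:
  assumes c: "continuous_on UNIV c" "\<And>x. norm x > M \<Longrightarrow> c x = 0" and \<delta>: "\<delta> > 0"
  obtains e0 where "e0 > 0" "e0 \<le> 1" "\<And>e. 0 < e \<Longrightarrow> e \<le> e0 \<Longrightarrow> L2_sq (\<lambda>x. convol c (mollifier e 0 0) x - c x) < \<delta>"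
proof -
  define V where "V = measure lborel (cball (0::R2) (M + 2))"
  have V: "V \<ge> 0" by (simp add: V_def)
  \<comment> \<open>A uniform error \<open>\<eta>\<close> on a disc of area \<open>V\<close> costs
    \<open>\<eta>\<^sup>2 * V\<close>; using \<open>V + 1\<close> avoids a zero denominator.\<close>
  define \<eta> where "\<eta> = sqrt (\<delta> / (2 * (V + 1)))"
  have \<eta>: "\<eta> > 0" "\<eta>\<^sup>2 * V < \<delta>"
  proof -
    show "\<eta> > 0" using \<delta> V by (simp add: \<eta>_def)
    have "\<eta>\<^sup>2 = \<delta> / (2 * (V + 1))" using \<delta> V by (simp add: \<eta>_def)
    then have "\<eta>\<^sup>2 * V = \<delta> * (V / (2 * (V + 1)))" by simp
    also have "\<dots> < \<delta> * 1" using \<delta> V by (intro mult_strict_left_mono) (auto simp: field_simps)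
    finally show "\<eta>\<^sup>2 * V < \<delta>" by simp
  qed
  have "uniformly_continuous_on (cball 0 (M + 4)) c"
    by (rule compact_uniformly_continuous[OF continuous_on_subset[OF c(1)]]) auto
  then obtain t where t: "t > 0" "\<And>x x'. x \<in> cball 0 (M + 4) \<Longrightarrow> x' \<in> cball 0 (M + 4) \<Longrightarrow> dist x' x < t \<Longrightarrow> dist (c x') (c x) < \<eta>"
    using \<eta>(1) unfolding uniformly_continuous_on_def by metis
  show ?thesis
  \<comment> \<open>The kernel reaches as far as \<open>2 * e\<close>, which for
    \<open>e \<le> t / 3\<close> is below the modulus of continuity \<open>t\<close>.\<close>
  proof (rule that[of "min 1 (t / 3)"])
    fix e :: real assume e: "0 < e" "e \<le> min 1 (t / 3)"
    then have e': "0 < e" "e \<le> 1" "2 * e < t" by auto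
    have cl: "L2_borel c" by (rule L2_borel_continuous[OF c])
    have zero: "convol c (mollifier e 0 0) x - c x = 0" if "norm x > M + 2" for x
    proof -
      have "c y * of_real (mollifier e 0 0 (x - y)) = 0" for y
      proof (cases "norm y > M")
        case False
        then have "norm (x - y) > 2" using norm_triangle_ineq2[of x y] that by linarith
        then show ?thesis using mollifier_continuous_compact(2)[OF e'(1,2)] by simp
      qed (simp add: c)
      then have "convol c (mollifier e 0 0) x = 0" unfolding convol_def by (simp only: Bochner_Integration.integral_zero)
      then show ?thesis using c(2)[of x] that by simp
    qed
    have near: "cmod (convol c (mollifier e 0 0) x - c x) \<le> \<eta>" if x: "norm x \<le> M + 2" for x
    proof -
      have i: "integrable lborel (\<lambda>y. c y * of_real (mollifier e 0 0 (x - y)))"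
        by (rule convol_integrable[OF L2_borel_loc_integrable[OF cl] mollifier_continuous_compact[OF e'(1,2)]])
      have iK: "integrable lborel (\<lambda>y. c x * of_real (mollifier e 0 0 (x - y)))"
        using mollifier_translate(1)[OF e'(1,2)] by (intro integrable_mult_right) simp
      have "c x = (LBINT y. c x * of_real (mollifier e 0 0 (x - y)))"
        using mollifier_translate(2)[OF e'(1,2), of x] by (simp only: integral_mult_right_zero integral_complex_of_real) simp
      then have "convol c (mollifier e 0 0) x - c x = (LBINT y. c y * of_real (mollifier e 0 0 (x - y)) - c x * of_real (mollifier e 0 0 (x - y)))"
        unfolding Bochner_Integration.integral_diff[OF i iK] by (simp add: convol_def)
      also have "cmod \<dots> \<le> (LBINT y. cmod (c y * of_real (mollifier e 0 0 (x - y)) - c x * of_real (mollifier e 0 0 (x - y))))"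
        by (rule integral_norm_bound)
      also have "\<dots> \<le> (LBINT y. \<eta> * mollifier e 0 0 (x - y))"
      proof (rule Bochner_Integration.integral_mono)
        show "integrable lborel (\<lambda>y. cmod (c y * of_real (mollifier e 0 0 (x - y)) - c x * of_real (mollifier e 0 0 (x - y))))"
          by (intro integrable_norm Bochner_Integration.integrable_diff i iK)
        show "integrable lborel (\<lambda>y. \<eta> * mollifier e 0 0 (x - y))" by (intro integrable_mult_right mollifier_translate(1)[OF e'(1,2)])
        fix y
        have "cmod (c y - c x) * mollifier e 0 0 (x - y) \<le> \<eta> * mollifier e 0 0 (x - y)"
        proof (cases "norm (x - y) > 2 * e")
          case True
          then show ?thesis using mollifier_eq_0[OF e'(1)] by simp
        next
          case False
          then have "dist y x < t" using e'(3) by (simp add: dist_norm norm_minus_commute)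
          moreover have "norm y \<le> M + 4" using False e'(2) x norm_triangle_ineq2[of y x] by (simp add: norm_minus_commute)
          ultimately have "dist (c y) (c x) < \<eta>" using x by (intro t) auto
          then show ?thesis using mollifier_nonneg[OF e'(1)] by (intro mult_right_mono) (auto simp: dist_norm)
        qed
        then show "cmod (c y * of_real (mollifier e 0 0 (x - y)) - c x * of_real (mollifier e 0 0 (x - y))) \<le> \<eta> * mollifier e 0 0 (x - y)"
          using mollifier_nonneg[OF e'(1)] by (simp only: left_diff_distrib[symmetric] norm_mult norm_of_real abs_of_nonneg)
      qed
      also have "\<dots> = \<eta>" using mollifier_translate(2)[OF e'(1,2)] by simp
      finally show ?thesis .
    qed
    have pw: "(cmod (convol c (mollifier e 0 0) x - c x))\<^sup>2 \<le> \<eta>\<^sup>2 * indicator (cball 0 (M + 2)) x" for x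
    proof (cases "norm x \<le> M + 2")
      case True
      then show ?thesis using power_mono[OF near[OF True], of 2] by simp
    next
      case False
      then show ?thesis using zero[of x] by simp
    qed
    have ii: "integrable lborel (\<lambda>x. \<eta>\<^sup>2 * indicat_real (cball (0::R2) (M + 2)) x)"
      by (intro integrable_mult_right integrable_indicator_cball)
    have L: "L2_borel (\<lambda>x. convol c (mollifier e 0 0) x - c x)" by (rule L2_borel_diff(1)[OF L2_borel_convol(1)[OF e'(1,2) cl] cl])
    have "L2_sq (\<lambda>x. convol c (mollifier e 0 0) x - c x) \<le> (LBINT x. \<eta>\<^sup>2 * indicat_real (cball (0::R2) (M + 2)) x)"
      unfolding L2_sq_def by (intro Bochner_Integration.integral_mono ii pw) (use L in \<open>simp add: L2_borel_def\<close>)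
    also have "\<dots> = \<eta>\<^sup>2 * V" by (simp add: V_def)
    finally show "L2_sq (\<lambda>x. convol c (mollifier e 0 0) x - c x) < \<delta>" using \<eta>(2) by linarith
  qed (use t in auto)
qed

text \<open>A density argument: mollification does not increase the mean square norm, so the error
  of replacing \<open>g\<close> by a continuous \<open>c\<close> is as small after mollification as
  before.\<close>

lemma convol_L2_approx:
  assumes g: "L2_borel g" and \<delta>: "\<delta> > 0"
  obtains e0 where "e0 > 0" "e0 \<le> 1" "\<And>e. 0 < e \<Longrightarrow> e \<le> e0 \<Longrightarrow> L2_sq (\<lambda>x. convol g (mollifier e 0 0) x - g x) < \<delta>"
proof -
  \<comment> \<open>Two applications of the doubled triangle inequality to three errors give at most
    10/12 of \<open>\<delta>\<close>.\<close>
  have d: "\<delta> / 12 > 0" "\<delta> / 4 > 0" using \<delta> by auto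
  obtain c M where c: "continuous_on UNIV c" "\<And>x. norm x > M \<Longrightarrow> c x = 0" and gc: "L2_sq (\<lambda>x. g x - c x) < \<delta> / 12"
    using L2_borel_approx_continuous[OF g d(1)] by metis
  obtain e0 where e0: "e0 > 0" "e0 \<le> 1" "\<And>e. 0 < e \<Longrightarrow> e \<le> e0 \<Longrightarrow> L2_sq (\<lambda>x. convol c (mollifier e 0 0) x - c x) < \<delta> / 12"
    using convol_continuous_approx[OF c d(1)] by metis
  have cl: "L2_borel c" by (rule L2_borel_continuous[OF c])
  have gl: "L2_borel (\<lambda>x. g x - c x)" by (rule L2_borel_diff(1)[OF g cl])
  show ?thesis
  proof (rule that[OF e0(1,2)])
    fix e assume e: "0 < e" "e \<le> e0"
    then have e1: "0 < e" "e \<le> 1" using e0 by auto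
    have eq: "convol g (mollifier e 0 0) x = convol (\<lambda>x. g x - c x) (mollifier e 0 0) x + 1 * convol c (mollifier e 0 0) x" for x
      using convol_add[OF L2_borel_loc_integrable[OF gl] L2_borel_loc_integrable[OF cl] mollifier_continuous_compact[OF e1], of 1 0 0 x] by simp
    have "L2_sq (\<lambda>x. convol g (mollifier e 0 0) x - g x) = L2_sq (\<lambda>x. (convol (\<lambda>x. g x - c x) (mollifier e 0 0) x + (convol c (mollifier e 0 0) x - c x)) + (c x - g x))"
      by (rule arg_cong[where f=L2_sq]) (simp add: fun_eq_iff eq)
    also have "\<dots> \<le> 2 * L2_sq (\<lambda>x. convol (\<lambda>x. g x - c x) (mollifier e 0 0) x + (convol c (mollifier e 0 0) x - c x)) + 2 * L2_sq (\<lambda>x. c x - g x)"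
      by (intro L2_borel_add L2_borel_diff L2_borel_convol e1 gl cl g)
    also have "\<dots> \<le> 2 * (2 * L2_sq (convol (\<lambda>x. g x - c x) (mollifier e 0 0)) + 2 * L2_sq (\<lambda>x. convol c (mollifier e 0 0) x - c x)) + 2 * L2_sq (\<lambda>x. c x - g x)"
      by (intro add_right_mono mult_left_mono L2_borel_add L2_borel_diff L2_borel_convol e1 gl cl) simp
    also have "\<dots> < \<delta>"
    proof -
      have *: "2 * (2 * p + 2 * q) + 2 * r < \<delta>" if "p \<le> r'" "r' < \<delta> / 12" "q < \<delta> / 12" "r = r'" for p q r r' :: real
        using that \<delta> by simp
      show ?thesis by (rule *[OF L2_borel_convol(2)[OF e1 gl] gc e0(3)[OF e] L2_sq_diff_commute])
    qed
    finally show "L2_sq (\<lambda>x. convol g (mollifier e 0 0) x - g x) < \<delta>" .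
  qed
qed

lemma integrable_L2_borel_mult:
  assumes f: "L2_borel f" and g: "L2_borel g"
  shows "integrable lborel (\<lambda>x. f x * cnj (g x))"
proof (rule Bochner_Integration.integrable_bound)
  show "integrable lborel (\<lambda>x. (cmod (f x))\<^sup>2 + (cmod (g x))\<^sup>2)" using f g by (simp add: L2_borel_def)
  have [measurable]: "f \<in> borel_measurable borel" "g \<in> borel_measurable borel" using f g by (auto simp: L2_borel_def)
  have [measurable]: "cnj \<in> borel_measurable borel"
    by (intro borel_measurable_continuous_onI continuous_intros)
  show "(\<lambda>x. f x * cnj (g x)) \<in> borel_measurable lborel" by measurable
  have "cmod a * cmod b \<le> (cmod a)\<^sup>2 + (cmod b)\<^sup>2" for a b
  proof -
    have "0 \<le> cmod a * cmod b" by simp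
    then show ?thesis using sum_squares_bound[of "cmod a" "cmod b"] unfolding mult.assoc by linarith
  qed
  then show "AE x in lborel. norm (f x * cnj (g x)) \<le> norm ((cmod (f x))\<^sup>2 + (cmod (g x))\<^sup>2)"
    by (auto intro!: AE_I2 simp: norm_mult)
qed

text \<open>The difference of the products is (f - f') times the conjugate of g plus f' times the
  conjugate of g - g'. Young's inequality puts \<open>\<eta>\<close> on the norms, which stay
  bounded, and its reciprocal on the differences, which tend to zero.\<close>

lemma L2_borel_mult_diff_bound:
  assumes L: "L2_borel f" "L2_borel f'" "L2_borel g" "L2_borel g'" and \<eta>: "\<eta> > 0"
  shows "cmod ((LBINT x. f x * cnj (g x)) - (LBINT x. f' x * cnj (g' x)))
     \<le> L2_sq (\<lambda>x. f x - f' x) / (4 * \<eta>) + \<eta> * L2_sq g + L2_sq (\<lambda>x. g x - g' x) / (4 * \<eta>) + \<eta> * L2_sq f'"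
proof -
  note d = L2_borel_diff(1)[OF L(1,2)] L2_borel_diff(1)[OF L(3,4)]
  have "(LBINT x. f x * cnj (g x)) - (LBINT x. f' x * cnj (g' x)) =
      (LBINT x. f x * cnj (g x) - f' x * cnj (g' x))"
    using L by (simp add: integrable_L2_borel_mult)
  also have "cmod \<dots> \<le> (LBINT x. cmod (f x * cnj (g x) - f' x * cnj (g' x)))"
    by (rule integral_norm_bound)
  also have "\<dots> \<le> (LBINT x. (cmod (f x - f' x))\<^sup>2 / (4 * \<eta>) + \<eta> * (cmod (g x))\<^sup>2 + (cmod (g x - g' x))\<^sup>2 / (4 * \<eta>) + \<eta> * (cmod (f' x))\<^sup>2)"
  proof (rule Bochner_Integration.integral_mono)
    show "integrable lborel (\<lambda>x. cmod (f x * cnj (g x) - f' x * cnj (g' x)))"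
      using L by (intro integrable_norm Bochner_Integration.integrable_diff integrable_L2_borel_mult)
    show "integrable lborel (\<lambda>x. (cmod (f x - f' x))\<^sup>2 / (4 * \<eta>) + \<eta> * (cmod (g x))\<^sup>2 + (cmod (g x - g' x))\<^sup>2 / (4 * \<eta>) + \<eta> * (cmod (f' x))\<^sup>2)"
      using L d by (simp add: L2_borel_def)
    fix x
    have "f x * cnj (g x) - f' x * cnj (g' x) = (f x - f' x) * cnj (g x) + f' x * cnj (g x - g' x)"
      by (simp add: algebra_simps)
    then have "cmod (f x * cnj (g x) - f' x * cnj (g' x)) \<le> cmod (g x) * cmod (f x - f' x) + cmod (f' x) * cmod (g x - g' x)"
      using norm_triangle_ineq[of "(f x - f' x) * cnj (g x)" "f' x * cnj (g x - g' x)"]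
      by (simp add: norm_mult mult.commute del: complex_cnj_diff)
    also have "\<dots> \<le> (\<eta> * (cmod (g x))\<^sup>2 + (cmod (f x - f' x))\<^sup>2 / (4 * \<eta>)) + (\<eta> * (cmod (f' x))\<^sup>2 + (cmod (g x - g' x))\<^sup>2 / (4 * \<eta>))"
      using young_mult[OF \<eta>, of "cmod (g x)" "cmod (f x - f' x)"] young_mult[OF \<eta>, of "cmod (f' x)" "cmod (g x - g' x)"]
      by linarith
    finally show "cmod (f x * cnj (g x) - f' x * cnj (g' x)) \<le> (cmod (f x - f' x))\<^sup>2 / (4 * \<eta>) + \<eta> * (cmod (g x))\<^sup>2 + (cmod (g x - g' x))\<^sup>2 / (4 * \<eta>) + \<eta> * (cmod (f' x))\<^sup>2"
      by linarith
  qed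
  also have "\<dots> = L2_sq (\<lambda>x. f x - f' x) / (4 * \<eta>) + \<eta> * L2_sq g + L2_sq (\<lambda>x. g x - g' x) / (4 * \<eta>) + \<eta> * L2_sq f'"
    using L d by (simp add: L2_borel_def L2_sq_def)
  finally show ?thesis .
qed

subsection \<open>Coercivity\<close>

text \<open>Lets a function that is only locally square integrable be replaced by a truncation, to
  which the mean square convergence results apply.\<close>

lemma convol_local:
  assumes e: "0 < e" "e \<le> 1" and x: "norm x \<le> r" and W: "\<And>y. norm y \<le> r + 2 \<Longrightarrow> W y = w y"
  shows "convol w (mollifier e i j) x = convol W (mollifier e i j) x"
proof -
  have "w y * of_real (mollifier e i j (x - y)) = W y * of_real (mollifier e i j (x - y))" for y
  proof (cases "norm (x - y) > 2")
    case True
    then show ?thesis using mollifier_continuous_compact(2)[OF e] by simp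
  next
    case False
    then have "norm y \<le> r + 2" using norm_triangle_ineq2[of y x] x by (simp add: norm_minus_commute)
    then show ?thesis by (simp add: W)
  qed
  then show ?thesis unfolding convol_def by (rule Bochner_Integration.integral_cong[OF refl])
qed

lemma loc_integrable_of_L2_borel:
  assumes "\<And>r. L2_borel (\<lambda>x. indicator (cball 0 r) x * w x)" "w \<in> borel_measurable borel"
  shows "loc_integrable w"
  unfolding loc_integrable_def
proof (intro conjI allI assms(2))
  fix r
  have "integrable lborel (\<lambda>x. indicator (cball 0 r) x *\<^sub>R (indicator (cball 0 r) x * w x))"
    using L2_borel_loc_integrable[OF assms(1)[of r]] by (simp add: loc_integrable_def)
  moreover have "(\<lambda>x. indicator (cball 0 r) x *\<^sub>R (indicator (cball 0 r) x * w x)) = (\<lambda>x. indicator (cball 0 r) x *\<^sub>R w x)"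
    by (auto simp: fun_eq_iff indicator_def)
  ultimately show "integrable lborel (\<lambda>x. indicator (cball 0 r) x *\<^sub>R w x)" by simp
qed

text \<open>The mollification parameter is sent to zero in \<open>mollified_estimates\<close>:
  pairing and local norm are continuous in mean square. The factor 2 in the second bound is that of
  \<open>cmod_add_sq\<close>.\<close>

lemma limit_estimates:
  fixes w L F v g1 g2 :: "R2 \<Rightarrow> complex"
  assumes k: "k > 0" and wm: "w \<in> borel_measurable borel" and w: "\<And>r. L2_borel (\<lambda>x. indicator (cball 0 r) x * w x)"
    and L: "loc_integrable L" and F: "L2_borel F"
    and ae: "AE x in lborel. norm x > R \<longrightarrow> w x = v x" and R: "R > 0"
    and v: "\<And>x. norm x > R \<Longrightarrow> grad_at v g1 g2 x"
    and g: "continuous_on {x. norm x > R} g1" "continuous_on {x. norm x > R} g2"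
    and sommerfeld: "sommerfeld k v g1 g2"
    and wL: "\<And>e x i j. 0 < e \<Longrightarrow> e \<le> 1 \<Longrightarrow> i + j \<le> 1 \<Longrightarrow> convol w (mollifier e (i + 2) j) x + convol w (mollifier e i (j + 2)) x = convol L (mollifier e i j) x"
    and LF: "\<And>e x. 0 < e \<Longrightarrow> e \<le> 1 \<Longrightarrow> convol L (mollifier e 2 0) x + convol L (mollifier e 0 2) x = of_real (k^4) * convol w (mollifier e 0 0) x + convol F (mollifier e 0 0) x"
    and Fs: "\<And>x. norm x > R0 \<Longrightarrow> F x = 0" and R0: "R0 \<ge> 0"
  shows "Im (LBINT x. F x * cnj (w x)) \<le> 0"
    and "L2_sq (\<lambda>x. indicator (cball 0 R0) x * w x) \<le> 2 * total_const k (R0 + 2) * L2_sq F"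
proof -
  have wI: "loc_integrable w" by (rule loc_integrable_of_L2_borel[OF w wm])
  \<comment> \<open>The mollified source lives within radius \<open>R0 + 2\<close>, and kernels
    centred there see values of \<open>w\<close> up to distance 2 further out.\<close>
  define W where "W x = indicator (cball 0 (R0 + 4)) x * w x" for x
  have W: "L2_borel W" unfolding W_def by (rule w)
  have Weq: "W y = w y" if "norm y \<le> R0 + 4" for y using that by (simp add: W_def)
  define We where "We e = convol W (mollifier e 0 0)" for e
  define Fe where "Fe e = convol F (mollifier e 0 0)" for e
  have we: "convol w (mollifier e 0 0) x = We e x" if "0 < e" "e \<le> 1" "norm x \<le> R0 + 2" for e x
    unfolding We_def by (rule convol_local[OF that]) (auto intro: Weq)
  have est1: "Im (LBINT x. Fe e x * cnj (We e x)) \<le> 0"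
    and est2: "(LBINT x. indicator (cball 0 (R0 + 2)) x * (cmod (We e x))\<^sup>2) \<le> total_const k (R0 + 2) * L2_sq (Fe e)"
    if e: "0 < e" "e \<le> 1" for e
  proof -
    note m = mollified_estimates[OF k e wI L L2_borel_loc_integrable[OF F] ae R v g sommerfeld wL[OF e] LF[OF e] Fs R0]
    have "Fe e x * cnj (We e x) = convol F (mollifier e 0 0) x * cnj (convol w (mollifier e 0 0) x)" for x
      using we[OF e, of x] convol_support[where e=e and x=x and i=0 and j=0, OF e Fs] by (cases "norm x \<le> R0 + 2") (auto simp: Fe_def)
    then show "Im (LBINT x. Fe e x * cnj (We e x)) \<le> 0" using m(1) by simp
    have eq: "indicator (cball 0 (R0 + 2)) x * (cmod (We e x))\<^sup>2 = indicator (cball 0 (R0 + 2)) x * (cmod (convol w (mollifier e 0 0) x))\<^sup>2" for x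
      using we[OF e, of x] by (cases "norm x \<le> R0 + 2") auto
    show "(LBINT x. indicator (cball 0 (R0 + 2)) x * (cmod (We e x))\<^sup>2) \<le> total_const k (R0 + 2) * L2_sq (Fe e)"
      unfolding eq using m(2) by (simp add: L2_sq_def Fe_def)
  qed
  have FW: "(LBINT x. F x * cnj (w x)) = (LBINT x. F x * cnj (W x))"
  proof (rule Bochner_Integration.integral_cong[OF refl])
    fix x
    show "F x * cnj (w x) = F x * cnj (W x)" using Fs[of x] Weq[of x] by (cases "norm x \<le> R0") auto
  qed
  have cFe: "L2_borel (Fe e)" "L2_sq (Fe e) \<le> L2_sq F" and cWe: "L2_borel (We e)" "L2_sq (We e) \<le> L2_sq W" if "0 < e" "e \<le> 1" for e
    unfolding Fe_def We_def by (rule L2_borel_convol[OF that F] L2_borel_convol[OF that W])+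
  have tc: "total_const k (R0 + 2) \<ge> 0" by (rule total_const_nonneg[OF k])
  show "Im (LBINT x. F x * cnj (w x)) \<le> 0"
  proof (rule field_le_epsilon)
    fix \<epsilon> :: real assume \<epsilon>: "\<epsilon> > 0"
    define \<eta> where "\<eta> = \<epsilon> / (2 * (L2_sq W + L2_sq F + 1))"
    have S: "L2_sq W + L2_sq F + 1 > 0" using L2_sq_nonneg[of W] L2_sq_nonneg[of F] by linarith
    have \<eta>: "\<eta> > 0" using \<epsilon> S by (simp add: \<eta>_def)
    have \<eta>2: "\<eta> * L2_sq W + \<eta> * L2_sq F \<le> \<epsilon> / 2"
    proof -
      have "\<eta> * L2_sq W + \<eta> * L2_sq F \<le> \<eta> * (L2_sq W + L2_sq F + 1)" using \<eta> by (simp add: distrib_left)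
      also have "\<dots> = \<epsilon> / 2"
      proof -
        have "\<epsilon> / (2 * s) * s = \<epsilon> / 2" if "s > 0" for s using that by simp
        from this[OF S] show ?thesis by (simp only: \<eta>_def)
      qed
      finally show ?thesis .
    qed
    \<comment> \<open>Divided by \<open>4 * \<eta>\<close>, each of the two mollification errors
      contributes a quarter of \<open>\<epsilon>\<close>; the terms with factor
      \<open>\<eta>\<close> contribute the other half.\<close>
    have d: "\<epsilon> * \<eta> > 0" using \<epsilon> \<eta> by simp
    obtain e1 where e1: "e1 > 0" "e1 \<le> 1" "\<And>e. 0 < e \<Longrightarrow> e \<le> e1 \<Longrightarrow> L2_sq (\<lambda>x. convol F (mollifier e 0 0) x - F x) < \<epsilon> * \<eta>"
      using convol_L2_approx[OF F d] by metis
    obtain e2 where e2: "e2 > 0" "e2 \<le> 1" "\<And>e. 0 < e \<Longrightarrow> e \<le> e2 \<Longrightarrow> L2_sq (\<lambda>x. convol W (mollifier e 0 0) x - W x) < \<epsilon> * \<eta>"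
      using convol_L2_approx[OF W d] by metis
    define e where "e = min e1 e2"
    have e: "0 < e" "e \<le> 1" "e \<le> e1" "e \<le> e2" using e1 e2 by (auto simp: e_def)
    have "cmod ((LBINT x. Fe e x * cnj (We e x)) - (LBINT x. F x * cnj (W x)))
       \<le> L2_sq (\<lambda>x. Fe e x - F x) / (4 * \<eta>) + \<eta> * L2_sq (We e) + L2_sq (\<lambda>x. We e x - W x) / (4 * \<eta>) + \<eta> * L2_sq F"
      by (rule L2_borel_mult_diff_bound[OF cFe(1)[OF e(1,2)] F cWe(1)[OF e(1,2)] W \<eta>])
    also have "\<dots> \<le> \<epsilon> * \<eta> / (4 * \<eta>) + \<eta> * L2_sq W + \<epsilon> * \<eta> / (4 * \<eta>) + \<eta> * L2_sq F"
      using e1(3)[OF e(1,3)] e2(3)[OF e(1,4)] cWe(2)[OF e(1,2)] \<eta>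
      unfolding Fe_def[symmetric] We_def[symmetric]
      by (intro add_mono divide_right_mono mult_left_mono) auto
    also have "\<dots> \<le> \<epsilon>" using \<eta>2 \<eta> by simp
    finally have "Im (LBINT x. F x * cnj (W x)) - Im (LBINT x. Fe e x * cnj (We e x)) \<le> \<epsilon>"
      using abs_Im_le_cmod[of "(LBINT x. Fe e x * cnj (We e x)) - (LBINT x. F x * cnj (W x))"] by simp
    then show "Im (LBINT x. F x * cnj (w x)) \<le> 0 + \<epsilon>"
      unfolding FW using est1[OF e(1,2)] by simp
  qed
  show "L2_sq (\<lambda>x. indicator (cball 0 R0) x * w x) \<le> 2 * total_const k (R0 + 2) * L2_sq F"
  proof (rule field_le_epsilon)
    fix \<epsilon> :: real assume \<epsilon>: "\<epsilon> > 0"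
    then have d: "\<epsilon> / 2 > 0" by simp
    obtain e where e: "e > 0" "e \<le> 1" "\<And>e'. 0 < e' \<Longrightarrow> e' \<le> e \<Longrightarrow> L2_sq (\<lambda>x. convol W (mollifier e' 0 0) x - W x) < \<epsilon> / 2"
      using convol_L2_approx[OF W d] by metis
    have d2: "L2_sq (\<lambda>x. We e x - W x) < \<epsilon> / 2" using e(3)[of e] e by (simp add: We_def)
    have D: "L2_borel (\<lambda>x. We e x - W x)" by (rule L2_borel_diff(1)[OF cWe(1)[OF e(1,2)] W])
    have cWe': "continuous_on UNIV (We e)"
      unfolding We_def by (rule continuous_on_convol[OF L2_borel_loc_integrable[OF W] mollifier_continuous_compact[OF e(1,2)]])
    have i1: "integrable lborel (\<lambda>x. indicator (cball 0 (R0 + 2)) x * (cmod (We e x))\<^sup>2)"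
      by (intro integrable_cball_mult continuous_intros cWe')
    have i2: "integrable lborel (\<lambda>x. (cmod (We e x - W x))\<^sup>2)" using D by (simp add: L2_borel_def)
    have pw: "(cmod (indicator (cball 0 R0) x * w x))\<^sup>2 \<le> 2 * (indicator (cball 0 (R0 + 2)) x * (cmod (We e x))\<^sup>2) + 2 * (cmod (We e x - W x))\<^sup>2" for x
    proof (cases "norm x \<le> R0")
      case True
      have "w x = We e x + (W x - We e x)" using True by (simp add: Weq)
      then have "(cmod (w x))\<^sup>2 \<le> 2 * (cmod (We e x))\<^sup>2 + 2 * (cmod (W x - We e x))\<^sup>2"
        using cmod_add_sq[of "We e x" "W x - We e x"] by simp
      then show ?thesis using True by (simp add: norm_minus_commute)
    qed simp
    have "L2_sq (\<lambda>x. indicator (cball 0 R0) x * w x) \<le> (LBINT x. 2 * (indicator (cball 0 (R0 + 2)) x * (cmod (We e x))\<^sup>2) + 2 * (cmod (We e x - W x))\<^sup>2)"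
      unfolding L2_sq_def
      by (rule Bochner_Integration.integral_mono[OF _ Bochner_Integration.integrable_add[OF integrable_mult_right[OF i1] integrable_mult_right[OF i2]] pw])
         (use w in \<open>simp add: L2_borel_def\<close>)
    also have "\<dots> = 2 * (LBINT x. indicator (cball 0 (R0 + 2)) x * (cmod (We e x))\<^sup>2) + 2 * L2_sq (\<lambda>x. We e x - W x)"
      unfolding Bochner_Integration.integral_add[OF integrable_mult_right[OF i1] integrable_mult_right[OF i2]] integral_mult_right_zero L2_sq_def ..
    also have "\<dots> \<le> 2 * (total_const k (R0 + 2) * L2_sq F) + \<epsilon>"
    proof -
      have "total_const k (R0 + 2) * L2_sq (Fe e) \<le> total_const k (R0 + 2) * L2_sq F"
        using cFe(2)[OF e(1,2)] tc by (rule mult_left_mono)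
      then show ?thesis using est2[OF e(1,2)] d2 by linarith
    qed
    finally show "L2_sq (\<lambda>x. indicator (cball 0 R0) x * w x) \<le> 2 * total_const k (R0 + 2) * L2_sq F + \<epsilon>" by simp
  qed
qed

section \<open>Borel representatives and the mollified form of the weak equation\<close>

lemma borel_representative:
  fixes u :: "R2 \<Rightarrow> complex"
  assumes "u \<in> borel_measurable lebesgue"
  obtains ub where "ub \<in> borel_measurable borel" "AE x in lborel. u x = ub x"
proof -
  have "(\<lambda>x. Re (u x)) \<in> borel_measurable lebesgue" "(\<lambda>x. Im (u x)) \<in> borel_measurable lebesgue"
    using assms by measurable
  note ri = this
  from completion_ex_borel_measurable_real[OF ri(1)] obtain a
    where [measurable]: "a \<in> borel_measurable lborel" and a: "AE x in lborel. Re (u x) = a x" by blast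
  from completion_ex_borel_measurable_real[OF ri(2)] obtain b
    where [measurable]: "b \<in> borel_measurable lborel" and b: "AE x in lborel. Im (u x) = b x" by blast
  show ?thesis
  proof (rule that[of "\<lambda>x. Complex (a x) (b x)"])
    have "(\<lambda>x. of_real (a x) + \<i> * of_real (b x)) \<in> borel_measurable lborel" by measurable
    then show "(\<lambda>x. Complex (a x) (b x)) \<in> borel_measurable borel" by (simp add: Complex_eq)
    show "AE x in lborel. u x = Complex (a x) (b x)"
      using a b by eventually_elim (simp add: complex_eq_iff)
  qed
qed

text \<open>The problem is posed on the completed measure, whereas translation and exchange of
  integrals are carried out on \<open>lborel\<close> with Borel functions.\<close>

lemma lebesgue_lborel:
  fixes g gb :: "R2 \<Rightarrow> 'b::{banach, second_countable_topology}"
  assumes g: "g \<in> borel_measurable lebesgue" and gb: "gb \<in> borel_measurable borel" and ae: "AE x in lborel. g x = gb x"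
  shows "integral\<^sup>L lebesgue g = integral\<^sup>L lborel gb" "integrable lebesgue g \<longleftrightarrow> integrable lborel gb"
proof -
  have gb': "gb \<in> borel_measurable lborel" "gb \<in> borel_measurable lebesgue"
    using gb by (auto intro: measurable_completion)
  have ae': "AE x in lebesgue. g x = gb x" using ae by (simp add: AE_completion_iff)
  show "integral\<^sup>L lebesgue g = integral\<^sup>L lborel gb"
    using integral_cong_AE[OF g gb'(2) ae'] integral_completion[OF gb'(1)] by simp
  show "integrable lebesgue g \<longleftrightarrow> integrable lborel gb"
    using integrable_cong_AE[OF g gb'(2) ae'] integrable_completion[OF gb'(1)] by simp
qed

lemma locL2_representative:
  assumes "locL2 u"
  obtains ub where "ub \<in> borel_measurable borel" "AE x in lborel. u x = ub x" "\<And>r. L2_borel (\<lambda>x. indicator (cball 0 r) x * ub x)"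
proof -
  have um[measurable]: "u \<in> borel_measurable lebesgue" using assms by (simp add: locL2_def)
  obtain ub where ub[measurable]: "ub \<in> borel_measurable borel" and ae: "AE x in lborel. u x = ub x"
    using borel_representative[OF um] by blast
  show ?thesis
  proof (rule that[OF ub ae])
    fix r
    have "integrable lebesgue (\<lambda>x. indicator (cball 0 r) x *\<^sub>R (cmod (u x))\<^sup>2)"
      using assms compact_cball unfolding locL2_def set_integrable_def by blast
    moreover have "(\<lambda>x. indicator (cball 0 r) x *\<^sub>R (cmod (u x))\<^sup>2) \<in> borel_measurable lebesgue"
      using calculation by (rule borel_measurable_integrable)
    moreover have [measurable]: "(\<lambda>x. indicator (cball 0 r) x * ub x) \<in> borel_measurable borel"
      by (intro borel_measurable_times borel_measurable_indicator ub) auto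
    moreover have "(\<lambda>x. (cmod (indicator (cball 0 r) x * ub x))\<^sup>2) \<in> borel_measurable borel"
      by measurable
    moreover have "AE x in lborel. indicator (cball 0 r) x *\<^sub>R (cmod (u x))\<^sup>2 = (cmod (indicator (cball 0 r) x * ub x))\<^sup>2"
      using ae by eventually_elim (simp add: indicator_def)
    ultimately have "integrable lborel (\<lambda>x. (cmod (indicator (cball 0 r) x * ub x))\<^sup>2)"
      using lebesgue_lborel(2) by blast
    moreover have "(\<lambda>x. indicator (cball 0 r) x * ub x) \<in> borel_measurable borel" by measurable
    ultimately show "L2_borel (\<lambda>x. indicator (cball 0 r) x * ub x)" by (simp add: L2_borel_def)
  qed
qed

lemma lebesgue_convol:
  assumes u: "u \<in> borel_measurable lebesgue" and ub: "loc_integrable ub" and ae: "AE x in lborel. u x = ub x"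
    and \<sigma>: "continuous_on UNIV \<sigma>" "\<And>x. norm x > 2 \<Longrightarrow> \<sigma> x = 0"
  shows "(\<integral>y. u y * of_real (\<sigma> (x - y)) \<partial>lebesgue) = convol ub \<sigma> x"
    "integrable lebesgue (\<lambda>y. u y * of_real (\<sigma> (x - y)))"
proof -
  have [measurable]: "\<sigma> \<in> borel_measurable borel" using \<sigma>(1) by (rule borel_measurable_continuous_onI)
  have "(\<lambda>y. \<sigma> (x - y)) \<in> borel_measurable lborel" by measurable
  then have [measurable]: "(\<lambda>y. \<sigma> (x - y)) \<in> borel_measurable lebesgue" by (rule measurable_completion)
  have m: "(\<lambda>y. u y * of_real (\<sigma> (x - y))) \<in> borel_measurable lebesgue" using u by measurable
  have [measurable]: "ub \<in> borel_measurable borel" using ub by (simp add: loc_integrable_def)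
  have mb: "(\<lambda>y. ub y * of_real (\<sigma> (x - y))) \<in> borel_measurable borel" by measurable
  have ae': "AE y in lborel. u y * of_real (\<sigma> (x - y)) = ub y * of_real (\<sigma> (x - y))"
    using ae by eventually_elim simp
  show "(\<integral>y. u y * of_real (\<sigma> (x - y)) \<partial>lebesgue) = convol ub \<sigma> x"
    unfolding convol_def by (rule lebesgue_lborel(1)[OF m mb ae'])
  show "integrable lebesgue (\<lambda>y. u y * of_real (\<sigma> (x - y)))"
    unfolding lebesgue_lborel(2)[OF m mb ae'] by (rule convol_integrable[OF ub \<sigma>])
qed

text \<open>Testing the weak equation with the reflected and translated kernel evaluates the
  convolved equation at \<open>x\<close>. The bound 1 on \<open>i\<close> and \<open>j\<close>
  leaves room for two more derivatives among the three that exist.\<close>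

lemma mollifier_C2c:
  assumes e: "0 < e" "e \<le> 1" and ij: "i \<le> 1" "j \<le> 1"
  obtains g H where "C2c (\<lambda>y. mollifier e i j (x - y)) g H" "\<And>y. lap H y = mollifier e (i + 2) j (x - y) + mollifier e i (j + 2) (x - y)"
proof
  let ?g = "\<lambda>y. (- mollifier e (Suc i) j (x - y)) *\<^sub>R axis 1 1 + (- mollifier e i (Suc j) (x - y)) *\<^sub>R axis 2 1 :: R2"
  let ?H = "\<lambda>y v. (v$1 * mollifier e (Suc (Suc i)) j (x - y) + v$2 * mollifier e (Suc i) (Suc j) (x - y)) *\<^sub>R axis 1 1
      + (v$1 * mollifier e (Suc i) (Suc j) (x - y) + v$2 * mollifier e i (Suc (Suc j)) (x - y)) *\<^sub>R axis 2 1 :: R2"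
  have d: "((\<lambda>y. mollifier e a b (x - y)) has_derivative (\<lambda>v. - (v$1 * mollifier e (Suc a) b (x - y) + v$2 * mollifier e a (Suc b) (x - y)))) (at y)"
    if "a < 3" "b < 3" for a b y
  proof -
    have "((\<lambda>y. x - y) has_derivative (\<lambda>v. - v)) (at y)" by (auto intro!: derivative_eq_intros)
    from has_derivative_compose[OF this grad_at_mollifier[OF e(1) that, of "x - y", unfolded grad_at_def]]
    show ?thesis by simp
  qed
  show "C2c (\<lambda>y. mollifier e i j (x - y)) ?g ?H"
    unfolding C2c_def
  proof (intro conjI allI)
    fix y
    show "((\<lambda>y. mollifier e i j (x - y)) has_derivative (\<lambda>v. ?g y \<bullet> v)) (at y)"
      by (rule has_derivative_eq_rhs[OF d]) (use ij in \<open>auto simp: inner_add_left inner_diff_left inner_axis' fun_eq_iff\<close>)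
    have "(?g has_derivative (\<lambda>v. (- (- (v$1 * mollifier e (Suc (Suc i)) j (x - y) + v$2 * mollifier e (Suc i) (Suc j) (x - y)))) *\<^sub>R axis 1 1
       + (- (- (v$1 * mollifier e (Suc i) (Suc j) (x - y) + v$2 * mollifier e i (Suc (Suc j)) (x - y)))) *\<^sub>R axis 2 1)) (at y)"
      using ij by (intro has_derivative_add has_derivative_scaleR_left has_derivative_minus d) auto
    then show "(?g has_derivative ?H y) (at y)" by (simp only: minus_minus)
  next
    fix v :: R2
    show "continuous_on UNIV (\<lambda>y. ?H y v)"
      by (intro continuous_intros continuous_on_compose2[OF continuous_on_mollifier[OF e(1), of UNIV]]) auto
  next
    have "{y. mollifier e i j (x - y) \<noteq> 0} \<subseteq> cball x 2"
      using mollifier_continuous_compact(2)[OF e] by (auto simp: dist_norm intro: ccontr simp: not_le)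
    then show "bounded {y. mollifier e i j (x - y) \<noteq> 0}" by (rule bounded_subset[OF bounded_cball])
  qed
  show "lap ?H y = mollifier e (i + 2) j (x - y) + mollifier e i (j + 2) (x - y)" for y
    unfolding lap_def by (simp add: sum_2 axis_nth_2)
qed

text \<open>The exterior derivatives are classical, so the gradient of \<open>v\<close> is
  continuous there; the two normalisations agree because sqrt r equals r / sqrt r.\<close>

lemma radiating_sommerfeld:
  assumes "radiating \<kappa> w"
  obtains R v g1 g2 where "R > 0" "AE x in lebesgue. norm x > R \<longrightarrow> w x = v x"
    "\<And>x. norm x > R \<Longrightarrow> grad_at v g1 g2 x"
    "continuous_on {x. norm x > R} g1" "continuous_on {x. norm x > R} g2" "sommerfeld \<kappa> v g1 g2"
proof -
  obtain R v gv hv gl where R: "R > 0" and ae: "AE x in lebesgue. norm x > R \<longrightarrow> w x = v x"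
    and d: "\<forall>x. norm x > R \<longrightarrow>
        (v has_derivative (\<lambda>h. \<Sum>i\<in>UNIV. h $ i *\<^sub>R gv i x)) (at x) \<and>
        (\<forall>i::2. (gv i has_derivative (\<lambda>h. \<Sum>j\<in>UNIV. h $ j *\<^sub>R hv i j x)) (at x)) \<and>
        ((\<lambda>y. \<Sum>i\<in>UNIV. hv i i y) has_derivative (\<lambda>h. \<Sum>j\<in>(UNIV::2 set). h $ j *\<^sub>R gl j x)) (at x)"
    and s: "((\<lambda>x. sqrt (norm x) * cmod ((\<Sum>i\<in>UNIV. (x $ i / norm x) *\<^sub>R gv i x) - \<i> * of_real \<kappa> * v x)) \<longlongrightarrow> 0) at_infinity"
    using assms unfolding radiating_def by blast
  show ?thesis
  proof (rule that[OF R ae])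
    show "grad_at v (gv 1) (gv 2) x" if "norm x > R" for x
      using d[rule_format, OF that] by (simp add: grad_at_def sum_2)
    have "continuous_on {x. norm x > R} (gv i)" for i
      by (intro continuous_at_imp_continuous_on ballI) (use d in \<open>auto intro: has_derivative_continuous\<close>)
    then show "continuous_on {x. norm x > R} (gv 1)" "continuous_on {x. norm x > R} (gv 2)" by auto
    show "sommerfeld \<kappa> v (gv 1) (gv 2)"
      unfolding sommerfeld_def
    proof (rule Lim_transform_eventually[OF s])
      have "\<forall>\<^sub>F x in at_infinity. x \<noteq> (0::R2)" by (rule eventually_not_equal_at_infinity)
      then show "\<forall>\<^sub>F x in at_infinity. sqrt (norm x) * cmod ((\<Sum>i\<in>UNIV. (x $ i / norm x) *\<^sub>R gv i x) - \<i> * of_real \<kappa> * v x) =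
        cmod (x$1 *\<^sub>R gv 1 x + x$2 *\<^sub>R gv 2 x - \<i> * of_real (\<kappa> * norm x) * v x) / sqrt (norm x)"
      proof eventually_elim
        case (elim x)
        then have n: "norm x > 0" by simp
        have "x$1 *\<^sub>R gv 1 x + x$2 *\<^sub>R gv 2 x - \<i> * of_real (\<kappa> * norm x) * v x =
          of_real (norm x) * ((\<Sum>i\<in>UNIV. (x $ i / norm x) *\<^sub>R gv i x) - \<i> * of_real \<kappa> * v x)"
          using n by (simp add: sum_2 scaleR_conv_of_real[where 'a=complex] algebra_simps)
        then have "cmod (x$1 *\<^sub>R gv 1 x + x$2 *\<^sub>R gv 2 x - \<i> * of_real (\<kappa> * norm x) * v x) =
          norm x * cmod ((\<Sum>i\<in>UNIV. (x $ i / norm x) *\<^sub>R gv i x) - \<i> * of_real \<kappa> * v x)"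
          by (simp only: norm_mult norm_of_real abs_norm_cancel)
        moreover have "sqrt (norm x) * c = norm x * c / sqrt (norm x)" for c
        proof -
          have "norm x / sqrt (norm x) * c = sqrt (norm x) * c" using real_div_sqrt[OF norm_ge_zero] by (rule arg_cong)
          then show ?thesis by simp
        qed
        ultimately show ?case by (simp only:)
      qed
    qed
  qed
qed

lemma convol_add_kernel:
  assumes w: "loc_integrable w" and \<sigma>: "continuous_on UNIV \<sigma>" "\<And>x. norm x > 2 \<Longrightarrow> \<sigma> x = 0"
    and \<tau>: "continuous_on UNIV \<tau>" "\<And>x. norm x > 2 \<Longrightarrow> \<tau> x = 0"
  shows "convol w (\<lambda>z. \<sigma> z + \<tau> z) x = convol w \<sigma> x + convol w \<tau> x"
  unfolding convol_def of_real_add distrib_left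
  by (rule Bochner_Integration.integral_add[OF convol_integrable[OF w \<sigma>] convol_integrable[OF w \<tau>]])

text \<open>Testing with mollifiers produces the two convolution identities that
  \<open>limit_estimates\<close> takes as hypotheses. Square integrability of the source follows
  from the bound on \<open>n\<close> and the local square integrability of \<open>w\<close>.\<close>

lemma solution_estimates:
  fixes \<kappa> M R0 :: real and D :: "R2 set" and n f w :: "R2 \<Rightarrow> complex"
  assumes \<kappa>: "\<kappa> > 0" and D: "open D" "D \<subseteq> cball 0 R0" and R0: "R0 \<ge> 0"
    and nm: "n \<in> borel_measurable lebesgue" and nM: "AE x in lebesgue. cmod (n x) \<le> M"
    and n1: "AE x in lebesgue. x \<notin> D \<longrightarrow> n x = 1"
    and f: "L2_on D f" and sol: "is_sol \<kappa> n D f w"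
  obtains wb fb Fb where "wb \<in> borel_measurable borel" "AE x in lborel. w x = wb x"
    "\<And>r. L2_borel (\<lambda>x. indicator (cball 0 r) x * wb x)"
    "L2_borel fb" "AE x in lborel. indicator D x * f x = fb x"
    "L2_borel Fb" "AE x in lborel. of_real (\<kappa>^4) * (n x - 1) * (w x + indicator D x * f x) = Fb x"
    "Im (LBINT x. Fb x * cnj (wb x)) \<le> 0"
    "L2_sq (\<lambda>x. indicator (cball 0 R0) x * wb x) \<le> 2 * total_const \<kappa> (R0 + 2) * L2_sq Fb"
proof -
  have nM': "AE x in lborel. cmod (n x) \<le> M" and n1': "AE x in lborel. x \<notin> D \<longrightarrow> n x = 1"
    using nM n1 by (simp_all add: AE_completion_iff)
  obtain L where L: "locL2 L" and eq: "\<And>\<phi> g H. C2c \<phi> g H \<Longrightarrow>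
      (LINT x|lebesgue. w x * of_real (lap H x)) = (LINT x|lebesgue. L x * of_real (\<phi> x)) \<and>
      (LINT x|lebesgue. L x * of_real (lap H x))
        - of_real (\<kappa>^4) * (LINT x|lebesgue. n x * w x * of_real (\<phi> x))
      = of_real (\<kappa>^4) * (LINT x|lebesgue. (n x - 1) * (indicator D x * f x) * of_real (\<phi> x))"
    using sol unfolding is_sol_def by blast
  have w: "locL2 w" and rad: "radiating \<kappa> w" using sol by (auto simp: is_sol_def H2loc_def)
  obtain wb where wb: "wb \<in> borel_measurable borel" and wae: "AE x in lborel. w x = wb x"
    and wL2: "\<And>r. L2_borel (\<lambda>x. indicator (cball 0 r) x * wb x)"
    using locL2_representative[OF w] by blast
  obtain Lb where Lb: "Lb \<in> borel_measurable borel" and Lae: "AE x in lborel. L x = Lb x"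
    and LL2: "\<And>r. L2_borel (\<lambda>x. indicator (cball 0 r) x * Lb x)"
    using locL2_representative[OF L] by blast
  have wI: "loc_integrable wb" by (rule loc_integrable_of_L2_borel[OF wL2 wb])
  have LI: "loc_integrable Lb" by (rule loc_integrable_of_L2_borel[OF LL2 Lb])
  have wm[measurable]: "w \<in> borel_measurable lebesgue" and Lm: "L \<in> borel_measurable lebesgue"
    using w L by (auto simp: locL2_def)
  note nm[measurable]
  define f1 where "f1 x = indicator D x * f x" for x
  have f1m[measurable]: "f1 \<in> borel_measurable lebesgue" using f unfolding f1_def L2_on_def by simp
  obtain fb where fb[measurable]: "fb \<in> borel_measurable borel" and fae: "AE x in lborel. f1 x = fb x"
    using borel_representative[OF f1m] by blast
  have fL2: "L2_borel fb"
  proof -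
    have i: "integrable lebesgue (\<lambda>x. indicator D x *\<^sub>R (cmod (f x))\<^sup>2)"
      using f by (simp add: L2_on_def set_integrable_def)
    have "AE x in lborel. indicator D x *\<^sub>R (cmod (f x))\<^sup>2 = (cmod (fb x))\<^sup>2"
      using fae by eventually_elim (auto simp: f1_def indicator_def)
    from lebesgue_lborel(2)[OF borel_measurable_integrable[OF i] _ this] i
    show ?thesis by (simp add: L2_borel_def fb)
  qed
  define F0 where "F0 x = of_real (\<kappa>^4) * (n x - 1) * (w x + f1 x)" for x
  have F0m: "F0 \<in> borel_measurable lebesgue" unfolding F0_def by measurable
  obtain Fc where Fc[measurable]: "Fc \<in> borel_measurable borel" and Fcae: "AE x in lborel. F0 x = Fc x"
    using borel_representative[OF F0m] by blast
  \<comment> \<open>\<open>Fc\<close> vanishes outside the disc only almost everywhere; the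
    indicator makes the support condition hold at every point and changes \<open>Fc\<close> on a
    null set only.\<close>
  define Fb where "Fb x = indicator (cball 0 R0) x * Fc x" for x
  have Fbm[measurable]: "Fb \<in> borel_measurable borel"
    unfolding Fb_def by (intro borel_measurable_times borel_measurable_indicator Fc) auto
  have Fae: "AE x in lborel. F0 x = Fb x"
    using Fcae n1' by eventually_elim (use D in \<open>auto simp: Fb_def F0_def indicator_def\<close>)
  have Fs: "Fb x = 0" if "norm x > R0" for x using that by (simp add: Fb_def)
  have FL2: "L2_borel Fb"
    unfolding L2_borel_def
  proof (intro conjI Fbm)
    let ?W = "\<lambda>x. indicator (cball 0 R0) x * wb x"
    have "integrable lborel (\<lambda>x. (\<kappa>^4 * (M + 1))\<^sup>2 * (2 * (cmod (?W x))\<^sup>2 + 2 * (cmod (fb x))\<^sup>2))"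
      using wL2[of R0] fL2 by (intro integrable_mult_right Bochner_Integration.integrable_add) (auto simp: L2_borel_def)
    then show "integrable lborel (\<lambda>x. (cmod (Fb x))\<^sup>2)"
    proof (rule Bochner_Integration.integrable_bound)
      show "(\<lambda>x. (cmod (Fb x))\<^sup>2) \<in> borel_measurable lborel" by measurable
      show "AE x in lborel. norm ((cmod (Fb x))\<^sup>2) \<le> norm ((\<kappa>^4 * (M + 1))\<^sup>2 * (2 * (cmod (?W x))\<^sup>2 + 2 * (cmod (fb x))\<^sup>2))"
        using Fae fae wae nM'
      proof eventually_elim
        case (elim x)
        show ?case
        proof (cases "norm x > R0")
          case True
          then show ?thesis by (simp add: Fs)
        next
          case False
          have "cmod (Fb x) = \<kappa>^4 * cmod (n x - 1) * cmod (wb x + fb x)"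
            unfolding elim(1)[symmetric] elim(2)[symmetric] elim(3)[symmetric] F0_def using \<kappa> by (simp add: norm_mult norm_power)
          also have "\<dots> \<le> \<kappa>^4 * (M + 1) * cmod (wb x + fb x)"
            using elim(4) norm_triangle_ineq4[of "n x" 1] \<kappa> by (intro mult_right_mono mult_left_mono) auto
          finally have "(cmod (Fb x))\<^sup>2 \<le> (\<kappa>^4 * (M + 1) * cmod (wb x + fb x))\<^sup>2" by (intro power_mono) auto
          also have "\<dots> \<le> (\<kappa>^4 * (M + 1))\<^sup>2 * (2 * (cmod (wb x))\<^sup>2 + 2 * (cmod (fb x))\<^sup>2)"
            unfolding power_mult_distrib[of _ "cmod _"] by (intro mult_left_mono cmod_add_sq) simp
          finally show ?thesis using False by simp
        qed
      qed
    qed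
  qed
  obtain R v g1 g2 where rd: "R > 0" "AE x in lebesgue. norm x > R \<longrightarrow> w x = v x"
    "\<And>x. norm x > R \<Longrightarrow> grad_at v g1 g2 x"
    "continuous_on {x. norm x > R} g1" "continuous_on {x. norm x > R} g2" "sommerfeld \<kappa> v g1 g2"
    using radiating_sommerfeld[OF rad] by blast
  have wv: "AE x in lborel. norm x > R \<longrightarrow> wb x = v x"
    using rd(2)[unfolded AE_completion_iff] wae by eventually_elim auto
  note Kc = mollifier_continuous_compact
  have wLeq: "convol wb (mollifier e (i + 2) j) x + convol wb (mollifier e i (j + 2)) x = convol Lb (mollifier e i j) x"
    if e: "0 < e" "e \<le> 1" and ij: "i + j \<le> 1" for e x i j
  proof -
    obtain g H where gH: "C2c (\<lambda>y. mollifier e i j (x - y)) g H" "\<And>y. lap H y = mollifier e (i + 2) j (x - y) + mollifier e i (j + 2) (x - y)"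
      using mollifier_C2c[OF e, of i j x] ij by (metis add_leD1 add_leD2)
    have "(LINT y|lebesgue. w y * of_real (lap H y)) = convol wb (\<lambda>z. mollifier e (i + 2) j z + mollifier e i (j + 2) z) x"
      unfolding gH(2) by (rule lebesgue_convol(1)[OF wm wI wae]) (auto intro!: continuous_intros Kc[OF e] simp: Kc(2)[OF e])
    also have "\<dots> = convol wb (mollifier e (i + 2) j) x + convol wb (mollifier e i (j + 2)) x"
      by (rule convol_add_kernel[OF wI Kc[OF e] Kc[OF e]])
    finally show ?thesis
      using eq[OF gH(1)] lebesgue_convol(1)[OF Lm LI Lae Kc[OF e], of i j x] by simp
  qed
  have LFeq: "convol Lb (mollifier e 2 0) x + convol Lb (mollifier e 0 2) x = of_real (\<kappa>^4) * convol wb (mollifier e 0 0) x + convol Fb (mollifier e 0 0) x"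
    if e: "0 < e" "e \<le> 1" for e x
  proof -
    let ?\<phi> = "\<lambda>y. mollifier e 0 0 (x - y)"
    obtain g H where gH: "C2c ?\<phi> g H" "\<And>y. lap H y = mollifier e (0 + 2) 0 (x - y) + mollifier e 0 (0 + 2) (x - y)"
      using mollifier_C2c[OF e, of 0 0 x] by blast
    have 1: "(LINT y|lebesgue. L y * of_real (lap H y)) = convol Lb (mollifier e 2 0) x + convol Lb (mollifier e 0 2) x"
    proof -
      have "(LINT y|lebesgue. L y * of_real (lap H y)) = convol Lb (\<lambda>z. mollifier e (0 + 2) 0 z + mollifier e 0 (0 + 2) z) x"
        unfolding gH(2) by (rule lebesgue_convol(1)[OF Lm LI Lae]) (auto intro!: continuous_intros Kc[OF e] simp: Kc(2)[OF e])
      also have "\<dots> = convol Lb (mollifier e (0 + 2) 0) x + convol Lb (mollifier e 0 (0 + 2)) x"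
        by (rule convol_add_kernel[OF LI Kc[OF e] Kc[OF e]])
      finally show ?thesis by (simp add: numeral_2_eq_2)
    qed
    have "(\<lambda>y. mollifier e 0 0 (x - y)) \<in> borel_measurable borel"
      by (intro borel_measurable_continuous_onI continuous_on_compose2[OF Kc(1)[OF e]] continuous_intros) auto
    then have \<phi>m[measurable]: "?\<phi> \<in> borel_measurable lebesgue" by (intro measurable_completion) simp
    note wi = lebesgue_convol[OF wm wI wae Kc[OF e], of 0 0 x]
    note fi = lebesgue_convol[OF f1m L2_borel_loc_integrable[OF fL2] fae Kc[OF e], of 0 0 x]
    note Fi = lebesgue_convol[OF F0m L2_borel_loc_integrable[OF FL2] Fae Kc[OF e], of 0 0 x]
    have nwi: "integrable lebesgue (\<lambda>y. n y * w y * of_real (?\<phi> y))"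
    proof (rule Bochner_Integration.integrable_bound[OF integrable_mult_right[OF integrable_norm[OF wi(2)], of M]])
      show "(\<lambda>y. n y * w y * of_real (?\<phi> y)) \<in> borel_measurable lebesgue" by measurable
      show "AE y in lebesgue. norm (n y * w y * of_real (?\<phi> y)) \<le> norm (M * norm (w y * of_real (?\<phi> y)))"
        using nM
      proof eventually_elim
        case (elim y)
        have "cmod (n y) * norm (w y * of_real (?\<phi> y)) \<le> M * norm (w y * of_real (?\<phi> y))"
          using elim by (rule mult_right_mono) simp
        moreover have "norm (n y * w y * of_real (?\<phi> y)) = cmod (n y) * norm (w y * of_real (?\<phi> y))"
          by (simp only: norm_mult mult.assoc)
        ultimately show ?case unfolding real_norm_def by linarith
      qed
    qed
    have nfi: "integrable lebesgue (\<lambda>y. (n y - 1) * f1 y * of_real (?\<phi> y))"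
    proof (rule Bochner_Integration.integrable_bound[OF integrable_mult_right[OF integrable_norm[OF fi(2)], of "M + 1"]])
      show "(\<lambda>y. (n y - 1) * f1 y * of_real (?\<phi> y)) \<in> borel_measurable lebesgue" by measurable
      show "AE y in lebesgue. norm ((n y - 1) * f1 y * of_real (?\<phi> y)) \<le> norm ((M + 1) * norm (f1 y * of_real (?\<phi> y)))"
        using nM
      proof eventually_elim
        case (elim y)
        have "cmod (n y - 1) \<le> M + 1" using elim norm_triangle_ineq4[of "n y" 1] by simp
        then have "cmod (n y - 1) * norm (f1 y * of_real (?\<phi> y)) \<le> (M + 1) * norm (f1 y * of_real (?\<phi> y))"
          by (rule mult_right_mono) simp
        moreover have "norm ((n y - 1) * f1 y * of_real (?\<phi> y)) = cmod (n y - 1) * norm (f1 y * of_real (?\<phi> y))"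
          by (simp only: norm_mult mult.assoc)
        ultimately show ?case unfolding real_norm_def by linarith
      qed
    qed
    \<comment> \<open>Splitting \<open>n w\<close> into \<open>w\<close> and
      \<open>(n - 1) w\<close> moves the variable coefficient into the source.\<close>
    have "F0 y * of_real (?\<phi> y) = of_real (\<kappa>^4) * (n y * w y * of_real (?\<phi> y)) - of_real (\<kappa>^4) * (w y * of_real (?\<phi> y))
       + of_real (\<kappa>^4) * ((n y - 1) * f1 y * of_real (?\<phi> y))" for y
      by (simp add: F0_def algebra_simps)
    then have "(LINT y|lebesgue. F0 y * of_real (?\<phi> y)) = of_real (\<kappa>^4) * (LINT y|lebesgue. n y * w y * of_real (?\<phi> y))
       - of_real (\<kappa>^4) * (LINT y|lebesgue. w y * of_real (?\<phi> y)) + of_real (\<kappa>^4) * (LINT y|lebesgue. (n y - 1) * f1 y * of_real (?\<phi> y))"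
      by (simp only: Bochner_Integration.integral_add[OF Bochner_Integration.integrable_diff[OF integrable_mult_right[OF nwi] integrable_mult_right[OF wi(2)]] integrable_mult_right[OF nfi]]
         Bochner_Integration.integral_diff[OF integrable_mult_right[OF nwi] integrable_mult_right[OF wi(2)]] integral_mult_right_zero)
    moreover have "(LINT y|lebesgue. L y * of_real (lap H y)) - of_real (\<kappa>^4) * (LINT y|lebesgue. n y * w y * of_real (?\<phi> y))
       = of_real (\<kappa>^4) * (LINT y|lebesgue. (n y - 1) * f1 y * of_real (?\<phi> y))"
      using eq[OF gH(1)] unfolding f1_def by blast
    moreover have "(LINT y|lebesgue. w y * of_real (?\<phi> y)) = convol wb (mollifier e 0 0) x" by (rule wi(1))
    moreover have "(LINT y|lebesgue. F0 y * of_real (?\<phi> y)) = convol Fb (mollifier e 0 0) x" by (rule Fi(1))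
    ultimately show ?thesis unfolding 1 by (simp only:) (simp only: diff_eq_eq, simp only: add_ac, simp)
  qed
  note est = limit_estimates[OF \<kappa> wb wL2 LI FL2 wv rd(1,3,4,5,6) wLeq LFeq Fs R0]
  show ?thesis
    by (rule that[OF wb wae wL2 fL2 fae[unfolded f1_def] FL2 Fae[unfolded F0_def f1_def] est])
qed

theorem theorem3p3:
  fixes \<kappa> \<alpha> :: real and D :: "R2 set" and n :: "R2 \<Rightarrow> complex"
  assumes "\<kappa> > 0"
    and "open D" and "bounded D" and "C2_boundary D" and "connected (- closure D)"
    and "n \<in> borel_measurable lebesgue" and "\<exists>M. AE x in lebesgue. cmod (n x) \<le> M"
    and "AE x in lebesgue. x \<notin> D \<longrightarrow> n x = 1"
    and "ess_supp (\<lambda>x. n x - 1) = closure D"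
    and "\<alpha> > 0" and "AE x in lebesgue. x \<in> D \<longrightarrow> Im (n x) \<ge> \<alpha>"
  shows "\<exists>c>0. \<forall>f w. L2_on D f \<longrightarrow> is_sol \<kappa> n D f w \<longrightarrow>
           (let q = (ipD D (T_op \<kappa> n f w) f - ipD D f (T_op \<kappa> n f w)) / (2 * \<i>)
            in Im q = 0 \<and> Re q \<ge> c * (LINT x:D|lebesgue. (cmod (f x))^2))"
proof -
  obtain M where M: "AE x in lebesgue. cmod (n x) \<le> M" using assms(7) by blast
  have nM: "AE x in lborel. cmod (n x) \<le> M" and n1: "AE x in lborel. x \<notin> D \<longrightarrow> n x = 1"
    and n\<alpha>: "AE x in lborel. x \<in> D \<longrightarrow> Im (n x) \<ge> \<alpha>"
    using M assms(8,11) by (simp_all add: AE_completion_iff)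
  obtain R0 where R0: "R0 > 0" "\<And>x. x \<in> D \<Longrightarrow> norm x \<le> R0" using assms(3) by (auto simp: bounded_pos)
  have DR: "D \<subseteq> cball 0 R0" using R0(2) by auto
  define C where "C = 2 * total_const \<kappa> (R0 + 2)"
  have C: "C \<ge> 0" unfolding C_def using total_const_nonneg[OF assms(1)] by simp
  \<comment> \<open>\<open>E\<close> bounds the norm of \<open>f\<close> by that of
    \<open>h = f + w\<close>: both squares in \<open>f = h - w\<close> are doubled, \<open>w\<close>
    costs \<open>C\<close> times the source, and the source is at most
    \<open>\<kappa>^4 * (M + 1)\<close> times |h|. Dividing the lower bound
    \<open>\<kappa>\<^sup>2 * \<alpha> / 2\<close> in terms of \<open>h\<close> by \<open>E\<close>
    gives \<open>c\<close>.\<close>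
  define E where "E = 2 + 2 * C * (\<kappa>^4 * (M + 1))\<^sup>2"
  have E: "E > 0" using C by (simp add: E_def add_pos_nonneg)
  define c where "c = \<kappa>\<^sup>2 * \<alpha> / 2 / E"
  show ?thesis
  proof (intro exI[of _ c] conjI allI impI)
    show "c > 0" using assms(1,10) E by (simp add: c_def)
    fix f w assume f: "L2_on D f" and sol: "is_sol \<kappa> n D f w"
    obtain wb fb Fb where wb[measurable]: "wb \<in> borel_measurable borel" and wae: "AE x in lborel. w x = wb x"
      and wL2: "\<And>r. L2_borel (\<lambda>x. indicator (cball 0 r) x * wb x)"
      and fL2: "L2_borel fb" and fae: "AE x in lborel. indicator D x * f x = fb x"
      and FL2: "L2_borel Fb" and Fae: "AE x in lborel. of_real (\<kappa>^4) * (n x - 1) * (w x + indicator D x * f x) = Fb x"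
      and ImF: "Im (LBINT x. Fb x * cnj (wb x)) \<le> 0"
      and wF: "L2_sq (\<lambda>x. indicator (cball 0 R0) x * wb x) \<le> 2 * total_const \<kappa> (R0 + 2) * L2_sq Fb"
      using solution_estimates[OF assms(1,2) DR less_imp_le[OF R0(1)] assms(6) M assms(8) f sol] by blast
    have [measurable]: "fb \<in> borel_measurable borel" "Fb \<in> borel_measurable borel" "D \<in> sets borel"
      using fL2 FL2 assms(2) by (auto simp: L2_borel_def)
    have cnjm[measurable]: "cnj \<in> borel_measurable borel"
      by (intro borel_measurable_continuous_onI continuous_intros)
    define W where "W x = indicator (cball 0 R0) x * wb x" for x
    have WL2: "L2_borel W" unfolding W_def by (rule wL2)
    define h where "h x = fb x + W x" for x
    have hL2: "L2_borel h" unfolding h_def by (rule L2_borel_add(1)[OF fL2 WL2])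
    have [measurable]: "W \<in> borel_measurable borel" "h \<in> borel_measurable borel" using WL2 hL2 by (auto simp: L2_borel_def)
    have onD: "AE x in lborel. Fb x = of_real (\<kappa>^4) * (n x - 1) * (indicator D x * h x)"
      using Fae fae wae n1 
    proof eventually_elim
      case (elim x)
      show ?case
      proof (cases "x \<in> D")
        case True
        then have "norm x \<le> R0" using R0(2) by auto
        then show ?thesis using True elim by (simp add: h_def W_def add.commute)
      next
        case False
        then show ?thesis using elim by auto
      qed
    qed
    define H where "H = (LBINT x. indicator D x * (cmod (h x))\<^sup>2)"
    have iH: "integrable lborel (\<lambda>x. indicator D x * (cmod (h x))\<^sup>2)"
    proof (rule Bochner_Integration.integrable_bound)
      show "integrable lborel (\<lambda>x. (cmod (h x))\<^sup>2)" using hL2 by (simp add: L2_borel_def)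
    qed (auto intro!: AE_I2 simp: indicator_def)
    have ipeq: "ipD D (T_op \<kappa> n f w) f = of_real (1 / (2 * \<kappa>\<^sup>2)) * (LBINT x. Fb x * cnj (fb x))"
    proof -
      let ?g = "\<lambda>x. of_real (\<kappa>\<^sup>2 / 2) * (n x - 1) * (indicator D x * f x + indicator D x * w x) * cnj (indicator D x * f x)"
      have f1m: "(\<lambda>x. indicator D x * f x) \<in> borel_measurable lebesgue" using f by (simp add: L2_on_def)
      have wm: "w \<in> borel_measurable lebesgue" using sol by (simp add: is_sol_def H2loc_def locL2_def)
      have Dm: "(\<lambda>x. indicator D x :: complex) \<in> borel_measurable lebesgue"
        by (rule measurable_completion) simp
      have gm: "?g \<in> borel_measurable lebesgue"
        by (intro borel_measurable_times borel_measurable_diff borel_measurable_add borel_measurable_const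
             assms(6) f1m wm Dm measurable_compose[OF f1m cnjm])
      have gbm: "(\<lambda>x. of_real (1 / (2 * \<kappa>\<^sup>2)) * (Fb x * cnj (fb x))) \<in> borel_measurable borel" by measurable
      have ae: "AE x in lborel. ?g x = of_real (1 / (2 * \<kappa>\<^sup>2)) * (Fb x * cnj (fb x))"
        using Fae fae n1
      proof eventually_elim
        case (elim x)
        have \<kappa>4: "of_real (1 / (2 * \<kappa>\<^sup>2)) * (of_real (\<kappa>^4) * z) = (of_real (\<kappa>\<^sup>2 / 2) * z :: complex)" for z
        proof -
          have "1 / (2 * \<kappa>\<^sup>2) * \<kappa>^4 = \<kappa>\<^sup>2 / 2" using assms(1) by (simp add: field_simps power2_eq_square power4_eq_xxxx)
          then show ?thesis by (simp only: mult.assoc[symmetric] of_real_mult[symmetric])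
        qed
        show ?case
        proof (cases "x \<in> D")
          case True
          then show ?thesis
            unfolding elim(1)[symmetric] elim(2)[symmetric] using \<kappa>4[of "(n x - 1) * (w x + f x) * cnj (f x)"]
            by (auto simp: mult.assoc add.commute simp del: of_real_divide of_real_mult of_real_power)
        next
          case False
          then show ?thesis using elim by auto
        qed
      qed
      have "ipD D (T_op \<kappa> n f w) f = integral\<^sup>L lebesgue ?g"
        unfolding ipD_def set_lebesgue_integral_def T_op_def
        by (rule Bochner_Integration.integral_cong[OF refl]) (auto simp: indicator_def)
      also have "\<dots> = (LBINT x. of_real (1 / (2 * \<kappa>\<^sup>2)) * (Fb x * cnj (fb x)))"
        by (rule lebesgue_lborel(1)[OF gm gbm ae])
      finally show ?thesis by (simp only: integral_mult_right_zero)
    qed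
    have ipcnj: "ipD D f (T_op \<kappa> n f w) = cnj (ipD D (T_op \<kappa> n f w) f)"
      unfolding ipD_def set_lebesgue_integral_def
      by (subst Bochner_Integration.integral_cnj[symmetric]) (simp add: mult.commute)
    define z where "z = ipD D (T_op \<kappa> n f w) f"
    have q: "(z - cnj z) / (2 * \<i>) = of_real (Im z)"
      by (simp add: complex_diff_cnj mult_ac)
    \<comment> \<open>\<open>fb\<close> is \<open>h - W\<close>, and \<open>W\<close> agrees with
      \<open>wb\<close> where the source lives. The part with \<open>wb\<close> enters with a minus
      sign, so the nonpositive flux of \<open>solution_estimates\<close> can only increase the
      result.\<close>
    have Fh: "Im (LBINT x. Fb x * cnj (fb x)) = Im (LBINT x. Fb x * cnj (h x)) - Im (LBINT x. Fb x * cnj (wb x))"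
    proof -
      have "(LBINT x. Fb x * cnj (wb x)) = (LBINT x. Fb x * cnj (W x))"
      proof (rule integral_cong_AE)
        show "AE x in lborel. Fb x * cnj (wb x) = Fb x * cnj (W x)"
          using onD by eventually_elim (use DR in \<open>auto simp: W_def indicator_def\<close>)
      qed measurable
      moreover have "(LBINT x. Fb x * cnj (h x)) = (LBINT x. Fb x * cnj (fb x)) + (LBINT x. Fb x * cnj (W x))"
        unfolding h_def complex_cnj_add distrib_left
        by (rule Bochner_Integration.integral_add[OF integrable_L2_borel_mult[OF FL2 fL2] integrable_L2_borel_mult[OF FL2 WL2]])
      ultimately show ?thesis by simp
    qed
    have lower: "\<kappa>^4 * \<alpha> * H \<le> Im (LBINT x. Fb x * cnj (h x))"
    proof -
      have i: "integrable lborel (\<lambda>x. Fb x * cnj (h x))" by (rule integrable_L2_borel_mult[OF FL2 hL2])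
      have "\<kappa>^4 * \<alpha> * H = (LBINT x. \<kappa>^4 * \<alpha> * (indicator D x * (cmod (h x))\<^sup>2))" by (simp add: H_def)
      also have "\<dots> \<le> (LBINT x. Im (Fb x * cnj (h x)))"
      proof (rule integral_mono_AE[OF integrable_mult_right[OF iH] integrable_Im[OF i]])
        show "AE x in lborel. \<kappa>^4 * \<alpha> * (indicator D x * (cmod (h x))\<^sup>2) \<le> Im (Fb x * cnj (h x))"
          using onD n\<alpha>
        proof eventually_elim
          case (elim x)
          show ?case
          proof (cases "x \<in> D")
            case True
            have "Fb x * cnj (h x) = of_real (\<kappa>^4) * (n x - 1) * (h x * cnj (h x))"
              using elim(1) True by simp
            also have "h x * cnj (h x) = of_real ((cmod (h x))\<^sup>2)" by (rule complex_norm_square[symmetric])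
            also have "of_real (\<kappa>^4) * (n x - 1) * of_real ((cmod (h x))\<^sup>2) = of_real (\<kappa>^4 * (cmod (h x))\<^sup>2) * (n x - 1)"
              by simp
            \<comment> \<open>Subtracting 1 does not change the imaginary part of \<open>n\<close>,
              and the remaining factors are real.\<close>
            finally have "Im (Fb x * cnj (h x)) = \<kappa>^4 * (cmod (h x))\<^sup>2 * Im (n x)"
              by (simp only: Im_complex_of_real Re_complex_of_real times_complex.simps) simp
            moreover have "\<kappa>^4 * (cmod (h x))\<^sup>2 * \<alpha> \<le> \<kappa>^4 * (cmod (h x))\<^sup>2 * Im (n x)"
              using elim(2) True by (intro mult_left_mono) auto
            ultimately show ?thesis using True by (simp add: mult_ac)
          next
            case False
            then show ?thesis using elim(1) by simp
          qed
        qed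
      qed
      also have "\<dots> = Im (LBINT x. Fb x * cnj (h x))" by (rule integral_Im[OF i])
      finally show ?thesis .
    qed
    have FH: "L2_sq Fb \<le> (\<kappa>^4 * (M + 1))\<^sup>2 * H"
    proof -
      have "L2_sq Fb \<le> (LBINT x. (\<kappa>^4 * (M + 1))\<^sup>2 * (indicator D x * (cmod (h x))\<^sup>2))"
        unfolding L2_sq_def
      proof (rule integral_mono_AE[OF _ integrable_mult_right[OF iH]])
        show "integrable lborel (\<lambda>x. (cmod (Fb x))\<^sup>2)" using FL2 by (simp add: L2_borel_def)
        show "AE x in lborel. (cmod (Fb x))\<^sup>2 \<le> (\<kappa>^4 * (M + 1))\<^sup>2 * (indicator D x * (cmod (h x))\<^sup>2)"
          using onD nM
        proof eventually_elim
          case (elim x)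
          show ?case
          proof (cases "x \<in> D")
            case True
            have "cmod (Fb x) = \<kappa>^4 * cmod (n x - 1) * cmod (h x)"
              using elim(1) True assms(1) by (simp add: norm_mult norm_power)
            also have "\<dots> \<le> \<kappa>^4 * (M + 1) * cmod (h x)"
              using elim(2) norm_triangle_ineq4[of "n x" 1] assms(1) by (intro mult_right_mono mult_left_mono) auto
            finally have "(cmod (Fb x))\<^sup>2 \<le> (\<kappa>^4 * (M + 1) * cmod (h x))\<^sup>2" by (intro power_mono) auto
            then show ?thesis using True by (simp add: power_mult_distrib)
          next
            case False
            then show ?thesis using elim(1) by simp
          qed
        qed
      qed
      then show ?thesis by (simp add: H_def)
    qed
    have fH: "L2_sq fb \<le> E * H"
    proof -
      have "L2_sq fb \<le> (LBINT x. 2 * (indicator D x * (cmod (h x))\<^sup>2) + 2 * (cmod (W x))\<^sup>2)"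
        unfolding L2_sq_def
      proof (rule integral_mono_AE)
        show "integrable lborel (\<lambda>x. (cmod (fb x))\<^sup>2)" using fL2 by (simp add: L2_borel_def)
        show "integrable lborel (\<lambda>x. 2 * (indicator D x * (cmod (h x))\<^sup>2) + 2 * (cmod (W x))\<^sup>2)"
          using iH WL2 by (intro Bochner_Integration.integrable_add integrable_mult_right) (auto simp: L2_borel_def)
        show "AE x in lborel. (cmod (fb x))\<^sup>2 \<le> 2 * (indicator D x * (cmod (h x))\<^sup>2) + 2 * (cmod (W x))\<^sup>2"
          using fae
        proof eventually_elim
          case (elim x)
          show ?case
          proof (cases "x \<in> D")
            case True
            have "(cmod (fb x))\<^sup>2 \<le> 2 * (cmod (h x))\<^sup>2 + 2 * (cmod (- W x))\<^sup>2"
              using cmod_add_sq[of "h x" "- W x"] by (simp add: h_def)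
            then show ?thesis using True by simp
          next
            case False
            then show ?thesis using elim by auto
          qed
        qed
      qed
      also have "\<dots> = 2 * H + 2 * L2_sq W"
        using iH WL2 by (subst Bochner_Integration.integral_add) (auto simp: H_def L2_sq_def L2_borel_def)
      also have "\<dots> \<le> 2 * H + 2 * (C * ((\<kappa>^4 * (M + 1))\<^sup>2 * H))"
      proof -
        have "L2_sq W \<le> C * L2_sq Fb" using wF by (simp add: W_def[abs_def] C_def)
        also have "\<dots> \<le> C * ((\<kappa>^4 * (M + 1))\<^sup>2 * H)" by (rule mult_left_mono[OF FH C])
        finally show ?thesis by simp
      qed
      also have "\<dots> = E * H" by (simp add: E_def algebra_simps)
      finally show ?thesis .
    qed
    have fint: "(LINT x:D|lebesgue. (cmod (f x))^2) = L2_sq fb"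
    proof -
      have i: "integrable lebesgue (\<lambda>x. indicator D x *\<^sub>R (cmod (f x))\<^sup>2)"
        using f by (simp add: L2_on_def set_integrable_def)
      have ae: "AE x in lborel. indicator D x *\<^sub>R (cmod (f x))\<^sup>2 = (cmod (fb x))\<^sup>2"
        using fae by eventually_elim (auto simp: indicator_def)
      show ?thesis unfolding set_lebesgue_integral_def L2_sq_def
        by (rule lebesgue_lborel(1)[OF borel_measurable_integrable[OF i] _ ae]) measurable
    qed
    have "c * L2_sq fb \<le> Im z"
    proof -
      have "c * L2_sq fb \<le> c * (E * H)"
        using fH assms(1,10) E by (intro mult_left_mono) (auto simp: c_def)
      \<comment> \<open>The factor \<open>1 / (2 * \<kappa>\<^sup>2)\<close> is the one between the
        source and \<open>T_op\<close>; \<open>E\<close> cancels by the choice of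
        \<open>c\<close>.\<close>
      also have "\<dots> = 1 / (2 * \<kappa>\<^sup>2) * (\<kappa>^4 * \<alpha> * H)"
        using E assms(1) by (simp add: c_def field_simps power2_eq_square power4_eq_xxxx)
      also have "\<dots> \<le> 1 / (2 * \<kappa>\<^sup>2) * Im (LBINT x. Fb x * cnj (fb x))"
        using lower ImF Fh by (intro mult_left_mono) auto
      also have "\<dots> = Im z"
        unfolding z_def ipeq by (simp only: times_complex.simps Im_complex_of_real Re_complex_of_real)
      finally show ?thesis .
    qed
    then show "let q = (ipD D (T_op \<kappa> n f w) f - ipD D f (T_op \<kappa> n f w)) / (2 * \<i>)
            in Im q = 0 \<and> Re q \<ge> c * (LINT x:D|lebesgue. (cmod (f x))^2)"
      unfolding Let_def ipcnj z_def[symmetric] q fint by simp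
  qed
qed

end
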